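(* Let $V$ be a potential satisfying the standing assumptions on $V$ given in the context, and consider the linear Schrödinger equation $$i\frac{\partial}{\partial t}u=-\Delta u+V(x,t)u \qquad (x\in\mathbb T,\ t\in\mathbb R)$$ on $\mathbb T=[-\pi,\pi)$ with periodic boundary conditions. Then there exists $\varsigma>3$ such that for all $s>0$ there exists a constant $C_s$ such that for every initial condition $u(0)=u_0\in H^s(\mathbb T)$, the solution $u(t)$ satisfies $$\|u(t)\|_{H^s}\le C_s\,[\log(|t|+2)]^{\varsigma s}\,\|u(0)\|_{H^s}\qquad\text{for all } t\in\mathbb R.$$
   Context: $\mathbb T=[-\pi,\pi)$ with periodic boundary conditions (the circle), $\Delta=\partial_x^2$, and $H^s=H^s(\mathbb T)$ is the usual $L^2$-based Sobolev space with norm $\|f\|_{H^s}=\big(\sum_{j\in\mathbb Z}(1+j^2)^s|\hat f(j)|^2\big)^{1/2}$. Standing assumptions on $V$: $V:\mathbb R\times\mathbb R\to\mathbb R$, $(x,t)\mapsto V(x,t)$, is $2\pi$-periodic in $x$; it extends to a function analytic in $(x,t)$ in the complex strip $D=\{(x,t)\in\mathbb C^2: |\mathrm{Im}\,x|<\rho_0,\ |\mathrm{Im}\,t|<\rho_0\}$ for some $\rho_0>0$; it is real valued on $\mathbb R^2$; and it is bounded in $D$ (in particular $\|V\|_{\infty,\mathbb R^2}<\infty$). The constants $\varsigma$ and $C_s$ may depend on $V$. *)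

theory Defs
  imports "HOL-Analysis.Analysis"
begin

text \<open>Functions on the circle are functions on the reals of which only the values on the fundamental
  domain matter; periodicity is imposed on the test functions of the weak formulation below.\<close>

definition torus :: "real measure" where
  "torus = lebesgue_on {-pi..<pi}"

definition L2_torus :: "(real \<Rightarrow> complex) set" where
  "L2_torus = {f. f \<in> borel_measurable torus \<and> integrable torus (\<lambda>x. (cmod (f x))\<^sup>2)}"

definition fourier_coeff :: "(real \<Rightarrow> complex) \<Rightarrow> int \<Rightarrow> complex" where
  "fourier_coeff f j =
     complex_of_real (1 / (2 * pi)) * (LINT x|torus. f x * exp (- \<i> * of_int j * of_real x))"

text \<open>Only used for \<open>s \<ge> 0\<close>, where \<open>H\<^sup>s\<close> is a subspace of \<open>L\<^sup>2\<close>. The norm is meaningful only on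
  members of the space, since an infinite sum that diverges is \<open>0\<close>.\<close>

definition sobolev :: "real \<Rightarrow> (real \<Rightarrow> complex) set" where
  "sobolev s = {f \<in> L2_torus.
     (\<lambda>j::int. (1 + (real_of_int j)\<^sup>2) powr s * (cmod (fourier_coeff f j))\<^sup>2) summable_on UNIV}"

definition sobolev_norm :: "real \<Rightarrow> (real \<Rightarrow> complex) \<Rightarrow> real" where
  "sobolev_norm s f =
     sqrt (\<Sum>\<^sub>\<infinity>j::int. (1 + (real_of_int j)\<^sup>2) powr s * (cmod (fourier_coeff f j))\<^sup>2)"

definition complex_strip :: "real \<Rightarrow> (complex \<times> complex) set" where
  "complex_strip \<rho> = {(z, w). \<bar>Im z\<bar> < \<rho> \<and> \<bar>Im w\<bar> < \<rho>}"

definition analytic2_on :: "(complex \<times> complex \<Rightarrow> complex) \<Rightarrow> (complex \<times> complex) set \<Rightarrow> bool" where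
  "analytic2_on F D \<longleftrightarrow> (\<forall>(z0, w0)\<in>D. \<exists>r>0. \<exists>a :: nat \<Rightarrow> nat \<Rightarrow> complex.
     \<forall>z w. dist z z0 < r \<longrightarrow> dist w w0 < r \<longrightarrow>
       ((\<lambda>(m, n). a m n * (z - z0) ^ m * (w - w0) ^ n) has_sum F (z, w)) UNIV)"

definition analytic_potential :: "(real \<Rightarrow> real \<Rightarrow> real) \<Rightarrow> bool" where
  "analytic_potential V \<longleftrightarrow>
     (\<forall>x t. V (x + 2 * pi) t = V x t) \<and>
     (\<exists>\<rho>>0. \<exists>F. analytic2_on F (complex_strip \<rho>) \<and> bounded (F ` complex_strip \<rho>) \<and>
        (\<forall>x t. F (complex_of_real x, complex_of_real t) = complex_of_real (V x t)))"

text \<open>A smooth periodic test function is given together with all its derivatives: \<open>\<phi> k\<close> is the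
  \<open>k\<close>-th derivative of \<open>\<phi> 0\<close>.\<close>

definition test_function :: "(nat \<Rightarrow> real \<Rightarrow> complex) \<Rightarrow> bool" where
  "test_function \<phi> \<longleftrightarrow>
     (\<forall>k x. (\<phi> k has_vector_derivative \<phi> (Suc k) x) (at x)) \<and> (\<forall>x. \<phi> 0 (x + 2 * pi) = \<phi> 0 x)"

text \<open>\<open>u t x\<close> is the solution at time \<open>t\<close> and position \<open>x\<close>. It is a continuous curve in \<open>L\<^sup>2\<close> that
  satisfies \<open>\<i> \<partial>\<^sub>t u = - \<Delta> u + V u\<close> in the sense of periodic distributions in \<open>x\<close>, at every time:
  the Laplacian is moved to the test function, and the boundary terms vanish by periodicity.
  For data in \<open>H\<^sup>s\<close> with small \<open>s\<close> there is in general no classical solution.\<close>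

definition schrodinger_solution ::
    "(real \<Rightarrow> real \<Rightarrow> real) \<Rightarrow> (real \<Rightarrow> complex) \<Rightarrow> (real \<Rightarrow> real \<Rightarrow> complex) \<Rightarrow> bool" where
  "schrodinger_solution V u0 u \<longleftrightarrow>
     (\<forall>t. u t \<in> L2_torus) \<and>
     (\<forall>t0. ((\<lambda>t. LINT x|torus. (cmod (u t x - u t0 x))\<^sup>2) \<longlongrightarrow> 0) (at t0)) \<and>
     (AE x in torus. u 0 x = u0 x) \<and>
     (\<forall>\<phi>. test_function \<phi> \<longrightarrow> (\<forall>t. \<exists>d.
        ((\<lambda>\<tau>. LINT x|torus. u \<tau> x * \<phi> 0 x) has_vector_derivative d) (at t) \<and>
        \<i> * d = (LINT x|torus. u t x * (- \<phi> 2 x + complex_of_real (V x t) * \<phi> 0 x))))"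

end

(*
  In Fourier coefficients the equation couples the modes j and k through an entry that decays
  exponentially in |j - k| and is analytic in t, while the free energies j^2 and k^2 of modes on
  the two sides of a cutoff |j| = M differ by at least M. Hence the low modes can be continued to
  an almost invariant subspace {(a, X a)}, where X solves the Riccati equation
    i X' = H21 + H22 X - X H11 - X H12 X
  approximately. Each Riccati iteration divides by the gap M and, by Cauchy's estimate in a
  slightly smaller strip, loses only a factor proportional to the number of iterations, so about
  M iterations leave an error exp (- c M). An exact solution of the small system for a gives an
  approximate solution v = (a, X a) of the full equation. Since |u|^2, |v|^2 and <u, v> are almost
  conserved, the energy of u above frequency 2M at times |t| <= exp (c M) is controlled by its
  initial energy above frequency M / 2 plus exp (- c M). Summing over dyadic M >= C log |t| yields
  the bound.
*)
theory Submission
  imports Defs "HOL-Complex_Analysis.Complex_Analysis"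
begin

section \<open>Linear ordinary differential equations\<close>

text \<open>Each Riccati step differentiates in t and so consumes part of the strip. The iteration
  is therefore stopped when the strip is almost used up, and the residual is the last increment
  times the gap. Two choices make the estimates close. Matrix entries are measured against exp
  (-(\<theta>/2) (|j| - |k|)) instead of exp (-\<theta> |j - k|): this weight is multiplicative
  along chains of indices, so products keep it exactly, and the other half of the decay pays for the
  sums. The upper block is cut at 2M, which keeps every system finite and every gap below 4 M^2; the
  weight makes what leaks past 2M of size exp (-\<theta> M / 2). For data in H^s with small s the
  coefficients form a curve that is only continuous in l^2, although each coefficient is
  differentiable. Hence conservation of the norm is itself a limit argument, and u and v are
  compared through a finite pairing that can be differentiated term by term. The argument yields the
  first power of the logarithm for s = 1; the exponent 4 is chosen at the end to exceed 3.\<close>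

lemma antiderivative_exists:
  fixes f :: "real \<Rightarrow> complex"
  assumes "continuous_on UNIV f"
  shows "\<exists>F. F 0 = 0 \<and> (\<forall>t. (F has_vector_derivative f t) (at t))"
proof (rule exI[of _ "\<lambda>u. LBINT y=ereal 0..ereal u. f y"], intro conjI allI)
  let ?F = "\<lambda>u. LBINT y=ereal 0..ereal u. f y"
  show "?F 0 = 0" by simp
  fix t :: real
  have "(?F has_vector_derivative f t) (at t within {-\<bar>t\<bar>-1..\<bar>t\<bar>+1})"
    by (rule interval_integral_FTC2) (auto intro: continuous_on_subset[OF assms])
  moreover have "at t within {-\<bar>t\<bar>-1..\<bar>t\<bar>+1} = at t"
    by (rule at_within_interior) (auto simp: abs_if)
  ultimately show "(?F has_vector_derivative f t) (at t)" by simp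
qed

text \<open>One Picard step: integration turns |s|^n / n! into |t|^(n+1) / (n+1)!. Negative times
  are reduced to positive ones by reflecting F. The case n = 0 is the mean value inequality used
  later.\<close>

lemma antiderivative_power_bound:
  fixes F :: "real \<Rightarrow> 'a :: real_normed_vector"
  assumes F: "\<And>s. (F has_vector_derivative f s) (at s)" "F 0 = 0"
    and f: "\<And>s. \<bar>s\<bar> \<le> T \<Longrightarrow> norm (f s) \<le> C * \<bar>s\<bar> ^ n / fact n" and t: "\<bar>t\<bar> \<le> T"
  shows "norm (F t) \<le> C * \<bar>t\<bar> ^ Suc n / fact (Suc n)"
proof -
  have pos: "norm (G t) \<le> C * t ^ Suc n / fact (Suc n)"
    if G: "\<And>s. (G has_vector_derivative g s) (at s)" "G 0 = 0"
      and g: "\<And>s. \<bar>s\<bar> \<le> T \<Longrightarrow> norm (g s) \<le> C * \<bar>s\<bar> ^ n / fact n" and t: "0 \<le> t" "t \<le> T"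
    for G g :: "real \<Rightarrow> 'a" and t
  proof (cases "t = 0")
    case False
    have "norm (G t - G 0) \<le> C * t ^ Suc n / fact (Suc n) - C * 0 ^ Suc n / fact (Suc n)"
    proof (rule differentiable_bound_general[where f' = g and \<phi>' = "\<lambda>s. C * s ^ n / fact n"])
      show "0 < t" using t False by simp
      show "continuous_on {0..t} G"
        by (intro continuous_at_imp_continuous_on ballI) (meson G(1) has_vector_derivative_continuous)
      show "continuous_on {0..t} (\<lambda>s. C * s ^ Suc n / fact (Suc n))"
        by (intro continuous_intros) auto
      show "((\<lambda>s. C * s ^ Suc n / fact (Suc n)) has_vector_derivative C * s ^ n / fact n) (at s)" for s
      proof -
        have "((\<lambda>s. C * s ^ Suc n / fact (Suc n)) has_real_derivative C * (real (Suc n) * s ^ n) / fact (Suc n)) (at s)"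
          by (auto intro!: derivative_eq_intros simp del: power_Suc fact_Suc)
        also have "C * (real (Suc n) * s ^ n) / fact (Suc n) = C * s ^ n / fact n"
          by (simp add: fact_Suc del: of_nat_Suc)
        finally show ?thesis by (simp add: has_real_derivative_iff_has_vector_derivative)
      qed
      show "norm (g s) \<le> C * s ^ n / fact n" if "0 < s" "s < t" for s
        using g[of s] that t by auto
    qed (use G in auto)
    then show ?thesis using G(2) by simp
  qed (use G in auto)
  show ?thesis
  proof (cases "t \<ge> 0")
    case True then show ?thesis using pos[OF F f True] t by auto
  next
    case False
    have "((\<lambda>s. F (- s)) has_vector_derivative - f (- s)) (at s)" for s
    proof -
      have "((F \<circ> uminus) has_vector_derivative (-1) *\<^sub>R f (- s)) (at s)"
        by (rule vector_diff_chain_at) (auto intro!: derivative_eq_intros F)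
      then show ?thesis by (simp add: o_def)
    qed
    moreover have "norm (- f (- s)) \<le> C * \<bar>s\<bar> ^ n / fact n" if "\<bar>s\<bar> \<le> T" for s
      using f[of "- s"] that by simp
    ultimately have "norm (F (- (- t))) \<le> C * (- t) ^ Suc n / fact (Suc n)"
      using F(2) False t by (intro pos) auto
    then show ?thesis using False by (simp del: power_Suc fact_Suc)
  qed
qed

lemma uniform_limit_sum_finite:
  fixes f :: "'i \<Rightarrow> 'n \<Rightarrow> 'x \<Rightarrow> 'b :: real_normed_vector"
  assumes "\<And>i. i \<in> I \<Longrightarrow> uniform_limit S (f i) (g i) F"
  shows "uniform_limit S (\<lambda>n x. \<Sum>i\<in>I. f i n x) (\<lambda>x. \<Sum>i\<in>I. g i x) F"
  using assms by (induction I rule: infinite_finite_induct) (auto intro!: uniform_limit_const uniform_limit_add)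

text \<open>Picard iteration, written as the series of its increments. The factorials make it
  converge on every compact interval, so the solution is global although the coefficients are only
  continuous.\<close>

lemma linear_ode_exists:
  fixes A :: "'i \<Rightarrow> 'i \<Rightarrow> real \<Rightarrow> complex"
  assumes fin: "finite I" and cont: "\<And>j k. j \<in> I \<Longrightarrow> k \<in> I \<Longrightarrow> continuous_on UNIV (A j k)"
  shows "\<exists>a. \<forall>j\<in>I. a j 0 = a0 j \<and> (\<forall>t. (a j has_vector_derivative (\<Sum>k\<in>I. A j k t * a k t)) (at t))"
proof -
  define P :: "(real \<Rightarrow> complex) \<Rightarrow> real \<Rightarrow> complex"
    where "P f = (SOME F. F 0 = 0 \<and> (\<forall>t. (F has_vector_derivative f t) (at t)))" for f
  have P: "P f 0 = 0 \<and> (\<forall>t. (P f has_vector_derivative f t) (at t))" if "continuous_on UNIV f" for f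
    unfolding P_def by (rule someI_ex[OF antiderivative_exists[OF that]])
  \<comment> \<open>\<open>d n\<close> is the n-th increment: the constant initial vector, followed
    by antiderivatives of A times the previous increment.\<close>
  define d where "d = rec_nat (\<lambda>j t. a0 j) (\<lambda>n dn j. P (\<lambda>t. \<Sum>k\<in>I. A j k t * dn k t))"
  have d0: "d 0 = (\<lambda>j t. a0 j)" and dS: "\<And>n. d (Suc n) = (\<lambda>j. P (\<lambda>t. \<Sum>k\<in>I. A j k t * d n k t))"
    by (auto simp: d_def)
  have dcont: "continuous_on UNIV (d n j)" if "j \<in> I" for n j
    using that
  proof (induction n arbitrary: j)
    case (Suc n)
    have "continuous_on UNIV (\<lambda>t. \<Sum>k\<in>I. A j k t * d n k t)"
      using Suc cont by (intro continuous_intros) auto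
    from P[OF this] show ?case unfolding dS
      by (intro continuous_at_imp_continuous_on ballI) (meson has_vector_derivative_continuous)
  qed (simp add: d0)
  have dder: "(d (Suc n) j has_vector_derivative (\<Sum>k\<in>I. A j k t * d n k t)) (at t)" "d (Suc n) j 0 = 0"
    if "j \<in> I" for n j t
  proof -
    have "continuous_on UNIV (\<lambda>t. \<Sum>k\<in>I. A j k t * d n k t)"
      using that cont dcont by (intro continuous_intros) auto
    from P[OF this] show "(d (Suc n) j has_vector_derivative (\<Sum>k\<in>I. A j k t * d n k t)) (at t)" "d (Suc n) j 0 = 0"
      unfolding dS by auto
  qed
  have bound: "\<exists>C L. C \<ge> 0 \<and> L \<ge> 0 \<and> (\<forall>j\<in>I. \<forall>k\<in>I. \<forall>t. \<bar>t\<bar> \<le> T \<longrightarrow> norm (A j k t) \<le> L) \<and>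
     (\<forall>n. \<forall>j\<in>I. \<forall>t. \<bar>t\<bar> \<le> T \<longrightarrow> norm (d n j t) \<le> C * (real (card I) * L) ^ n * \<bar>t\<bar> ^ n / fact n)" for T
  proof -
    have "\<exists>L. \<forall>t. \<bar>t\<bar> \<le> T \<longrightarrow> norm (A j k t) \<le> L" if "j \<in> I" "k \<in> I" for j k
    proof -
      have "compact (A j k ` {-T..T})"
        by (intro compact_continuous_image continuous_on_subset[OF cont[OF that]]) auto
      then have "bounded (A j k ` {-T..T})" by (rule compact_imp_bounded)
      then obtain L where "\<forall>x\<in>A j k ` {-T..T}. norm x \<le> L" by (auto simp: bounded_iff)
      then show ?thesis by (intro exI[of _ L]) (auto simp: abs_le_iff)
    qed
    then obtain Lf where Lf: "\<And>j k t. j \<in> I \<Longrightarrow> k \<in> I \<Longrightarrow> \<bar>t\<bar> \<le> T \<Longrightarrow> norm (A j k t) \<le> Lf j k"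
      by metis
    define L where "L = (\<Sum>j\<in>I. \<Sum>k\<in>I. \<bar>Lf j k\<bar>)"
    have L: "norm (A j k t) \<le> L" if "j \<in> I" "k \<in> I" "\<bar>t\<bar> \<le> T" for j k t
    proof -
      have "norm (A j k t) \<le> \<bar>Lf j k\<bar>" using Lf[OF that] by simp
      also have "\<dots> \<le> (\<Sum>k\<in>I. \<bar>Lf j k\<bar>)" using fin that by (intro member_le_sum) auto
      also have "\<dots> \<le> L" unfolding L_def using fin that
        by (intro member_le_sum[of j I "\<lambda>j. \<Sum>k\<in>I. \<bar>Lf j k\<bar>"]) (auto intro: sum_nonneg)
      finally show ?thesis .
    qed
    have L0: "L \<ge> 0" unfolding L_def by (intro sum_nonneg) auto
    define C where "C = (\<Sum>j\<in>I. norm (a0 j))"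
    have C0: "C \<ge> 0" unfolding C_def by (intro sum_nonneg) auto
    have "norm (d n j t) \<le> C * (real (card I) * L) ^ n * \<bar>t\<bar> ^ n / fact n"
      if "j \<in> I" "\<bar>t\<bar> \<le> T" for n j t
      using that
    proof (induction n arbitrary: j t)
      case 0
      then show ?case using fin by (auto simp: d0 C_def intro!: member_le_sum[of j I "\<lambda>j. norm (a0 j)"])
    next
      case (Suc n)
      have "norm (d (Suc n) j t) \<le> (C * (real (card I) * L) ^ Suc n) * \<bar>t\<bar> ^ Suc n / fact (Suc n)"
      proof (rule antiderivative_power_bound[OF dder(1)[OF Suc.prems(1)] dder(2)[OF Suc.prems(1)] _ Suc.prems(2)])
        fix s :: real assume s: "\<bar>s\<bar> \<le> T"
        have "norm (\<Sum>k\<in>I. A j k s * d n k s) \<le> (\<Sum>k\<in>I. L * (C * (real (card I) * L) ^ n * \<bar>s\<bar> ^ n / fact n))"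
        proof (rule sum_norm_le)
          fix k assume k: "k \<in> I"
          show "norm (A j k s * d n k s) \<le> L * (C * (real (card I) * L) ^ n * \<bar>s\<bar> ^ n / fact n)"
            unfolding norm_mult by (intro mult_mono L Suc.IH Suc.prems k s L0) auto
        qed
        then show "norm (\<Sum>k\<in>I. A j k s * d n k s) \<le> C * (real (card I) * L) ^ Suc n * \<bar>s\<bar> ^ n / fact n"
          by (simp add: mult_ac)
      qed
      then show ?case by (simp add: mult_ac)
    qed
    then show ?thesis using L L0 C0 by blast
  qed
  define a where "a j t = (\<Sum>n. d n j t)" for j t
  have unif: "uniform_limit {-T..T} (\<lambda>n t. \<Sum>i<n. d i j t) (a j) sequentially" if "j \<in> I" for j T
  proof -
    from bound[of T] obtain C L where CL: "C \<ge> 0" "L \<ge> 0"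
      "\<And>n j t. j \<in> I \<Longrightarrow> \<bar>t\<bar> \<le> T \<Longrightarrow> norm (d n j t) \<le> C * (real (card I) * L) ^ n * \<bar>t\<bar> ^ n / fact n" by metis
    show ?thesis unfolding a_def
    proof (rule Weierstrass_m_test[where M = "\<lambda>n. C * ((real (card I) * L * \<bar>T\<bar>) ^ n / fact n)"])
      fix n t assume t: "t \<in> {-T..T}"
      then have tT: "\<bar>t\<bar> \<le> T" by auto
      have "norm (d n j t) \<le> C * (real (card I) * L) ^ n * \<bar>t\<bar> ^ n / fact n"
        by (rule CL(3)[OF that tT])
      also have "\<dots> \<le> C * (real (card I) * L) ^ n * \<bar>T\<bar> ^ n / fact n"
        using CL tT by (intro divide_right_mono mult_left_mono power_mono) auto
      finally show "norm (d n j t) \<le> C * ((real (card I) * L * \<bar>T\<bar>) ^ n / fact n)"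
        by (simp add: power_mult_distrib)
    next
      show "summable (\<lambda>n. C * ((real (card I) * L * \<bar>T\<bar>) ^ n / fact n))"
        using summable_exp[of "real (card I) * L * \<bar>T\<bar>"] by (intro summable_mult) (simp add: field_simps)
    qed
  qed
  have sums: "(\<lambda>n. d n j t) sums a j t" if "j \<in> I" for j t
  proof -
    have "t \<in> {-\<bar>t\<bar>..\<bar>t\<bar>}" by auto
    from tendsto_uniform_limitI[OF unif[OF that] this] show ?thesis by (simp add: sums_def)
  qed
  have der: "(a j has_vector_derivative (\<Sum>k\<in>I. A j k t * a k t)) (at t)" if j: "j \<in> I" for j t
  proof -
    define T where "T = \<bar>t\<bar> + 1"
    \<comment> \<open>The derivative of \<open>d 0\<close> is 0, which shifts the index by one: n +
      1 differentiated terms sum to A applied to the first n terms. This identifies the limit of the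
      derivatives as A a.\<close>
    define f' where "f' n x = (case n of 0 \<Rightarrow> 0 | Suc n \<Rightarrow> (\<Sum>k\<in>I. A j k x * d n k x))" for n x
    have f'_sum: "(\<Sum>i<Suc n. f' i x) = (\<Sum>k\<in>I. A j k x * (\<Sum>i<n. d i k x))" for n x
    proof -
      have "(\<Sum>i<Suc n. f' i x) = (\<Sum>i<n. \<Sum>k\<in>I. A j k x * d i k x)"
        by (subst sum.lessThan_Suc_shift) (simp add: f'_def)
      also have "\<dots> = (\<Sum>k\<in>I. \<Sum>i<n. A j k x * d i k x)" by (rule sum.swap)
      finally show ?thesis by (simp add: sum_distrib_left)
    qed
    have ul: "uniform_limit {-T..T} (\<lambda>n x. \<Sum>i<n. f' i x) (\<lambda>x. \<Sum>k\<in>I. A j k x * a k x) sequentially"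
    proof -
      have "uniform_limit {-T..T} (\<lambda>n x. \<Sum>k\<in>I. A j k x * (\<Sum>i<n. d i k x)) (\<lambda>x. \<Sum>k\<in>I. A j k x * a k x) sequentially"
      proof (rule uniform_limit_sum_finite)
        fix k assume k: "k \<in> I"
        have c1: "bounded (A j k ` {-T..T})"
          by (intro compact_imp_bounded compact_continuous_image continuous_on_subset[OF cont[OF j k]]) auto
        have "continuous_on {-T..T} (a k)"
          by (rule uniform_limit_theorem[OF _ unif[OF k]])
            (auto intro!: always_eventually continuous_intros continuous_on_subset[OF dcont[OF k]])
        then have c2: "bounded (a k ` {-T..T})"
          by (intro compact_imp_bounded compact_continuous_image) auto
        show "uniform_limit {-T..T} (\<lambda>n x. A j k x * (\<Sum>i<n. d i k x)) (\<lambda>x. A j k x * a k x) sequentially"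
          by (rule uniform_lim_mult[OF uniform_limit_const unif[OF k] c1 c2])
      qed
      then have "uniform_limit {-T..T} (\<lambda>n x. \<Sum>i<Suc n. f' i x) (\<lambda>x. \<Sum>k\<in>I. A j k x * a k x) sequentially"
        by (simp only: f'_sum)
      then show ?thesis
        using filterlim_sequentially_Suc[of "\<lambda>n x. \<Sum>i<n. f' i x"]
        unfolding uniform_limit_iff eventually_sequentially_Suc[of "\<lambda>n. \<forall>x\<in>{-T..T}. dist (\<Sum>i<n. f' i x) _ < _"]
        by (subst (asm) eventually_sequentially_Suc) blast
    qed
    have "\<exists>g. \<forall>x\<in>{-T..T}. (\<lambda>n. d n j x) sums g x \<and>
      (g has_derivative (\<lambda>h. h *\<^sub>R (\<Sum>k\<in>I. A j k x * a k x))) (at x within {-T..T})"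
    proof (rule has_derivative_series[where f' = "\<lambda>n x h. h *\<^sub>R f' n x" and x = 0])
      show "(d n j has_derivative (\<lambda>h. h *\<^sub>R f' n x)) (at x within {-T..T})" for n x
      proof (cases n)
        case 0 then show ?thesis by (simp add: d0 f'_def)
      next
        case (Suc m)
        then show ?thesis using dder(1)[OF j, of m x] unfolding has_vector_derivative_def f'_def
          by (auto intro: has_derivative_at_withinI)
      qed
      show "\<forall>\<^sub>F n in sequentially. \<forall>x\<in>{-T..T}. \<forall>h. norm ((\<Sum>i<n. h *\<^sub>R f' i x) - h *\<^sub>R (\<Sum>k\<in>I. A j k x * a k x)) \<le> e * norm h"
        if "e > 0" for e
        using uniform_limitD[OF ul that]
      proof eventually_elim
        case (elim n)
        show ?case
        proof (intro ballI allI)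
          fix x h :: real assume "x \<in> {-T..T}"
          then have "norm ((\<Sum>i<n. f' i x) - (\<Sum>k\<in>I. A j k x * a k x)) \<le> e"
            using elim by (force simp: dist_norm)
          then have "\<bar>h\<bar> * norm ((\<Sum>i<n. f' i x) - (\<Sum>k\<in>I. A j k x * a k x)) \<le> \<bar>h\<bar> * e"
            by (intro mult_left_mono) auto
          then show "norm ((\<Sum>i<n. h *\<^sub>R f' i x) - h *\<^sub>R (\<Sum>k\<in>I. A j k x * a k x)) \<le> e * norm h"
            by (simp add: scaleR_sum_right[symmetric] scaleR_diff_right[symmetric] mult.commute)
        qed
      qed
      show "(\<lambda>n. d n j 0) sums a j 0" by (rule sums[OF j])
    qed (auto simp: T_def)
    then obtain g where g: "\<And>x. x \<in> {-T..T} \<Longrightarrow> (\<lambda>n. d n j x) sums g x"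
      "\<And>x. x \<in> {-T..T} \<Longrightarrow> (g has_derivative (\<lambda>h. h *\<^sub>R (\<Sum>k\<in>I. A j k x * a k x))) (at x within {-T..T})" by blast
    have tT: "t \<in> {-T..T}" by (auto simp: T_def)
    have ga: "g x = a j x" if "x \<in> {-T..T}" for x using sums_unique2[OF g(1)[OF that] sums[OF j]] .
    have "at t within {-T..T} = at t"
      by (rule at_within_interior) (auto simp: T_def abs_if)
    moreover have "(a j has_derivative (\<lambda>h. h *\<^sub>R (\<Sum>k\<in>I. A j k t * a k t))) (at t within {-T..T})"
      by (rule has_derivative_transform[OF tT _ g(2)[OF tT]]) (simp add: ga)
    ultimately show ?thesis by (simp add: has_vector_derivative_def)
  qed
  have init: "a j 0 = a0 j" if "j \<in> I" for j
  proof -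
    have "d n j 0 = (if n = 0 then a0 j else 0)" for n
      using dder(2)[OF that] by (cases n) (auto simp: d0)
    then have "(\<lambda>n. d n j 0) sums a0 j" using sums_If_finite_set[of "{0}" "\<lambda>_. a0 j"] by simp
    then show ?thesis using sums[OF that, of 0] sums_unique2 by blast
  qed
  show ?thesis using der init by blast
qed

section \<open>An approximate Riccati solution\<close>

text \<open>Twice the one-sided geometric series in exp (-\<tau>). It counts the central term twice
  and so bounds the sum over all integers.\<close>

definition geo :: "real \<Rightarrow> real" where "geo \<tau> = 2 / (1 - exp (- \<tau>))"

lemma geo_pos: "\<tau> > 0 \<Longrightarrow> geo \<tau> > 0"
  by (simp add: geo_def)

text \<open>On either side of j the distances |j - l| are distinct naturals, so each half is part of
  a geometric series. The bound depends neither on j nor on the set, as row sums of convolution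
  kernels require.\<close>

lemma sum_exp_abs_le_geo:
  fixes j :: int
  assumes "\<tau> > 0" "finite A"
  shows "(\<Sum>l\<in>A. exp (- \<tau> * \<bar>real_of_int (j - l)\<bar>)) \<le> geo \<tau>"
proof -
  have half: "(\<Sum>l\<in>B. exp (- \<tau> * \<bar>real_of_int (j - l)\<bar>)) \<le> 1 / (1 - exp (- \<tau>))"
    if fin: "finite B" and inj: "inj_on (\<lambda>l. nat \<bar>j - l\<bar>) B" for B
  proof -
    have "(\<Sum>l\<in>B. exp (- \<tau> * \<bar>real_of_int (j - l)\<bar>)) = (\<Sum>n\<in>(\<lambda>l. nat \<bar>j - l\<bar>) ` B. exp (- \<tau>) ^ n)"
      by (subst sum.reindex[OF inj]) (simp add: exp_of_nat_mult[symmetric] mult.commute)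
    also have "\<dots> \<le> (\<Sum>n. exp (- \<tau>) ^ n)"
      using assms(1) fin by (intro sum_le_suminf summable_geometric) auto
    also have "\<dots> = 1 / (1 - exp (- \<tau>))"
      using assms(1) by (intro suminf_geometric) auto
    finally show ?thesis .
  qed
  have "(\<Sum>l\<in>A. exp (- \<tau> * \<bar>real_of_int (j - l)\<bar>)) =
     (\<Sum>l\<in>A \<inter> {..j}. exp (- \<tau> * \<bar>real_of_int (j - l)\<bar>)) + (\<Sum>l\<in>A - {..j}. exp (- \<tau> * \<bar>real_of_int (j - l)\<bar>))"
    using assms(2) by (rule sum.Int_Diff)
  also have "\<dots> \<le> 1 / (1 - exp (- \<tau>)) + 1 / (1 - exp (- \<tau>))"
    using assms(2) by (intro add_mono half) (auto simp: inj_on_def)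
  finally show ?thesis by (simp add: geo_def)
qed

section \<open>Holomorphic functions on horizontal strips\<close>

definition strip :: "real \<Rightarrow> complex set" where "strip r = {w. \<bar>Im w\<bar> < r}"

lemma open_strip: "open (strip r)"
proof -
  have "strip r = {w. Im w < r} \<inter> {w. - r < Im w}" by (auto simp: strip_def)
  then show ?thesis by (simp add: open_Int open_halfspace_Im_gt open_halfspace_Im_lt)
qed

lemma strip_mono: "r \<le> r' \<Longrightarrow> strip r \<subseteq> strip r'"
  by (auto simp: strip_def)

lemma convex_strip: "convex (strip r)"
proof -
  have "strip r = {w. Im w < r} \<inter> {w. - r < Im w}" by (auto simp: strip_def)
  then show ?thesis by (simp add: convex_Int convex_halfspace_Im_gt convex_halfspace_Im_lt)
qed

lemma cball_subset_strip:
  assumes "w \<in> strip (r - \<delta>)"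
  shows "cball w \<delta> \<subseteq> strip r"
proof
  fix z assume "z \<in> cball w \<delta>"
  then have "\<bar>Im (z - w)\<bar> \<le> \<delta>" using abs_Im_le_cmod[of "z - w"] by (auto simp: dist_norm norm_minus_commute)
  then show "z \<in> strip r" using assms by (auto simp: strip_def)
qed

text \<open>Cauchy's estimate on a disc of radius \<delta>: a derivative costs width \<delta> and a
  factor 1 / \<delta>, with no other loss.\<close>

lemma deriv_bound_strip:
  assumes "g holomorphic_on strip r" "\<And>w. w \<in> strip r \<Longrightarrow> cmod (g w) \<le> K" "\<delta> > 0" "w \<in> strip (r - \<delta>)"
  shows "cmod (deriv g w) \<le> K / \<delta>"
proof -
  note sub = cball_subset_strip[OF assms(4)]
  have "cmod ((deriv ^^ 1) g w) \<le> fact 1 * K / \<delta> ^ 1"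
  proof (rule Cauchy_inequality)
    show "g holomorphic_on ball w \<delta>" using assms(1) sub ball_subset_cball holomorphic_on_subset by blast
    show "continuous_on (cball w \<delta>) g" using assms(1) sub holomorphic_on_imp_continuous_on continuous_on_subset by blast
    show "cmod (g x) \<le> K" if "cmod (w - x) = \<delta>" for x
      using that sub by (intro assms(2)) (auto simp: dist_norm)
  qed (use assms(3) in auto)
  then show ?thesis by simp
qed

section \<open>Frequency blocks\<close>

definition lo :: "nat \<Rightarrow> int set" where "lo M = {k. \<bar>k\<bar> < int M}"
definition hi :: "nat \<Rightarrow> int set" where "hi M = {j. int M \<le> \<bar>j\<bar> \<and> \<bar>j\<bar> < 2 * int M}"

lemma lo_eq: "lo M = {- int M <..< int M}"
  by (auto simp: lo_def)

lemma finite_lo [simp]: "finite (lo M)"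
  by (simp add: lo_eq)

lemma hi_subset: "hi M \<subseteq> lo (2 * M)"
  by (auto simp: lo_def hi_def)

lemma finite_hi [simp]: "finite (hi M)"
  using hi_subset finite_lo by (rule finite_subset)

lemma card_lo: "card (lo M) \<le> 2 * M"
  by (simp add: lo_eq)

lemma card_hi: "card (hi M) \<le> 4 * M"
 using card_mono[OF finite_lo hi_subset, of M] card_lo[of "2 * M"] by linarith

text \<open>j^2 - k^2 = (|j| - |k|) (|j| + |k|), where the first factor is at least 1 and the second
  at least M. The lower bound drives the contraction; the upper one enters when an increment is
  converted back into a residual.\<close>

lemma gap_bounds:
  assumes "j \<in> hi M" "k \<in> lo M"
  shows "real M \<le> real_of_int (j\<^sup>2 - k\<^sup>2)" "real_of_int (j\<^sup>2 - k\<^sup>2) \<le> 4 * (real M)\<^sup>2"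
proof -
  have jk: "int M \<le> \<bar>j\<bar>" "\<bar>j\<bar> < 2 * int M" "\<bar>k\<bar> < int M" using assms by (auto simp: hi_def lo_def)
  have eq: "j\<^sup>2 - k\<^sup>2 = (\<bar>j\<bar> - \<bar>k\<bar>) * (\<bar>j\<bar> + \<bar>k\<bar>)" by (simp add: algebra_simps power2_eq_square flip: abs_mult)
  have "1 * int M \<le> (\<bar>j\<bar> - \<bar>k\<bar>) * (\<bar>j\<bar> + \<bar>k\<bar>)" using jk by (intro mult_mono) auto
  then show "real M \<le> real_of_int (j\<^sup>2 - k\<^sup>2)" unfolding eq by linarith
  have "\<bar>j\<bar>\<^sup>2 \<le> (2 * int M)\<^sup>2" using jk by (intro power_mono) auto
  then have "j\<^sup>2 - k\<^sup>2 \<le> 4 * (int M)\<^sup>2" by (simp add: power_mult_distrib) (smt (verit) zero_le_power2)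
  then have "real_of_int (j\<^sup>2 - k\<^sup>2) \<le> real_of_int (4 * (int M)\<^sup>2)" by (simp only: of_int_le_iff)
  then show "real_of_int (j\<^sup>2 - k\<^sup>2) \<le> 4 * (real M)\<^sup>2" by simp
qed

text \<open>The potential reduced to its Fourier coefficients in x, as functions of complex time:
  analyticity in t becomes holomorphy on a strip, analyticity in x becomes exponential decay in m.
  Reality of V is the symmetry \<open>sym\<close>; it is stated on the real axis because conjugation
  does not preserve holomorphy.\<close>

locale exp_potential =
  fixes W :: "int \<Rightarrow> complex \<Rightarrow> complex" and \<rho> \<theta> B :: real
  assumes rho: "\<rho> > 0" and theta: "\<theta> > 0" and B: "B > 0"
    and hol: "\<And>m. W m holomorphic_on strip \<rho>"
    and bound: "\<And>m w. w \<in> strip \<rho> \<Longrightarrow> cmod (W m w) \<le> B * exp (- \<theta> * \<bar>real_of_int m\<bar>)"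
    and sym: "\<And>m t. W (- m) (complex_of_real t) = cnj (W m (complex_of_real t))"
begin

text \<open>A ratio of exponential weights at j and k, hence exactly multiplicative under
  composition (\<open>wt_mult\<close>). It is at most 1 when |k| \<le> |j| and may be large
  otherwise.\<close>

definition wt :: "int \<Rightarrow> int \<Rightarrow> real" where
  "wt j k = exp (- (\<theta> / 2) * (\<bar>real_of_int j\<bar> - \<bar>real_of_int k\<bar>))"

abbreviation S :: real where "S \<equiv> geo (\<theta> / 2)"

lemma S_pos: "S > 0" using theta by (intro geo_pos) simp

lemma wt_pos: "wt j k > 0" by (simp add: wt_def)

lemma wt_mult: "wt j l * wt l k = wt j k"
  by (simp add: wt_def field_simps flip: exp_add)

text \<open>The decay rate \<theta> is split in two. Half becomes the weight because |j| - |k| \<le>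
  |j - k|; the other half stays as a summable kernel.\<close>

lemma bound_wt:
  assumes "w \<in> strip \<rho>"
  shows "cmod (W (j - k) w) \<le> B * wt j k * exp (- (\<theta> / 2) * \<bar>real_of_int (j - k)\<bar>)"
proof -
  have "\<theta> * (\<bar>real_of_int j\<bar> - \<bar>real_of_int k\<bar>) \<le> \<theta> * \<bar>real_of_int (j - k)\<bar>"
    using theta by (intro mult_left_mono) auto
  then have "exp (- \<theta> * \<bar>real_of_int (j - k)\<bar>) \<le> wt j k * exp (- (\<theta> / 2) * \<bar>real_of_int (j - k)\<bar>)"
    by (simp add: wt_def field_simps flip: exp_add)
  then have "B * exp (- \<theta> * \<bar>real_of_int (j - k)\<bar>) \<le> B * (wt j k * exp (- (\<theta> / 2) * \<bar>real_of_int (j - k)\<bar>))"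
    using B by (intro mult_left_mono) auto
  then show ?thesis using bound[OF assms, of "j - k"] by (simp add: mult_ac)
qed

lemma sum_left:
  assumes "w \<in> strip \<rho>" "finite A" "p \<ge> 0" "\<And>l. l \<in> A \<Longrightarrow> cmod (Q l) \<le> p * wt l k"
  shows "cmod (\<Sum>l\<in>A. W (j - l) w * Q l) \<le> p * B * S * wt j k"
proof -
  have "cmod (\<Sum>l\<in>A. W (j - l) w * Q l) \<le> (\<Sum>l\<in>A. p * B * wt j k * exp (- (\<theta> / 2) * \<bar>real_of_int (j - l)\<bar>))"
  proof (rule sum_norm_le)
    fix l assume l: "l \<in> A"
    have "cmod (W (j - l) w * Q l) \<le> (B * wt j l * exp (- (\<theta> / 2) * \<bar>real_of_int (j - l)\<bar>)) * (p * wt l k)"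
      unfolding norm_mult using B assms(3) by (intro mult_mono bound_wt assms l) (auto simp: less_imp_le[OF wt_pos])
    also have "\<dots> = p * B * (wt j l * wt l k) * exp (- (\<theta> / 2) * \<bar>real_of_int (j - l)\<bar>)" by (simp add: mult_ac)
    finally show "cmod (W (j - l) w * Q l) \<le> p * B * wt j k * exp (- (\<theta> / 2) * \<bar>real_of_int (j - l)\<bar>)"
      by (simp add: wt_mult)
  qed
  also have "\<dots> = p * B * wt j k * (\<Sum>l\<in>A. exp (- (\<theta> / 2) * \<bar>real_of_int (j - l)\<bar>))"
    by (simp add: sum_distrib_left)
  also have "\<dots> \<le> p * B * wt j k * S"
    using assms B theta wt_pos[of j k] by (intro mult_left_mono sum_exp_abs_le_geo) auto
  finally show ?thesis by (simp add: mult_ac)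
qed

lemma sum_right:
  assumes "w \<in> strip \<rho>" "finite A" "p \<ge> 0" "\<And>l. l \<in> A \<Longrightarrow> cmod (Q l) \<le> p * wt j l"
  shows "cmod (\<Sum>l\<in>A. Q l * W (l - k) w) \<le> p * B * S * wt j k"
proof -
  have "cmod (\<Sum>l\<in>A. Q l * W (l - k) w) \<le> (\<Sum>l\<in>A. p * B * wt j k * exp (- (\<theta> / 2) * \<bar>real_of_int (k - l)\<bar>))"
  proof (rule sum_norm_le)
    fix l assume l: "l \<in> A"
    have "cmod (Q l * W (l - k) w) \<le> (p * wt j l) * (B * wt l k * exp (- (\<theta> / 2) * \<bar>real_of_int (l - k)\<bar>))"
      unfolding norm_mult using B assms(3) by (intro mult_mono bound_wt assms l) (auto simp: less_imp_le[OF wt_pos])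
    also have "\<dots> = p * B * (wt j l * wt l k) * exp (- (\<theta> / 2) * \<bar>real_of_int (k - l)\<bar>)"
      by (simp add: mult_ac abs_minus_commute)
    finally show "cmod (Q l * W (l - k) w) \<le> p * B * wt j k * exp (- (\<theta> / 2) * \<bar>real_of_int (k - l)\<bar>)"
      by (simp add: wt_mult)
  qed
  also have "\<dots> = p * B * wt j k * (\<Sum>l\<in>A. exp (- (\<theta> / 2) * \<bar>real_of_int (k - l)\<bar>))"
    by (simp add: sum_distrib_left)
  also have "\<dots> \<le> p * B * wt j k * S"
    using assms B theta wt_pos[of j k] by (intro mult_left_mono sum_exp_abs_le_geo) auto
  finally show ?thesis by (simp add: mult_ac)
qed

text \<open>The sum over \<open>lo M\<close> uses the summable kernel through
  \<open>sum_right\<close>. Nothing summable is left for \<open>hi M\<close>, so that sum costs its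
  cardinality, at most 4M. This is affordable because p or q will be of order 1 / M.\<close>

lemma sum_quad:
  assumes "w \<in> strip \<rho>" "p \<ge> 0" "q \<ge> 0" "\<And>l. l \<in> lo M \<Longrightarrow> cmod (P l) \<le> p * wt j l"
    "\<And>m. m \<in> hi M \<Longrightarrow> cmod (Q m) \<le> q * wt m k"
  shows "cmod (\<Sum>l\<in>lo M. \<Sum>m\<in>hi M. P l * W (l - m) w * Q m) \<le> p * q * (4 * real M) * B * S * wt j k"
proof -
  have "(\<Sum>l\<in>lo M. \<Sum>m\<in>hi M. P l * W (l - m) w * Q m) = (\<Sum>m\<in>hi M. (\<Sum>l\<in>lo M. P l * W (l - m) w) * Q m)"
    by (subst sum.swap) (simp add: sum_distrib_right)
  also have "cmod \<dots> \<le> (\<Sum>m\<in>hi M. p * B * S * q * wt j k)"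
  proof (rule sum_norm_le)
    fix m assume m: "m \<in> hi M"
    have "cmod ((\<Sum>l\<in>lo M. P l * W (l - m) w) * Q m) \<le> (p * B * S * wt j m) * (q * wt m k)"
      unfolding norm_mult using assms m B S_pos
      by (intro mult_mono sum_right m) (auto intro!: mult_nonneg_nonneg less_imp_le[OF wt_pos])
    also have "\<dots> = p * B * S * q * (wt j m * wt m k)" by (simp only: mult_ac)
    finally show "cmod ((\<Sum>l\<in>lo M. P l * W (l - m) w) * Q m) \<le> p * B * S * q * wt j k"
      by (simp only: wt_mult)
  qed
  also have "\<dots> = real (card (hi M)) * (p * B * S * q * wt j k)" by simp
  also have "\<dots> \<le> (4 * real M) * (p * B * S * q * wt j k)"
    using card_hi[of M] assms B S_pos wt_pos[of j k] by (intro mult_right_mono) (auto simp: of_nat_mono[of _ "4 * M", simplified])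
  finally show ?thesis by (simp add: mult_ac)
qed

text \<open>Fixed points of \<open>riccati M\<close> are the \<open>X\<close> whose graphs are invariant. The denominator is the
  gap between the free energies, so the map contracts with rate proportional to \<open>1 / M\<close>.\<close>

definition riccati :: "nat \<Rightarrow> (int \<Rightarrow> int \<Rightarrow> complex \<Rightarrow> complex) \<Rightarrow> int \<Rightarrow> int \<Rightarrow> complex \<Rightarrow> complex" where
  "riccati M X j k w = (\<i> * deriv (X j k) w - W (j - k) w - (\<Sum>l\<in>hi M. W (j - l) w * X l k w)
     + (\<Sum>l\<in>lo M. X j l w * W (l - k) w)
     + (\<Sum>l\<in>lo M. \<Sum>m\<in>hi M. X j l w * W (l - m) w * X m k w)) / of_real (real_of_int (j\<^sup>2 - k\<^sup>2))"

lemma gap_nonzero: "j \<in> hi M \<Longrightarrow> k \<in> lo M \<Longrightarrow> real_of_int (j\<^sup>2 - k\<^sup>2) \<noteq> 0"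
  using gap_bounds(1)[of j M k] by (auto simp: lo_def)

lemma riccati_holomorphic:
  assumes "\<And>j k. j \<in> hi M \<Longrightarrow> k \<in> lo M \<Longrightarrow> X j k holomorphic_on strip r" "r \<le> \<rho>" "j \<in> hi M" "k \<in> lo M"
  shows "riccati M X j k holomorphic_on strip r"
proof -
  have W: "W m holomorphic_on strip r" for m
    using hol holomorphic_on_subset strip_mono[OF assms(2)] by blast
  show ?thesis unfolding riccati_def[abs_def]
    using assms gap_nonzero[OF assms(3,4)]
    by (intro holomorphic_intros W open_strip assms(1)) auto
qed

text \<open>The derivative term costs 1 / \<delta> by Cauchy, each linear term costs B S, and the
  quadratic term is split as (X - Y) W X + Y W (X - Y). In the latter the bound K / M cancels the
  factor 4M of \<open>sum_quad\<close>, leaving 8 K B S in total. Division by the gap supplies 1 /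
  M.\<close>

lemma riccati_contraction:
  assumes X: "\<And>j k. j \<in> hi M \<Longrightarrow> k \<in> lo M \<Longrightarrow> X j k holomorphic_on strip r"
    and Y: "\<And>j k. j \<in> hi M \<Longrightarrow> k \<in> lo M \<Longrightarrow> Y j k holomorphic_on strip r"
    and Xb: "\<And>j k w. j \<in> hi M \<Longrightarrow> k \<in> lo M \<Longrightarrow> w \<in> strip r \<Longrightarrow> cmod (X j k w) \<le> K / M * wt j k"
    and Yb: "\<And>j k w. j \<in> hi M \<Longrightarrow> k \<in> lo M \<Longrightarrow> w \<in> strip r \<Longrightarrow> cmod (Y j k w) \<le> K / M * wt j k"
    and D: "\<And>j k w. j \<in> hi M \<Longrightarrow> k \<in> lo M \<Longrightarrow> w \<in> strip r \<Longrightarrow> cmod (X j k w - Y j k w) \<le> \<mu> * wt j k"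
    and r: "r \<le> \<rho>" "\<delta> > 0" and pos: "\<mu> \<ge> 0" "K \<ge> 0" "M > 0"
    and jk: "j \<in> hi M" "k \<in> lo M" and w: "w \<in> strip (r - \<delta>)"
  shows "cmod (riccati M X j k w - riccati M Y j k w) \<le> \<mu> / M * (1 / \<delta> + 2 * B * S + 8 * K * B * S) * wt j k"
proof -
  have ws: "w \<in> strip r" and w\<rho>: "w \<in> strip \<rho>" using w r by (auto simp: strip_def)
  let ?g = "real_of_int (j\<^sup>2 - k\<^sup>2)"
  define Q where "Q X = \<i> * deriv (X j k) w - W (j - k) w - (\<Sum>l\<in>hi M. W (j - l) w * X l k w)
     + (\<Sum>l\<in>lo M. X j l w * W (l - k) w)
     + (\<Sum>l\<in>lo M. \<Sum>m\<in>hi M. X j l w * W (l - m) w * X m k w)" for X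
  have hD: "(\<lambda>z. X j k z - Y j k z) holomorphic_on strip r"
    by (intro holomorphic_intros X Y jk)
  have dX: "X j k field_differentiable at w" and dY: "Y j k field_differentiable at w"
    using X[OF jk] Y[OF jk] open_strip ws holomorphic_on_imp_differentiable_at by blast+
  have t1: "cmod (\<i> * (deriv (X j k) w - deriv (Y j k) w)) \<le> \<mu> * wt j k / \<delta>"
    using deriv_bound_strip[OF hD D[OF jk] r(2) w] dX dY by (simp add: norm_mult deriv_diff)
  have t2: "cmod (\<Sum>l\<in>hi M. W (j - l) w * (X l k w - Y l k w)) \<le> \<mu> * B * S * wt j k"
    by (rule sum_left[OF w\<rho>]) (use D jk ws pos in auto)
  have t3: "cmod (\<Sum>l\<in>lo M. (X j l w - Y j l w) * W (l - k) w) \<le> \<mu> * B * S * wt j k"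
    by (rule sum_right[OF w\<rho>]) (use D jk ws pos in auto)
  have t4: "cmod (\<Sum>l\<in>lo M. \<Sum>m\<in>hi M. (X j l w - Y j l w) * W (l - m) w * X m k w)
      \<le> \<mu> * (K / M) * (4 * real M) * B * S * wt j k"
    by (rule sum_quad[OF w\<rho>]) (use D Xb jk ws pos in auto)
  have t5: "cmod (\<Sum>l\<in>lo M. \<Sum>m\<in>hi M. Y j l w * W (l - m) w * (X m k w - Y m k w))
      \<le> (K / M) * \<mu> * (4 * real M) * B * S * wt j k"
    by (rule sum_quad[OF w\<rho>]) (use D Yb jk ws pos in auto)
  have QQ: "Q X - Q Y = \<i> * (deriv (X j k) w - deriv (Y j k) w) - (\<Sum>l\<in>hi M. W (j - l) w * (X l k w - Y l k w))
     + (\<Sum>l\<in>lo M. (X j l w - Y j l w) * W (l - k) w)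
     + (\<Sum>l\<in>lo M. \<Sum>m\<in>hi M. (X j l w - Y j l w) * W (l - m) w * X m k w)
     + (\<Sum>l\<in>lo M. \<Sum>m\<in>hi M. Y j l w * W (l - m) w * (X m k w - Y m k w))"
    unfolding Q_def by (simp add: algebra_simps sum_subtractf sum.distrib)
  have "cmod (Q X - Q Y) \<le> \<mu> * wt j k / \<delta> + \<mu> * B * S * wt j k + \<mu> * B * S * wt j k
      + \<mu> * (K / M) * (4 * real M) * B * S * wt j k + (K / M) * \<mu> * (4 * real M) * B * S * wt j k"
    unfolding QQ by (intro norm_triangle_mono norm_triangle_le_diff[OF add_mono] t1 t2 t3 t4 t5)
  also have "\<dots> = \<mu> * (1 / \<delta> + 2 * B * S + 8 * K * B * S) * wt j k"
    using pos by (simp add: field_simps)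
  finally have Qb: "cmod (Q X - Q Y) \<le> \<mu> * (1 / \<delta> + 2 * B * S + 8 * K * B * S) * wt j k" .
  have "riccati M X j k w - riccati M Y j k w = (Q X - Q Y) / of_real ?g"
    by (simp only: riccati_def Q_def diff_divide_distrib)
  also have "cmod \<dots> = cmod (Q X - Q Y) / \<bar>?g\<bar>" by (simp only: norm_divide norm_of_real)
  also have "\<dots> \<le> \<mu> * (1 / \<delta> + 2 * B * S + 8 * K * B * S) * wt j k / M"
    using gap_bounds[OF jk] pos Qb order_trans[OF norm_ge_zero Qb] by (intro frac_le) auto
  finally show ?thesis by (simp add: mult_ac)
qed

primrec ric :: "nat \<Rightarrow> nat \<Rightarrow> int \<Rightarrow> int \<Rightarrow> complex \<Rightarrow> complex" where
  "ric 0 M = (\<lambda>j k w. 0)"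
| "ric (Suc n) M = riccati M (ric n M)"

text \<open>The part of the contraction constant that does not depend on \<delta>, at K = 2 B. The
  same number comes up again when the leakage past 2M is summed, as 2 B S + 4 (4
  \<open>B\<^sup>2\<close> S).\<close>

definition C\<^sub>1 :: real where "C\<^sub>1 = 2 * B * S + 16 * B\<^sup>2 * S"

text \<open>The left factor is a partial sum of the increments (B / M) (1/2)^n, whose total is 2 B /
  M.\<close>

lemma partial_geometric_wt_le: "2 * B / real M * (1 - (1/2)^i) * wt j k \<le> 2 * B / M * wt j k"
proof -
  have "2 * B / M * wt j k * (1 - (1/2)^i) \<le> 2 * B / M * wt j k * 1"
    using B wt_pos[of j k] by (intro mult_left_mono) auto
  moreover have "2 * B / M * wt j k * (1 - (1/2)^i) = 2 * B / M * (1 - (1/2)^i) * wt j k"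
    by (simp only: mult_ac)
  ultimately show ?thesis by (simp only: mult_1_right)
qed

text \<open>Each step gives up width \<rho> / (N + 2), so 1 / \<delta> is (N + 2) / \<rho> and the
  assumption on N makes the contraction ratio 1/2. The claims are proved together: the contraction
  needs the size bound 2 B / M, and that bound is the sum of the increments so far.\<close>

lemma ric_bounds:
  assumes M: "M > 0" and N: "(real N + 2) / \<rho> + C\<^sub>1 \<le> M / 2" and n: "n \<le> Suc N"
  shows "(\<forall>j\<in>hi M. \<forall>k\<in>lo M. ric n M j k holomorphic_on strip (\<rho> - n * (\<rho> / (real N + 2)))) \<and>
    (\<forall>j\<in>hi M. \<forall>k\<in>lo M. \<forall>w\<in>strip (\<rho> - n * (\<rho> / (real N + 2))). cmod (ric n M j k w) \<le> 2 * B / M * (1 - (1/2)^n) * wt j k) \<and>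
    (\<forall>j\<in>hi M. \<forall>k\<in>lo M. \<forall>w\<in>strip (\<rho> - Suc n * (\<rho> / (real N + 2))).
       cmod (ric (Suc n) M j k w - ric n M j k w) \<le> (1/2)^n * (B / M) * wt j k)"
  using n
proof (induction n)
  case 0
  have "cmod (riccati M (\<lambda>j k w. 0) j k w) \<le> B / M * wt j k"
    if jk: "j \<in> hi M" "k \<in> lo M" and w: "w \<in> strip (\<rho> - \<rho> / (real N + 2))" for j k w
  proof -
    have "\<rho> / (real N + 2) \<ge> 0" using rho by simp
    then have "w \<in> strip \<rho>" using w by (auto simp: strip_def)
    note b = bound_wt[OF this, of j k]
    have "exp (- (\<theta> / 2) * \<bar>real_of_int (j - k)\<bar>) \<le> 1" using theta by simp
    then have "B * wt j k * exp (- (\<theta> / 2) * \<bar>real_of_int (j - k)\<bar>) \<le> B * wt j k * 1"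
      using B wt_pos[of j k] by (intro mult_left_mono) auto
    with b have b: "cmod (W (j - k) w) \<le> B * wt j k" by linarith
    have "cmod (riccati M (\<lambda>j k w. 0) j k w) = cmod (W (j - k) w) / \<bar>real_of_int (j\<^sup>2 - k\<^sup>2)\<bar>"
      unfolding riccati_def by (simp only: norm_divide norm_of_real) simp
    also have "\<dots> \<le> B * wt j k / M"
      using gap_bounds[OF jk] M b order_trans[OF norm_ge_zero b] by (intro frac_le) auto
    finally show ?thesis by simp
  qed
  then show ?case using B by simp
next
  case (Suc n)
  let ?\<delta> = "\<rho> / (real N + 2)"
  let ?r = "\<rho> - Suc n * ?\<delta>"
  have \<delta>: "?\<delta> > 0" using rho by simp
  have rr: "?r \<le> \<rho> - n * ?\<delta>" using \<delta> by (simp only: of_nat_Suc distrib_right mult_1)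
  have "real (Suc n) * ?\<delta> \<ge> 0" using \<delta> by (intro mult_nonneg_nonneg) auto
  then have r\<rho>: "?r \<le> \<rho>" by linarith
  from Suc have hol_n: "\<And>j k. j \<in> hi M \<Longrightarrow> k \<in> lo M \<Longrightarrow> ric n M j k holomorphic_on strip (\<rho> - n * ?\<delta>)"
    and b_n: "\<And>j k w. j \<in> hi M \<Longrightarrow> k \<in> lo M \<Longrightarrow> w \<in> strip (\<rho> - n * ?\<delta>) \<Longrightarrow> cmod (ric n M j k w) \<le> 2 * B / M * (1 - (1/2)^n) * wt j k"
    and d_n: "\<And>j k w. j \<in> hi M \<Longrightarrow> k \<in> lo M \<Longrightarrow> w \<in> strip ?r \<Longrightarrow> cmod (ric (Suc n) M j k w - ric n M j k w) \<le> (1/2)^n * (B / M) * wt j k"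
    by (auto simp: Suc_le_eq)
  have hol_n': "ric n M j k holomorphic_on strip ?r" if "j \<in> hi M" "k \<in> lo M" for j k
    using hol_n[OF that] holomorphic_on_subset strip_mono[OF rr] by blast
  have b_n': "cmod (ric n M j k w) \<le> 2 * B / M * (1 - (1/2)^n) * wt j k"
    if "j \<in> hi M" "k \<in> lo M" "w \<in> strip ?r" for j k w using b_n[OF that(1,2)] strip_mono[OF rr] that(3) by blast
  have hol_S: "ric (Suc n) M j k holomorphic_on strip ?r" if "j \<in> hi M" "k \<in> lo M" for j k
    using hol_n' that r\<rho> by (auto intro!: riccati_holomorphic)
  have b_S: "cmod (ric (Suc n) M j k w) \<le> 2 * B / M * (1 - (1/2)^Suc n) * wt j k"
    if "j \<in> hi M" "k \<in> lo M" "w \<in> strip ?r" for j k w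
  proof -
    have "cmod (ric (Suc n) M j k w) \<le> cmod (ric n M j k w) + cmod (ric (Suc n) M j k w - ric n M j k w)"
      by (rule norm_triangle_sub)
    also have "\<dots> \<le> 2 * B / M * (1 - (1/2)^n) * wt j k + (1/2)^n * (B / M) * wt j k"
      by (intro add_mono b_n' d_n that)
    also have "\<dots> = 2 * B / M * (1 - (1/2)^Suc n) * wt j k"
    proof -
      have "2 * B / M * (1 - q) * wt j k + q * (B / M) * wt j k = 2 * B / M * (1 - 1/2 * q) * wt j k" for q :: real
        using M by (simp add: field_simps)
      then show ?thesis by (simp only: power_Suc)
    qed
    finally show ?thesis .
  qed
  have "cmod (ric (Suc (Suc n)) M j k w - ric (Suc n) M j k w) \<le> (1/2)^Suc n * (B / M) * wt j k"
    if jk: "j \<in> hi M" "k \<in> lo M" and w: "w \<in> strip (\<rho> - Suc (Suc n) * ?\<delta>)" for j k w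
  proof -
    have "\<rho> - Suc (Suc n) * d = \<rho> - Suc n * d - d" for d :: real by (simp add: algebra_simps)
    then have w': "w \<in> strip (?r - ?\<delta>)" using w by (simp only:)
    have "cmod (riccati M (ric (Suc n) M) j k w - riccati M (ric n M) j k w) \<le>
       ((1/2)^n * (B / M)) / M * (1 / ?\<delta> + 2 * B * S + 8 * (2 * B) * B * S) * wt j k"
      by (rule riccati_contraction[OF hol_S hol_n' order_trans[OF b_S partial_geometric_wt_le] order_trans[OF b_n' partial_geometric_wt_le] d_n r\<rho> \<delta> _ _ M jk w'])
        (use B in auto)
    also have "1 / ?\<delta> + 2 * B * S + 8 * (2 * B) * B * S = (real N + 2) / \<rho> + C\<^sub>1"
      by (simp add: C\<^sub>1_def power2_eq_square)
    also have "((1/2)^n * (B / M)) / M * ((real N + 2) / \<rho> + C\<^sub>1) * wt j k \<le> ((1/2)^n * (B / M)) / M * (M / 2) * wt j k"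
      using B wt_pos[of j k] by (intro mult_right_mono mult_left_mono N) auto
    also have "\<dots> = (1/2)^Suc n * (B / M) * wt j k" using M by simp
    finally show ?thesis by simp
  qed
  then show ?case using hol_S b_S by blast
qed

text \<open>X is the N-th iterate on the real line. Multiplying the fixed point equation by the gap
  shows that its residual is the gap times the next increment, at most 4 \<open>M\<^sup>2\<close> (B
  / M) (1/2)^N.\<close>

lemma approximate_riccati_solution:
  assumes M: "M > 0" and N: "(real N + 2) / \<rho> + C\<^sub>1 \<le> M / 2"
  obtains X X' :: "int \<Rightarrow> int \<Rightarrow> real \<Rightarrow> complex" where
    "\<And>j k t. j \<in> hi M \<Longrightarrow> k \<in> lo M \<Longrightarrow> (X j k has_vector_derivative X' j k t) (at t)"
    "\<And>j k t. j \<in> hi M \<Longrightarrow> k \<in> lo M \<Longrightarrow> cmod (X j k t) \<le> 2 * B / M * wt j k"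
    "\<And>j k t. j \<in> hi M \<Longrightarrow> k \<in> lo M \<Longrightarrow>
       cmod (\<i> * X' j k t - of_int (j\<^sup>2 - k\<^sup>2) * X j k t - W (j - k) (of_real t)
          - (\<Sum>l\<in>hi M. W (j - l) (of_real t) * X l k t) + (\<Sum>l\<in>lo M. X j l t * W (l - k) (of_real t))
          + (\<Sum>l\<in>lo M. \<Sum>m\<in>hi M. X j l t * W (l - m) (of_real t) * X m k t)) \<le> 4 * B * M * (1/2)^N"
proof
  let ?X = "\<lambda>j k t. ric N M j k (complex_of_real t)" and ?X' = "\<lambda>j k t. deriv (ric N M j k) (complex_of_real t)"
  \<comment> \<open>Dividing the strip into N + 2 parts leaves one part after N + 1 reductions, so
    the real line still lies where the increment from iterate N to N + 1 is bounded.\<close>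
  have "N * (\<rho> / (real N + 2)) < \<rho>" "Suc N * (\<rho> / (real N + 2)) < \<rho>" using rho by (auto simp: field_simps)
  then have real: "complex_of_real t \<in> strip (\<rho> - N * (\<rho> / (real N + 2)))" "complex_of_real t \<in> strip (\<rho> - Suc N * (\<rho> / (real N + 2)))" for t
    unfolding strip_def by (auto simp del: of_nat_Suc)
  have "N \<le> Suc N" by simp
  from ric_bounds[OF M N this] real
  have 1: "\<And>j k. j \<in> hi M \<Longrightarrow> k \<in> lo M \<Longrightarrow> ric N M j k holomorphic_on strip (\<rho> - N * (\<rho> / (real N + 2)))"
    and 2: "\<And>j k t. j \<in> hi M \<Longrightarrow> k \<in> lo M \<Longrightarrow> cmod (?X j k t) \<le> 2 * B / M * (1 - (1/2)^N) * wt j k"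
    and 3: "\<And>j k t. j \<in> hi M \<Longrightarrow> k \<in> lo M \<Longrightarrow> cmod (ric (Suc N) M j k (of_real t) - ?X j k t) \<le> (1/2)^N * (B / M) * wt j k"
    by blast+
  fix j k t assume jk: "j \<in> hi M" "k \<in> lo M"
  show "((?X j k) has_vector_derivative ?X' j k t) (at t)"
    using holomorphic_derivI[OF 1[OF jk] open_strip real(1)] by (rule has_vector_derivative_real_field)
  show "cmod (?X j k t) \<le> 2 * B / M * wt j k"
    by (rule order_trans[OF 2[OF jk] partial_geometric_wt_le])
  let ?g = "real_of_int (j\<^sup>2 - k\<^sup>2)"
  define Q where "Q = \<i> * ?X' j k t - W (j - k) (of_real t)
          - (\<Sum>l\<in>hi M. W (j - l) (of_real t) * ?X l k t) + (\<Sum>l\<in>lo M. ?X j l t * W (l - k) (of_real t))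
          + (\<Sum>l\<in>lo M. \<Sum>m\<in>hi M. ?X j l t * W (l - m) (of_real t) * ?X m k t)"
  have "ric (Suc N) M j k (of_real t) = Q / of_real ?g"
    by (simp add: riccati_def Q_def)
  then have Q: "Q = of_real ?g * ric (Suc N) M j k (of_real t)"
    using nonzero_eq_divide_eq[of "complex_of_real ?g"] gap_nonzero[OF jk] of_real_eq_0_iff by (metis mult.commute)
  have "\<i> * ?X' j k t - of_int (j\<^sup>2 - k\<^sup>2) * ?X j k t - W (j - k) (of_real t)
          - (\<Sum>l\<in>hi M. W (j - l) (of_real t) * ?X l k t) + (\<Sum>l\<in>lo M. ?X j l t * W (l - k) (of_real t))
          + (\<Sum>l\<in>lo M. \<Sum>m\<in>hi M. ?X j l t * W (l - m) (of_real t) * ?X m k t)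
        = Q - of_real ?g * ?X j k t"
    by (simp add: Q_def algebra_simps)
  also have "\<dots> = of_real ?g * (ric (Suc N) M j k (of_real t) - ?X j k t)"
    by (simp add: Q right_diff_distrib)
  also have "cmod \<dots> \<le> (4 * (real M)\<^sup>2) * ((1/2)^N * (B / M) * wt j k)"
    unfolding norm_mult norm_of_real using gap_bounds[OF jk] by (intro mult_mono 3 jk) auto
  \<comment> \<open>The weight is at most 1 here because |k| < M \<le> |j|.\<close>
  also have "\<dots> \<le> (4 * (real M)\<^sup>2) * ((1/2)^N * (B / M) * 1)"
    using B theta jk by (intro mult_left_mono) (auto simp: wt_def hi_def lo_def)
  also have "\<dots> = 4 * B * M * (1/2)^N" using M by (simp add: power2_eq_square field_simps)
  finally show "cmod (\<i> * ?X' j k t - of_int (j\<^sup>2 - k\<^sup>2) * ?X j k t - W (j - k) (of_real t)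
          - (\<Sum>l\<in>hi M. W (j - l) (of_real t) * ?X l k t) + (\<Sum>l\<in>lo M. ?X j l t * W (l - k) (of_real t))
          + (\<Sum>l\<in>lo M. \<Sum>m\<in>hi M. ?X j l t * W (l - m) (of_real t) * ?X m k t)) \<le> 4 * B * M * (1/2)^N" .
qed

end

section \<open>Approximately invariant low-frequency dynamics\<close>

lemma has_real_derivative_cmod_sq:
  assumes "(f has_vector_derivative f') (at t)"
  shows "((\<lambda>t. (cmod (f t))\<^sup>2) has_real_derivative 2 * Re (cnj (f t) * f')) (at t)"
proof -
  have Re: "((\<lambda>t. Re (f t)) has_real_derivative Re f') (at t)"
    using bounded_linear.has_vector_derivative[OF bounded_linear_Re assms]
    by (simp add: has_real_derivative_iff_has_vector_derivative)
  have Im: "((\<lambda>t. Im (f t)) has_real_derivative Im f') (at t)"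
    using bounded_linear.has_vector_derivative[OF bounded_linear_Im assms]
    by (simp add: has_real_derivative_iff_has_vector_derivative)
  show ?thesis unfolding cmod_power2
    by (rule derivative_eq_intros Re Im refl)+ (simp add: algebra_simps)
qed

lemma sum_le_sqrt_card_mult:
  fixes f :: "'a \<Rightarrow> real"
  shows "(\<Sum>i\<in>A. f i)\<^sup>2 \<le> real (card A) * (\<Sum>i\<in>A. (f i)\<^sup>2)"
  using Cauchy_Schwarz_ineq_sum[of "\<lambda>_. 1" f A] by simp

lemma lo_Un_hi: "lo (2 * M) = lo M \<union> hi M" and lo_Int_hi: "lo M \<inter> hi M = {}"
  by (auto simp: lo_def hi_def)

lemma sum_lo_split: "(\<Sum>k\<in>lo (2 * M). f k) = (\<Sum>k\<in>lo M. f k) + (\<Sum>k\<in>hi M. f k)"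
  unfolding lo_Un_hi by (rule sum.union_disjoint) (auto simp: lo_Int_hi)

context exp_potential
begin

lemma real_in_strip: "complex_of_real t \<in> strip \<rho>"
  using rho by (simp add: strip_def)

lemma W_continuous: "continuous_on UNIV (\<lambda>t. W m (complex_of_real t))"
proof -
  have "continuous_on (strip \<rho>) (W m)" using hol by (rule holomorphic_on_imp_continuous_on)
  then show ?thesis
    by (rule continuous_on_compose2) (auto intro!: continuous_intros simp: real_in_strip)
qed

text \<open>The first term is the Riccati residual 4 B M (1/2)^N per entry, times at most 2M columns
  and 4M rows. The second is the part of the potential that carries v to modes beyond 2M.\<close>

definition approx_error :: "nat \<Rightarrow> nat \<Rightarrow> real" where
  "approx_error M N = 32 * B * real M ^ 3 * (1/2)^N + C\<^sub>1 * M * exp (- (\<theta> / 2) * M)"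

text \<open>The residual is measured in l^1 and over all integers. Outside \<open>lo K\<close> the
  function v vanishes but the potential acting on it does not, and that part is needed when v is
  paired with an exact flow. The error is relative to the norm of v, so that Gronwall
  applies.\<close>

definition approx_flow :: "nat \<Rightarrow> real \<Rightarrow> (int \<Rightarrow> real \<Rightarrow> complex) \<Rightarrow> (int \<Rightarrow> real \<Rightarrow> complex) \<Rightarrow> bool" where
  "approx_flow K e v v' \<longleftrightarrow> (\<forall>j t. (v j has_vector_derivative v' j t) (at t)) \<and>
     (\<forall>j t. j \<notin> lo K \<longrightarrow> v j t = 0) \<and>
     (\<forall>F t. finite F \<longrightarrow> (\<Sum>j\<in>F. cmod (\<i> * v' j t - of_int (j\<^sup>2) * v j t - (\<Sum>k\<in>lo K. W (j - k) (of_real t) * v k t)))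
        \<le> e * sqrt (\<Sum>k\<in>lo K. (cmod (v k t))\<^sup>2))"

text \<open>With v = (a, X a) and i a' = (H11 + H12 X) a, the equation holds exactly on
  \<open>lo M\<close>. On \<open>hi M\<close> the defect is the Riccati residual applied to a, and
  beyond 2M it is the potential applied to v.\<close>

lemma approximate_solution:
  assumes M: "M > 0" and N: "(real N + 2) / \<rho> + C\<^sub>1 \<le> M / 2"
  obtains v v' :: "int \<Rightarrow> real \<Rightarrow> complex" where
    "approx_flow (2 * M) (approx_error M N) v v'"
    "\<And>k. k \<in> lo M \<Longrightarrow> v k 0 = a0 k"
    "\<And>j. j \<in> hi M \<Longrightarrow> cmod (v j 0) \<le> 2 * B / M * (\<Sum>k\<in>lo M. wt j k * cmod (a0 k))"
proof -
  obtain X X' where X': "\<And>j k t. j \<in> hi M \<Longrightarrow> k \<in> lo M \<Longrightarrow> (X j k has_vector_derivative X' j k t) (at t)"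
    and Xb: "\<And>j k t. j \<in> hi M \<Longrightarrow> k \<in> lo M \<Longrightarrow> cmod (X j k t) \<le> 2 * B / M * wt j k"
    and R: "\<And>j k t. j \<in> hi M \<Longrightarrow> k \<in> lo M \<Longrightarrow>
       cmod (\<i> * X' j k t - of_int (j\<^sup>2 - k\<^sup>2) * X j k t - W (j - k) (of_real t)
          - (\<Sum>l\<in>hi M. W (j - l) (of_real t) * X l k t) + (\<Sum>l\<in>lo M. X j l t * W (l - k) (of_real t))
          + (\<Sum>l\<in>lo M. \<Sum>m\<in>hi M. X j l t * W (l - m) (of_real t) * X m k t)) \<le> 4 * B * M * (1/2)^N"
    using approximate_riccati_solution[OF M N] by blast
  have Xc: "continuous_on UNIV (X j k)" if "j \<in> hi M" "k \<in> lo M" for j k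
    by (intro continuous_at_imp_continuous_on ballI) (meson X' that has_vector_derivative_continuous)
  \<comment> \<open>A is -i (H11 + H12 X): the low modes feel the upper block only through
    X.\<close>
  define A where "A k l t = - \<i> * ((if k = l then of_int (k\<^sup>2) else 0) + W (k - l) (of_real t)
      + (\<Sum>m\<in>hi M. W (k - m) (of_real t) * X m l t))" for k l t
  have Ac: "continuous_on UNIV (A k l)" if "k \<in> lo M" "l \<in> lo M" for k l
    unfolding A_def using that by (intro continuous_intros W_continuous Xc)
  obtain a where a0: "\<And>k. k \<in> lo M \<Longrightarrow> a k 0 = a0 k"
    and a': "\<And>k t. k \<in> lo M \<Longrightarrow> (a k has_vector_derivative (\<Sum>l\<in>lo M. A k l t * a l t)) (at t)"
    using linear_ode_exists[of "lo M" A a0, OF finite_lo Ac] by metis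
  define v where "v j t = (if j \<in> lo M then a j t else if j \<in> hi M then \<Sum>k\<in>lo M. X j k t * a k t else 0)" for j t
  define v' where "v' j t = (if j \<in> lo M then \<Sum>l\<in>lo M. A j l t * a l t
     else if j \<in> hi M then \<Sum>k\<in>lo M. X j k t * (\<Sum>l\<in>lo M. A k l t * a l t) + X' j k t * a k t else 0)" for j t
  define Hv where "Hv j t = of_int (j\<^sup>2) * v j t + (\<Sum>k\<in>lo (2 * M). W (j - k) (of_real t) * v k t)" for j t
  have vlo: "v k t = a k t" if "k \<in> lo M" for k t using that by (simp add: v_def)
  have vhi: "v j t = (\<Sum>k\<in>lo M. X j k t * a k t)" if "j \<in> hi M" for j t
    using that lo_Int_hi by (auto simp: v_def)
  have vfar: "v j t = 0" if "j \<notin> lo (2 * M)" for j t using that by (auto simp: v_def lo_Un_hi)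
  have v': "(v j has_vector_derivative v' j t) (at t)" for j t
  proof -
    consider "j \<in> lo M" | "j \<in> hi M" "j \<notin> lo M" | "j \<notin> hi M" "j \<notin> lo M" by blast
    then show ?thesis
    proof cases
      case 1 then show ?thesis using a'[of j t] by (simp add: v_def[abs_def] v'_def)
    next
      case 2
      have "((\<lambda>t. \<Sum>k\<in>lo M. X j k t * a k t) has_vector_derivative
         (\<Sum>k\<in>lo M. X j k t * (\<Sum>l\<in>lo M. A k l t * a l t) + X' j k t * a k t)) (at t)"
        using 2 by (intro has_vector_derivative_sum has_vector_derivative_mult X' a') auto
      with 2 show ?thesis by (simp add: v_def[abs_def] v'_def)
    next
      case 3 then show ?thesis by (simp add: v_def[abs_def] v'_def)
    qed
  qed
  have iA: "\<i> * (\<Sum>l\<in>lo M. A k l t * a l t) = of_int (k\<^sup>2) * a k t + (\<Sum>l\<in>lo M. W (k - l) (of_real t) * a l t)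
      + (\<Sum>l\<in>lo M. (\<Sum>m\<in>hi M. W (k - m) (of_real t) * X m l t) * a l t)" if k: "k \<in> lo M" for k t
  proof -
    have "\<i> * (\<Sum>l\<in>lo M. A k l t * a l t) = (\<Sum>l\<in>lo M. (if k = l then of_int (k\<^sup>2) * a l t else 0)
        + W (k - l) (of_real t) * a l t + (\<Sum>m\<in>hi M. W (k - m) (of_real t) * X m l t) * a l t)"
      unfolding sum_distrib_left A_def by (intro sum.cong refl) (auto simp: algebra_simps)
    also have "\<dots> = (\<Sum>l\<in>lo M. (if k = l then of_int (k\<^sup>2) * a l t else 0)) + (\<Sum>l\<in>lo M. W (k - l) (of_real t) * a l t)
      + (\<Sum>l\<in>lo M. (\<Sum>m\<in>hi M. W (k - m) (of_real t) * X m l t) * a l t)"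
      by (simp add: sum.distrib)
    also have "(\<Sum>l\<in>lo M. (if k = l then of_int (k\<^sup>2) * a l t else 0)) = of_int (k\<^sup>2) * a k t"
      using k by (subst sum.delta') auto
    finally show ?thesis .
  qed
  have swap: "(\<Sum>m\<in>hi M. W (k - m) (of_real t) * (\<Sum>l\<in>lo M. X m l t * a l t))
     = (\<Sum>l\<in>lo M. (\<Sum>m\<in>hi M. W (k - m) (of_real t) * X m l t) * a l t)" for k t
  proof -
    have "(\<Sum>m\<in>hi M. W (k - m) (of_real t) * (\<Sum>l\<in>lo M. X m l t * a l t))
      = (\<Sum>m\<in>hi M. \<Sum>l\<in>lo M. W (k - m) (of_real t) * X m l t * a l t)"
      by (simp add: sum_distrib_left mult.assoc)
    also have "\<dots> = (\<Sum>l\<in>lo M. \<Sum>m\<in>hi M. W (k - m) (of_real t) * X m l t * a l t)" by (rule sum.swap)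
    finally show ?thesis by (simp add: sum_distrib_right)
  qed
  have Wv: "(\<Sum>k\<in>lo (2 * M). W (j - k) (of_real t) * v k t) = (\<Sum>l\<in>lo M. W (j - l) (of_real t) * a l t)
      + (\<Sum>l\<in>lo M. (\<Sum>m\<in>hi M. W (j - m) (of_real t) * X m l t) * a l t)" for j t
    unfolding sum_lo_split swap[symmetric] by (simp add: vlo vhi)
  have res_lo: "\<i> * v' j t - Hv j t = 0" if "j \<in> lo M" for j t
    unfolding Hv_def Wv vlo[OF that] using iA[OF that, of t] that by (simp add: v'_def)
  have res_hi: "cmod (\<i> * v' j t - Hv j t) \<le> (\<Sum>k\<in>lo M. 4 * B * M * (1/2)^N * cmod (a k t))" if j: "j \<in> hi M" for j t
  proof -
    define Rjk where "Rjk k = \<i> * X' j k t - of_int (j\<^sup>2 - k\<^sup>2) * X j k t - W (j - k) (of_real t)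
          - (\<Sum>l\<in>hi M. W (j - l) (of_real t) * X l k t) + (\<Sum>l\<in>lo M. X j l t * W (l - k) (of_real t))
          + (\<Sum>l\<in>lo M. \<Sum>m\<in>hi M. X j l t * W (l - m) (of_real t) * X m k t)" for k
    have "\<i> * v' j t = (\<Sum>k\<in>lo M. X j k t * (\<i> * (\<Sum>l\<in>lo M. A k l t * a l t)) + \<i> * X' j k t * a k t)"
      using j lo_Int_hi unfolding v'_def by (auto simp: sum_distrib_left algebra_simps)
    also have "\<dots> = (\<Sum>k\<in>lo M. of_int (k\<^sup>2) * X j k t * a k t + X j k t * (\<Sum>l\<in>lo M. W (k - l) (of_real t) * a l t)
       + X j k t * (\<Sum>l\<in>lo M. (\<Sum>m\<in>hi M. W (k - m) (of_real t) * X m l t) * a l t) + \<i> * X' j k t * a k t)"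
      by (intro sum.cong refl, subst iA) (auto simp: algebra_simps)
    also have "\<dots> = (\<Sum>k\<in>lo M. of_int (k\<^sup>2) * X j k t * a k t)
       + (\<Sum>k\<in>lo M. \<Sum>l\<in>lo M. X j k t * W (k - l) (of_real t) * a l t)
       + (\<Sum>k\<in>lo M. \<Sum>l\<in>lo M. (\<Sum>m\<in>hi M. X j k t * W (k - m) (of_real t) * X m l t) * a l t)
       + (\<Sum>k\<in>lo M. \<i> * X' j k t * a k t)"
      by (simp only: sum.distrib sum_distrib_left sum_distrib_right mult.assoc)
    \<comment> \<open>Exchanging the two low indices makes a k the common factor, so that the terms
      can be matched with the entries of the Riccati residual.\<close>
    also have "(\<Sum>k\<in>lo M. \<Sum>l\<in>lo M. X j k t * W (k - l) (of_real t) * a l t)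
       = (\<Sum>k\<in>lo M. (\<Sum>l\<in>lo M. X j l t * W (l - k) (of_real t)) * a k t)"
      by (subst sum.swap) (simp add: sum_distrib_right)
    also have "(\<Sum>k\<in>lo M. \<Sum>l\<in>lo M. (\<Sum>m\<in>hi M. X j k t * W (k - m) (of_real t) * X m l t) * a l t)
       = (\<Sum>k\<in>lo M. (\<Sum>l\<in>lo M. \<Sum>m\<in>hi M. X j l t * W (l - m) (of_real t) * X m k t) * a k t)"
      by (subst sum.swap) (simp add: sum_distrib_right)
    finally have iv: "\<i> * v' j t = (\<Sum>k\<in>lo M. of_int (k\<^sup>2) * X j k t * a k t
       + (\<Sum>l\<in>lo M. X j l t * W (l - k) (of_real t)) * a k t
       + (\<Sum>l\<in>lo M. \<Sum>m\<in>hi M. X j l t * W (l - m) (of_real t) * X m k t) * a k t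
       + \<i> * X' j k t * a k t)"
      by (simp only: sum.distrib)
    have Hv: "Hv j t = (\<Sum>k\<in>lo M. of_int (j\<^sup>2) * X j k t * a k t + W (j - k) (of_real t) * a k t
       + (\<Sum>m\<in>hi M. W (j - m) (of_real t) * X m k t) * a k t)"
      unfolding Hv_def Wv vhi[OF j] by (simp only: sum.distrib sum_distrib_left mult.assoc add.assoc)
    have "\<i> * v' j t - Hv j t = (\<Sum>k\<in>lo M. Rjk k * a k t)"
      unfolding iv Hv sum_subtractf[symmetric] Rjk_def by (intro sum.cong refl) (simp add: algebra_simps)
    also have "cmod \<dots> \<le> (\<Sum>k\<in>lo M. 4 * B * M * (1/2)^N * cmod (a k t))"
      using R[OF j] by (intro sum_norm_le) (auto simp: norm_mult Rjk_def intro!: mult_right_mono)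
    finally show ?thesis .
  qed
  define nv where "nv t = sqrt (\<Sum>k\<in>lo (2 * M). (cmod (v k t))\<^sup>2)" for t
  have nv0: "nv t \<ge> 0" for t by (auto simp: nv_def intro: sum_nonneg)
  have v_nv: "cmod (v k t) \<le> nv t" if "k \<in> lo (2 * M)" for k t
    unfolding nv_def using that
    by (intro real_le_rsqrt member_le_sum[of k _ "\<lambda>k. (cmod (v k t))\<^sup>2"]) auto
  have a_nv: "cmod (a k t) \<le> nv t" if "k \<in> lo M" for k t
    using v_nv[of k t] that vlo[OF that, of t] by (auto simp: lo_Un_hi)
  have res_hi': "cmod (\<i> * v' j t - Hv j t) \<le> 8 * B * real M ^ 2 * (1/2)^N * nv t" if j: "j \<in> hi M" for j t
  proof -
    have "(\<Sum>k\<in>lo M. 4 * B * M * (1/2)^N * cmod (a k t)) \<le> real (card (lo M)) * (4 * B * M * (1/2)^N * nv t)"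
      using B by (intro sum_bounded_above mult_left_mono a_nv) auto
    also have "\<dots> \<le> real (2 * M) * (4 * B * M * (1/2)^N * nv t)"
      using B nv0 card_lo by (intro mult_right_mono mult_nonneg_nonneg) (auto simp del: of_nat_mult)
    finally show ?thesis using res_hi[OF j, of t] by (simp add: power2_eq_square mult_ac)
  qed
  let ?g = "\<lambda>j k. exp (- (\<theta> / 2) * \<bar>real_of_int (j - k)\<bar>)"
  define e where "e = exp (- (\<theta> / 2) * M)"
  \<comment> \<open>An entire block of length M lies between \<open>lo M\<close> and the modes
    beyond 2M.\<close>
  have wt_far: "wt j k \<le> e" if "j \<notin> lo (2 * M)" "k \<in> lo M" for j k
  proof -
    have "real M \<le> \<bar>real_of_int j\<bar> - \<bar>real_of_int k\<bar>" using that by (auto simp: lo_def)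
    then show ?thesis using theta by (simp add: wt_def e_def)
  qed
  have e0: "e > 0" by (simp add: e_def)
  have far_lo: "cmod (W (j - k) (of_real t) * v k t) \<le> B * e * nv t * ?g j k" if "j \<notin> lo (2 * M)" "k \<in> lo M" for j k t
  proof -
    have "cmod (W (j - k) (of_real t) * v k t) \<le> (B * wt j k * ?g j k) * nv t"
      unfolding norm_mult using that B wt_pos[of j k]
      by (intro mult_mono bound_wt real_in_strip v_nv) (auto simp: lo_Un_hi)
    also have "\<dots> \<le> (B * e * ?g j k) * nv t"
      using B nv0 by (intro mult_right_mono mult_left_mono wt_far that) auto
    finally show ?thesis by (simp add: mult_ac)
  qed
  \<comment> \<open>Modes just below 2M couple to modes just above without any decay. The smallness
    comes from v k itself: \<open>wt j k * wt k l = wt j l\<close> with l in \<open>lo M\<close>, so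
    the weights add up to the full distance. The sum over l costs 2M and is paid for by the factor 2
    B / M of X.\<close>
  have far_hi: "cmod (W (j - k) (of_real t) * v k t) \<le> 4 * B\<^sup>2 * e * nv t * ?g j k" if j: "j \<notin> lo (2 * M)" and k: "k \<in> hi M" for j k t
  proof -
    have "cmod (v k t) \<le> (\<Sum>l\<in>lo M. (2 * B / M * wt k l) * nv t)"
      unfolding vhi[OF k] by (intro sum_norm_le, unfold norm_mult, intro mult_mono Xb a_nv k)
        (use B nv0 in \<open>auto simp: less_imp_le[OF wt_pos]\<close>)
    then have "cmod (W (j - k) (of_real t) * v k t) \<le> (B * wt j k * ?g j k) * (\<Sum>l\<in>lo M. (2 * B / M * wt k l) * nv t)"
      unfolding norm_mult using B wt_pos[of j k]
      by (intro mult_mono bound_wt real_in_strip) auto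
    also have "\<dots> = (\<Sum>l\<in>lo M. 2 * B\<^sup>2 / M * nv t * ?g j k * (wt j k * wt k l))"
      unfolding sum_distrib_left by (intro sum.cong refl) (simp add: power2_eq_square)
    also have "\<dots> \<le> (\<Sum>l\<in>lo M. 2 * B\<^sup>2 / M * nv t * ?g j k * e)"
      unfolding wt_mult using B nv0 by (intro sum_mono mult_left_mono wt_far j) auto
    also have "\<dots> = real (card (lo M)) * (2 * B\<^sup>2 / M * nv t * ?g j k * e)" by simp
    also have "\<dots> \<le> real (2 * M) * (2 * B\<^sup>2 / M * nv t * ?g j k * e)"
      using B nv0 card_lo e0 by (intro mult_right_mono mult_nonneg_nonneg) (auto simp del: of_nat_mult)
    also have "\<dots> = 4 * B\<^sup>2 * e * nv t * ?g j k" using M by simp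
    finally show ?thesis .
  qed
  have sum_far: "(\<Sum>j\<in>F. cmod (\<i> * v' j t - Hv j t)) \<le> C\<^sub>1 * M * e * nv t"
    if fin: "finite F" and F: "F \<inter> lo (2 * M) = {}" for F t
  proof -
    have g: "(\<Sum>j\<in>F. ?g j k) \<le> S" for k
      using sum_exp_abs_le_geo[of "\<theta> / 2" F k] theta fin by (simp add: abs_minus_commute)
    have "(\<Sum>j\<in>F. cmod (\<i> * v' j t - Hv j t)) \<le>
        (\<Sum>j\<in>F. (\<Sum>k\<in>lo M. B * e * nv t * ?g j k) + (\<Sum>k\<in>hi M. 4 * B\<^sup>2 * e * nv t * ?g j k))"
    proof (rule sum_mono)
      fix j assume "j \<in> F"
      then have j: "j \<notin> lo (2 * M)" using F by auto
      then have "\<i> * v' j t - Hv j t = - (\<Sum>k\<in>lo (2 * M). W (j - k) (of_real t) * v k t)"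
        by (auto simp: Hv_def vfar v'_def lo_Un_hi)
      also have "cmod \<dots> = cmod ((\<Sum>k\<in>lo M. W (j - k) (of_real t) * v k t) + (\<Sum>k\<in>hi M. W (j - k) (of_real t) * v k t))"
        unfolding sum_lo_split by (rule norm_minus_cancel)
      also have "\<dots> \<le> (\<Sum>k\<in>lo M. B * e * nv t * ?g j k) + (\<Sum>k\<in>hi M. 4 * B\<^sup>2 * e * nv t * ?g j k)"
        by (intro norm_triangle_mono sum_norm_le far_lo far_hi j)
      finally show "cmod (\<i> * v' j t - Hv j t) \<le> \<dots>" .
    qed
    also have "\<dots> = (\<Sum>k\<in>lo M. B * e * nv t * (\<Sum>j\<in>F. ?g j k)) + (\<Sum>k\<in>hi M. 4 * B\<^sup>2 * e * nv t * (\<Sum>j\<in>F. ?g j k))"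
      by (simp only: sum.distrib sum.swap[of _ _ F] sum_distrib_left)
    also have "\<dots> \<le> (\<Sum>k\<in>lo M. B * e * nv t * S) + (\<Sum>k\<in>hi M. 4 * B\<^sup>2 * e * nv t * S)"
      using B nv0 e0 by (intro add_mono sum_mono mult_left_mono g) auto
    also have "\<dots> = real (card (lo M)) * (B * e * nv t * S) + real (card (hi M)) * (4 * B\<^sup>2 * e * nv t * S)"
      by simp
    also have "\<dots> \<le> real (2 * M) * (B * e * nv t * S) + real (4 * M) * (4 * B\<^sup>2 * e * nv t * S)"
      using B nv0 e0 S_pos card_lo card_hi
      by (intro add_mono mult_right_mono mult_nonneg_nonneg) (auto simp del: of_nat_mult)
    also have "\<dots> = C\<^sub>1 * M * e * nv t" by (simp add: C\<^sub>1_def algebra_simps)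
    finally show ?thesis .
  qed
  have sum_near: "(\<Sum>j\<in>F. cmod (\<i> * v' j t - Hv j t)) \<le> 32 * B * real M ^ 3 * (1/2)^N * nv t"
    if fin: "finite F" and F: "F \<subseteq> lo (2 * M)" for F t
  proof -
    have "(\<Sum>j\<in>F. cmod (\<i> * v' j t - Hv j t)) \<le> (\<Sum>j\<in>lo (2 * M). cmod (\<i> * v' j t - Hv j t))"
      using F by (intro sum_mono2) auto
    also have "\<dots> = (\<Sum>j\<in>hi M. cmod (\<i> * v' j t - Hv j t))"
      unfolding sum_lo_split by (simp add: res_lo)
    also have "\<dots> \<le> real (card (hi M)) * (8 * B * real M ^ 2 * (1/2)^N * nv t)"
      by (rule sum_bounded_above) (rule res_hi')
    also have "\<dots> \<le> real (4 * M) * (8 * B * real M ^ 2 * (1/2)^N * nv t)"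
      using B nv0 card_hi by (intro mult_right_mono mult_nonneg_nonneg) (auto simp del: of_nat_mult)
    finally show ?thesis by (simp add: power2_eq_square power3_eq_cube mult_ac)
  qed
  have total: "(\<Sum>j\<in>F. cmod (\<i> * v' j t - Hv j t)) \<le> approx_error M N * nv t" if fin: "finite F" for F t
  proof -
    have "(\<Sum>j\<in>F. cmod (\<i> * v' j t - Hv j t)) = (\<Sum>j\<in>F \<inter> lo (2 * M). cmod (\<i> * v' j t - Hv j t))
        + (\<Sum>j\<in>F - lo (2 * M). cmod (\<i> * v' j t - Hv j t))"
      using fin by (rule sum.Int_Diff)
    also have "\<dots> \<le> 32 * B * real M ^ 3 * (1/2)^N * nv t + C\<^sub>1 * M * e * nv t"
      using fin by (intro add_mono sum_near sum_far) auto
    finally show ?thesis by (simp add: approx_error_def e_def algebra_simps)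
  qed
  show thesis
  proof (rule that[of v v'])
    show "approx_flow (2 * M) (approx_error M N) v v'"
      using v' vfar total unfolding approx_flow_def Hv_def nv_def by (simp add: diff_diff_eq)
    show "v k 0 = a0 k" if "k \<in> lo M" for k using that by (simp add: vlo a0)
    show "cmod (v j 0) \<le> 2 * B / M * (\<Sum>k\<in>lo M. wt j k * cmod (a0 k))" if "j \<in> hi M" for j
    proof -
      have "cmod (v j 0) \<le> (\<Sum>k\<in>lo M. (2 * B / M * wt j k) * cmod (a0 k))"
        unfolding vhi[OF that]
        by (intro sum_norm_le, unfold norm_mult, intro mult_mono Xb that)
          (use B in \<open>auto simp: a0 less_imp_le[OF wt_pos]\<close>)
      then show ?thesis by (simp add: sum_distrib_left mult_ac)
    qed
  qed
qed

end

section \<open>Square-summable curves and conservation laws\<close>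

lemma has_sum_norm_le:
  fixes f :: "'a \<Rightarrow> 'b :: real_normed_vector"
  assumes "(f has_sum s) A" "\<And>F. finite F \<Longrightarrow> F \<subseteq> A \<Longrightarrow> norm (sum f F) \<le> K"
  shows "norm s \<le> K"
proof (rule tendsto_upperbound)
  show "((\<lambda>F. norm (sum f F)) \<longlongrightarrow> norm s) (finite_subsets_at_top A)"
    using assms(1) unfolding has_sum_def by (rule tendsto_norm)
  show "\<forall>\<^sub>F F in finite_subsets_at_top A. norm (sum f F) \<le> K"
    by (rule eventually_finite_subsets_at_top_weakI) (use assms in auto)
qed auto

text \<open>Gronwall's inequality in both time directions: E exp (-c t) decreases forward from 0,
  and E exp (c t) increases up to 0.\<close>

lemma growth_bound_of_relative_derivative:
  fixes E :: "real \<Rightarrow> real"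
  assumes "\<And>t. (E has_real_derivative E' t) (at t)" "\<And>t. \<bar>E' t\<bar> \<le> c * E t"
  shows "E t \<le> E 0 * exp (c * \<bar>t\<bar>)"
proof (cases "t \<ge> 0")
  case True
  have "E t * exp (- c * t) \<le> E 0 * exp (- c * 0)"
  proof (rule DERIV_nonpos_imp_nonincreasing[OF True, where f = "\<lambda>s. E s * exp (- c * s)"])
    fix s
    have "((\<lambda>s. E s * exp (- c * s)) has_real_derivative (E' s - c * E s) * exp (- c * s)) (at s)"
      by (auto intro!: derivative_eq_intros assms(1) simp: algebra_simps)
    moreover have "(E' s - c * E s) * exp (- c * s) \<le> 0"
      using assms(2)[of s] by (intro mult_nonpos_nonneg) auto
    ultimately show "\<exists>y. ((\<lambda>s. E s * exp (- c * s)) has_real_derivative y) (at s) \<and> y \<le> 0" by blast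
  qed
  then show ?thesis using True by (simp add: exp_minus field_simps)
next
  case False
  have "E t * exp (c * t) \<le> E 0 * exp (c * 0)"
  proof (rule DERIV_nonneg_imp_nondecreasing[where f = "\<lambda>s. E s * exp (c * s)"])
    fix s
    have "((\<lambda>s. E s * exp (c * s)) has_real_derivative (E' s + c * E s) * exp (c * s)) (at s)"
      by (auto intro!: derivative_eq_intros assms(1) simp: algebra_simps)
    moreover have "(E' s + c * E s) * exp (c * s) \<ge> 0"
      using assms(2)[of s] by (intro mult_nonneg_nonneg) auto
    ultimately show "\<exists>y. ((\<lambda>s. E s * exp (c * s)) has_real_derivative y) (at s) \<and> 0 \<le> y" by blast
  qed (use False in auto)
  then show ?thesis using False by (simp add: exp_minus field_simps)
qed

lemma mean_value_bound:
  fixes f :: "real \<Rightarrow> 'a :: real_normed_vector"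
  assumes "\<And>s. (f has_vector_derivative f' s) (at s)" "\<And>s. \<bar>s\<bar> \<le> \<bar>t\<bar> \<Longrightarrow> norm (f' s) \<le> K"
  shows "norm (f t - f 0) \<le> K * \<bar>t\<bar>"
proof -
  have "norm (f t - f 0) \<le> K * \<bar>t\<bar> ^ Suc 0 / fact (Suc 0)"
    by (rule antiderivative_power_bound[where F = "\<lambda>t. f t - f 0" and f = f' and T = "\<bar>t\<bar>"])
      (use assms in \<open>auto intro!: derivative_eq_intros\<close>)
  then show ?thesis by simp
qed

section \<open>Square-summable sequences and their tails\<close>

abbreviation sq_summable :: "('a \<Rightarrow> complex) \<Rightarrow> bool" where
  "sq_summable x \<equiv> (\<lambda>j. (cmod (x j))\<^sup>2) summable_on UNIV"

lemma cmod_sq_add_le: "(cmod (a + b))\<^sup>2 \<le> 2 * (cmod a)\<^sup>2 + 2 * (cmod b)\<^sup>2"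
proof -
  have "(cmod (a + b))\<^sup>2 \<le> (cmod a + cmod b)\<^sup>2" by (intro power_mono norm_triangle_ineq) auto
  also have "\<dots> \<le> 2 * (cmod a)\<^sup>2 + 2 * (cmod b)\<^sup>2"
    using sum_squares_bound[of "cmod a" "cmod b"] by (simp add: power2_sum)
  finally show ?thesis .
qed

lemma cnj_mult_of_int: "cnj z * (of_int n * z) = complex_of_real (of_int n * (cmod z)\<^sup>2)"
proof -
  have "cnj z * (of_int n * z) = of_int n * (z * cnj z)" by (simp add: mult_ac)
  also have "\<dots> = of_int n * complex_of_real ((cmod z)\<^sup>2)" by (simp only: complex_norm_square)
  finally show ?thesis by simp
qed

lemma sq_summable_on: "sq_summable x \<Longrightarrow> (\<lambda>j. (cmod (x j))\<^sup>2) summable_on A"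
  by (rule summable_on_subset_banach) auto

lemma sq_summable_diff:
  assumes "sq_summable x" "sq_summable y"
  shows "sq_summable (\<lambda>j. x j - y j)"
proof (rule summable_on_comparison_test)
  show "(\<lambda>j. 2 * (cmod (x j))\<^sup>2 + 2 * (cmod (y j))\<^sup>2) summable_on UNIV"
    by (intro summable_on_add summable_on_cmult_right assms)
  show "(cmod (x j - y j))\<^sup>2 \<le> 2 * (cmod (x j))\<^sup>2 + 2 * (cmod (y j))\<^sup>2" for j
    using cmod_sq_add_le[of "x j" "- y j"] by simp
qed auto

lemma infsum_sq_le:
  assumes "sq_summable x" "sq_summable y"
  shows "(\<Sum>\<^sub>\<infinity>j\<in>A. (cmod (x j))\<^sup>2) \<le> 2 * (\<Sum>\<^sub>\<infinity>j\<in>A. (cmod (y j))\<^sup>2) + 2 * (\<Sum>\<^sub>\<infinity>j. (cmod (x j - y j))\<^sup>2)"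
proof -
  note d = sq_summable_diff[OF assms]
  have "(\<Sum>\<^sub>\<infinity>j\<in>A. (cmod (x j))\<^sup>2) \<le> (\<Sum>\<^sub>\<infinity>j\<in>A. 2 * (cmod (y j))\<^sup>2 + 2 * (cmod (x j - y j))\<^sup>2)"
  proof (rule infsum_mono)
    show "(cmod (x j))\<^sup>2 \<le> 2 * (cmod (y j))\<^sup>2 + 2 * (cmod (x j - y j))\<^sup>2" for j
      using cmod_sq_add_le[of "y j" "x j - y j"] by simp
  qed (auto intro!: summable_on_add summable_on_cmult_right sq_summable_on assms d)
  also have "\<dots> = 2 * (\<Sum>\<^sub>\<infinity>j\<in>A. (cmod (y j))\<^sup>2) + 2 * (\<Sum>\<^sub>\<infinity>j\<in>A. (cmod (x j - y j))\<^sup>2)"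
    by (subst infsum_add) (auto intro!: summable_on_cmult_right sq_summable_on assms d simp: infsum_cmult_right')
  also have "(\<Sum>\<^sub>\<infinity>j\<in>A. (cmod (x j - y j))\<^sup>2) \<le> (\<Sum>\<^sub>\<infinity>j. (cmod (x j - y j))\<^sup>2)"
    by (rule infsum_mono_neutral) (auto intro!: sq_summable_on d)
  finally show ?thesis by simp
qed

lemma finite_sum_sq_le:
  assumes "sq_summable x" "finite F" "F \<subseteq> A"
  shows "(\<Sum>j\<in>F. (cmod (x j))\<^sup>2) \<le> (\<Sum>\<^sub>\<infinity>j\<in>A. (cmod (x j))\<^sup>2)"
  by (rule finite_sum_le_infsum) (use assms in \<open>auto intro: sq_summable_on\<close>)

lemma infsum_sq_split:
  assumes "sq_summable x" "finite F"
  shows "(\<Sum>\<^sub>\<infinity>j. (cmod (x j))\<^sup>2) = (\<Sum>j\<in>F. (cmod (x j))\<^sup>2) + (\<Sum>\<^sub>\<infinity>j\<in>-F. (cmod (x j))\<^sup>2)"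
  using infsum_Un_disjoint[of "\<lambda>j. (cmod (x j))\<^sup>2" F "- F"] assms by (simp add: sq_summable_on)

lemma lo_exhausts: "finite F \<Longrightarrow> \<exists>J0. \<forall>J\<ge>J0. F \<subseteq> lo J"
proof -
  assume "finite F"
  then have "finite ((\<lambda>j. nat \<bar>j\<bar>) ` F)" by simp
  then obtain n where "\<forall>m\<in>(\<lambda>j. nat \<bar>j\<bar>) ` F. m < n" using finite_nat_set_iff_bounded by blast
  then show ?thesis by (intro exI[of _ n]) (fastforce simp: lo_def)
qed

lemma lo_mono: "J \<le> K \<Longrightarrow> lo J \<subseteq> lo K"
  by (auto simp: lo_def)

lemma tail_antimono:
  assumes "sq_summable x" "J \<le> K"
  shows "(\<Sum>\<^sub>\<infinity>j\<in>-lo K. (cmod (x j))\<^sup>2) \<le> (\<Sum>\<^sub>\<infinity>j\<in>-lo J. (cmod (x j))\<^sup>2)"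
  by (rule infsum_mono_neutral) (use assms lo_mono[of J K] in \<open>auto intro: sq_summable_on\<close>)

lemma tail_small:
  assumes "sq_summable x" "\<epsilon> > 0"
  shows "\<exists>J. (\<Sum>\<^sub>\<infinity>j\<in>-lo J. (cmod (x j))\<^sup>2) < \<epsilon>"
proof -
  have "((\<lambda>j. (cmod (x j))\<^sup>2) has_sum (\<Sum>\<^sub>\<infinity>j. (cmod (x j))\<^sup>2)) UNIV" using assms by simp
  then have "\<forall>\<^sub>F F in finite_subsets_at_top UNIV. dist (\<Sum>j\<in>F. (cmod (x j))\<^sup>2) (\<Sum>\<^sub>\<infinity>j. (cmod (x j))\<^sup>2) < \<epsilon>"
    unfolding has_sum_def using assms(2) by (rule tendstoD)
  then obtain F where F: "finite F" "\<And>G. finite G \<Longrightarrow> F \<subseteq> G \<Longrightarrow> dist (\<Sum>j\<in>G. (cmod (x j))\<^sup>2) (\<Sum>\<^sub>\<infinity>j. (cmod (x j))\<^sup>2) < \<epsilon>"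
    unfolding eventually_finite_subsets_at_top by auto
  obtain J where "F \<subseteq> lo J" using lo_exhausts[OF F(1)] by blast
  from F(2)[OF finite_lo this] show ?thesis
    by (intro exI[of _ J]) (auto simp: dist_real_def infsum_sq_split[OF assms(1) finite_lo[of J]])
qed

text \<open>A continuous curve in l^2 is tight on compact time intervals. Smallness of a tail at one
  time persists nearby, finitely many such neighbourhoods suffice, and tails decrease in J, so the
  largest cutoff serves all of them.\<close>

lemma l2_curve_uniform_tail:
  fixes c :: "int \<Rightarrow> real \<Rightarrow> complex"
  assumes s: "\<And>t. sq_summable (\<lambda>j. c j t)"
    and lim: "\<And>t0. ((\<lambda>t. \<Sum>\<^sub>\<infinity>j. (cmod (c j t - c j t0))\<^sup>2) \<longlongrightarrow> 0) (at t0)" and \<epsilon>: "\<epsilon> > 0"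
  shows "\<exists>J0. \<forall>J\<ge>J0. \<forall>t. \<bar>t\<bar> \<le> T \<longrightarrow> (\<Sum>\<^sub>\<infinity>j\<in>-lo J. (cmod (c j t))\<^sup>2) \<le> \<epsilon>"
proof -
  have "\<exists>J d. d > 0 \<and> (\<forall>t\<in>ball t0 d. (\<Sum>\<^sub>\<infinity>j\<in>-lo J. (cmod (c j t))\<^sup>2) \<le> \<epsilon>)" for t0
  proof -
    \<comment> \<open>The value \<epsilon> / 4 matches the factors 2 and 2 in
      \<open>infsum_sq_le\<close>.\<close>
    obtain J where J: "(\<Sum>\<^sub>\<infinity>j\<in>-lo J. (cmod (c j t0))\<^sup>2) < \<epsilon> / 4" using tail_small[OF s] \<epsilon> by (metis zero_less_divide_iff zero_less_numeral)
    have "\<forall>\<^sub>F t in at t0. dist (\<Sum>\<^sub>\<infinity>j. (cmod (c j t - c j t0))\<^sup>2) 0 < \<epsilon> / 4"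
      using lim \<epsilon> by (intro tendstoD) auto
    then obtain d where d: "d > 0" "\<And>t. t \<noteq> t0 \<Longrightarrow> dist t t0 < d \<Longrightarrow> dist (\<Sum>\<^sub>\<infinity>j. (cmod (c j t - c j t0))\<^sup>2) 0 < \<epsilon> / 4"
      unfolding eventually_at by auto
    have "(\<Sum>\<^sub>\<infinity>j\<in>-lo J. (cmod (c j t))\<^sup>2) \<le> \<epsilon>" if "t \<in> ball t0 d" for t
    proof (cases "t = t0")
      case True then show ?thesis using J \<epsilon> by simp
    next
      case False
      then have "(\<Sum>\<^sub>\<infinity>j. (cmod (c j t - c j t0))\<^sup>2) < \<epsilon> / 4"
        using d(2)[of t] that by (auto simp: dist_commute)
      then show ?thesis using infsum_sq_le[OF s[of t] s[of t0], of "- lo J"] J by linarith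
    qed
    then show ?thesis using d(1) by blast
  qed
  then obtain Jf df where Jd: "\<And>t0. df t0 > 0"
    "\<And>t0 t. t \<in> ball t0 (df t0) \<Longrightarrow> (\<Sum>\<^sub>\<infinity>j\<in>-lo (Jf t0). (cmod (c j t))\<^sup>2) \<le> \<epsilon>" by metis
  have cov: "{-T..T} \<subseteq> (\<Union>t0\<in>{-T..T}. ball t0 (df t0))" using Jd(1) by force
  obtain Tf where Tf: "Tf \<subseteq> {-T..T}" "finite Tf" "{-T..T} \<subseteq> (\<Union>t0\<in>Tf. ball t0 (df t0))"
    by (rule compactE_image[OF compact_Icc _ cov]) auto
  show ?thesis
  proof (intro exI[of _ "Max (insert 0 (Jf ` Tf))"] allI impI)
    fix J t assume J: "Max (insert 0 (Jf ` Tf)) \<le> J" and t: "\<bar>t\<bar> \<le> T"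
    then have "t \<in> {-T..T}" by auto
    then obtain t0 where t0: "t0 \<in> Tf" "t \<in> ball t0 (df t0)" using Tf(3) by blast
    have "Jf t0 \<le> Max (insert 0 (Jf ` Tf))" using t0 Tf(2) by (intro Max_ge) auto
    then have "Jf t0 \<le> J" using J by simp
    from tail_antimono[OF s this, of t] Jd(2)[OF t0(2)]
    show "(\<Sum>\<^sub>\<infinity>j\<in>-lo J. (cmod (c j t))\<^sup>2) \<le> \<epsilon>" by linarith
  qed
qed

section \<open>The exact flow and bounds for the potential\<close>

context exp_potential
begin

text \<open>The equation is imposed on each coefficient separately, together with continuity in l^2.
  Differentiability in l^2 would exclude rough data, for which j^2 c j is not
  square-summable.\<close>

definition flow :: "(int \<Rightarrow> real \<Rightarrow> complex) \<Rightarrow> bool" where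
  "flow c \<longleftrightarrow> (\<forall>t. sq_summable (\<lambda>j. c j t)) \<and>
     (\<forall>t0. ((\<lambda>t. \<Sum>\<^sub>\<infinity>j. (cmod (c j t - c j t0))\<^sup>2) \<longlongrightarrow> 0) (at t0)) \<and>
     (\<forall>j t. (c j has_vector_derivative
        - \<i> * (of_int (j\<^sup>2) * c j t + (\<Sum>\<^sub>\<infinity>k. W (j - k) (of_real t) * c k t))) (at t))"

text \<open>Cauchy-Schwarz over pairs (j, k) after writing the kernel as a product of two square
  roots; row and column sums are both at most geo \<theta>. The absolute values inside the sum let
  the same bound give summability and tail estimates.\<close>

lemma schur_test:
  assumes "finite A" "finite F"
  shows "(\<Sum>j\<in>A. \<Sum>k\<in>F. cmod (W (j - k) (of_real t)) * (cmod (x j) * cmod (y k)))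
     \<le> B * geo \<theta> * (sqrt (\<Sum>j\<in>A. (cmod (x j))\<^sup>2) * sqrt (\<Sum>k\<in>F. (cmod (y k))\<^sup>2))"
proof -
  define w where "w j k = exp (- \<theta> * \<bar>real_of_int (j - k)\<bar>)" for j k
  have w0: "w j k \<ge> 0" for j k by (simp add: w_def)
  have g1: "(\<Sum>k\<in>F. w j k) \<le> geo \<theta>" for j
    unfolding w_def by (rule sum_exp_abs_le_geo[OF theta assms(2)])
  have g2: "(\<Sum>j\<in>A. w j k) \<le> geo \<theta>" for k
    using sum_exp_abs_le_geo[OF theta assms(1), of k] by (simp add: w_def abs_minus_commute)
  have gpos: "geo \<theta> > 0" using theta by (rule geo_pos)
  let ?X = "\<Sum>j\<in>A. (cmod (x j))\<^sup>2" and ?Y = "\<Sum>k\<in>F. (cmod (y k))\<^sup>2"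
  have X0: "?X \<ge> 0" "?Y \<ge> 0" by (auto intro: sum_nonneg)
  have "(\<Sum>(j,k)\<in>A \<times> F. (sqrt (w j k) * cmod (x j)) * (sqrt (w j k) * cmod (y k)))\<^sup>2
     \<le> (\<Sum>(j,k)\<in>A \<times> F. (sqrt (w j k) * cmod (x j))\<^sup>2) * (\<Sum>(j,k)\<in>A \<times> F. (sqrt (w j k) * cmod (y k))\<^sup>2)"
    using Cauchy_Schwarz_ineq_sum[of "\<lambda>(j,k). sqrt (w j k) * cmod (x j)" "\<lambda>(j,k). sqrt (w j k) * cmod (y k)" "A \<times> F"]
    by (simp add: case_prod_unfold)
  also have "(\<Sum>(j,k)\<in>A \<times> F. (sqrt (w j k) * cmod (x j))\<^sup>2) = (\<Sum>j\<in>A. (\<Sum>k\<in>F. w j k) * (cmod (x j))\<^sup>2)"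
    by (simp add: sum.cartesian_product[symmetric] power_mult_distrib w0 sum_distrib_right)
  also have "(\<Sum>(j,k)\<in>A \<times> F. (sqrt (w j k) * cmod (y k))\<^sup>2) = (\<Sum>k\<in>F. (\<Sum>j\<in>A. w j k) * (cmod (y k))\<^sup>2)"
    by (simp add: sum.cartesian_product[symmetric] power_mult_distrib w0 sum_distrib_right) (rule sum.swap)
  also have "(\<Sum>j\<in>A. (\<Sum>k\<in>F. w j k) * (cmod (x j))\<^sup>2) * (\<Sum>k\<in>F. (\<Sum>j\<in>A. w j k) * (cmod (y k))\<^sup>2)
     \<le> (geo \<theta> * ?X) * (geo \<theta> * ?Y)"
    unfolding sum_distrib_left using gpos
    by (intro mult_mono sum_mono mult_right_mono g1 g2)
      (auto intro!: sum_nonneg mult_nonneg_nonneg w0)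
  also have "\<dots> = (geo \<theta>)\<^sup>2 * (?X * ?Y)" by (simp add: power2_eq_square)
  also have "\<dots> = (geo \<theta> * (sqrt ?X * sqrt ?Y))\<^sup>2" using X0 by (simp only: power_mult_distrib real_sqrt_pow2)
  finally have cs: "(\<Sum>(j,k)\<in>A \<times> F. (sqrt (w j k) * cmod (x j)) * (sqrt (w j k) * cmod (y k))) \<le> geo \<theta> * (sqrt ?X * sqrt ?Y)"
    by (rule power2_le_imp_le) (use gpos X0 in auto)
  have "(\<Sum>j\<in>A. \<Sum>k\<in>F. cmod (W (j - k) (of_real t)) * (cmod (x j) * cmod (y k)))
     \<le> (\<Sum>j\<in>A. \<Sum>k\<in>F. (B * w j k) * (cmod (x j) * cmod (y k)))"
    unfolding w_def by (intro sum_mono mult_right_mono bound real_in_strip) auto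
  also have "\<dots> = B * (\<Sum>(j,k)\<in>A \<times> F. (sqrt (w j k) * cmod (x j)) * (sqrt (w j k) * cmod (y k)))"
  proof -
    have "(sqrt (w j k) * cmod (x j)) * (sqrt (w j k) * cmod (y k)) = w j k * (cmod (x j) * cmod (y k))" for j k
    proof -
      have "(sqrt (w j k) * cmod (x j)) * (sqrt (w j k) * cmod (y k)) = (sqrt (w j k) * sqrt (w j k)) * (cmod (x j) * cmod (y k))"
        by (simp only: mult_ac)
      then show ?thesis using w0 by simp
    qed
    then show ?thesis
      by (simp only: sum.cartesian_product[symmetric] sum_distrib_left) (simp only: mult.assoc)
  qed
  also have "\<dots> \<le> B * (geo \<theta> * (sqrt ?X * sqrt ?Y))" using B by (intro mult_left_mono cs) auto
  finally show ?thesis by (simp add: mult.assoc)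
qed

lemma W_summable_on:
  assumes "sq_summable x"
  shows "(\<lambda>k. W (j - k) (of_real t) * x k) summable_on A"
proof (rule abs_summable_summable)
  show "(\<lambda>k. norm (W (j - k) (of_real t) * x k)) summable_on A"
  proof (rule nonneg_bdd_above_summable_on)
    show "bdd_above (sum (\<lambda>k. norm (W (j - k) (of_real t) * x k)) ` {F. F \<subseteq> A \<and> finite F})"
    proof (rule bdd_aboveI)
      fix s assume "s \<in> sum (\<lambda>k. norm (W (j - k) (of_real t) * x k)) ` {F. F \<subseteq> A \<and> finite F}"
      then obtain F where F: "finite F" and s: "s = (\<Sum>k\<in>F. norm (W (j - k) (of_real t) * x k))" by auto
      have "s \<le> B * geo \<theta> * (sqrt (\<Sum>j\<in>{j}. (cmod 1)\<^sup>2) * sqrt (\<Sum>k\<in>F. (cmod (x k))\<^sup>2))"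
        using schur_test[of "{j}" F t "\<lambda>_. 1" x] F by (simp add: s norm_mult)
      also have "\<dots> \<le> B * geo \<theta> * (1 * sqrt (\<Sum>\<^sub>\<infinity>k. (cmod (x k))\<^sup>2))"
        using B geo_pos[OF theta] by (intro mult_left_mono mult_mono real_sqrt_le_mono finite_sum_sq_le assms F)
          (auto intro!: sum_nonneg infsum_nonneg)
      finally show "s \<le> B * geo \<theta> * (1 * sqrt (\<Sum>\<^sub>\<infinity>k. (cmod (x k))\<^sup>2))" .
    qed
  qed auto
qed

lemma W_infsum_split:
  assumes "sq_summable x"
  shows "(\<Sum>\<^sub>\<infinity>k. W (j - k) (of_real t) * x k) = (\<Sum>k\<in>lo J. W (j - k) (of_real t) * x k) + (\<Sum>\<^sub>\<infinity>k\<in>-lo J. W (j - k) (of_real t) * x k)"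
  using infsum_Un_disjoint[OF W_summable_on[OF assms] W_summable_on[OF assms], of "lo J" "- lo J" j t]
  by simp

lemma W_swap:
  assumes "finite A"
  shows "(\<Sum>j\<in>A. \<Sum>k\<in>A. cnj (W (j - k) (of_real t) * x k) * y j) = (\<Sum>j\<in>A. \<Sum>k\<in>A. cnj (x j) * (W (j - k) (of_real t) * y k))"
proof -
  have "(\<Sum>j\<in>A. \<Sum>k\<in>A. cnj (W (j - k) (of_real t) * x k) * y j) = (\<Sum>j\<in>A. \<Sum>k\<in>A. cnj (x k) * (W (k - j) (of_real t) * y j))"
  proof (intro sum.cong refl)
    fix j k
    have "cnj (W (j - k) (of_real t)) = W (k - j) (of_real t)" using sym[of "j - k" t] by simp
    then show "cnj (W (j - k) (of_real t) * x k) * y j = cnj (x k) * (W (k - j) (of_real t) * y j)" by simp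
  qed
  also have "\<dots> = (\<Sum>k\<in>A. \<Sum>j\<in>A. cnj (x k) * (W (k - j) (of_real t) * y j))" by (rule sum.swap)
  finally show ?thesis .
qed

lemma W_form_real:
  assumes "finite A"
  shows "Im (\<Sum>j\<in>A. \<Sum>k\<in>A. cnj (x j) * (W (j - k) (of_real t) * x k)) = 0"
proof -
  have "cnj (\<Sum>j\<in>A. \<Sum>k\<in>A. cnj (x j) * (W (j - k) (of_real t) * x k)) = (\<Sum>j\<in>A. \<Sum>k\<in>A. cnj (W (j - k) (of_real t) * x k) * x j)"
    by (simp add: mult_ac)
  also have "\<dots> = (\<Sum>j\<in>A. \<Sum>k\<in>A. cnj (x j) * (W (j - k) (of_real t) * x k))" by (rule W_swap[OF assms])
  finally have "Im (cnj (\<Sum>j\<in>A. \<Sum>k\<in>A. cnj (x j) * (W (j - k) (of_real t) * x k)))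
      = Im (\<Sum>j\<in>A. \<Sum>k\<in>A. cnj (x j) * (W (j - k) (of_real t) * x k))" by (rule arg_cong)
  then show ?thesis unfolding cnj.sel(2) by linarith
qed

text \<open>The kinetic term and the Hermitian coupling inside A contribute real quadratic forms,
  which the factor -i removes from the real part. Only r changes the energy. For the truncated exact
  flow r is the coupling to the tail, for an approximate flow it is the residual.\<close>

lemma energy_identity:
  assumes "finite A" "\<And>j. j \<in> A \<Longrightarrow> y j = - \<i> * (of_int (j\<^sup>2) * x j + (\<Sum>k\<in>A. W (j - k) (of_real t) * x k) + r j)"
  shows "(\<Sum>j\<in>A. 2 * Re (cnj (x j) * y j)) = 2 * Im (\<Sum>j\<in>A. cnj (x j) * r j)"
proof -
  have "(\<Sum>j\<in>A. cnj (x j) * y j) = (\<Sum>j\<in>A. - \<i> * (cnj (x j) * (of_int (j\<^sup>2) * x j)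
      + (\<Sum>k\<in>A. cnj (x j) * (W (j - k) (of_real t) * x k)) + cnj (x j) * r j))"
    by (intro sum.cong refl) (simp add: assms(2) sum_distrib_left algebra_simps)
  also have "\<dots> = - \<i> * ((\<Sum>j\<in>A. complex_of_real (of_int (j\<^sup>2) * (cmod (x j))\<^sup>2))
      + (\<Sum>j\<in>A. \<Sum>k\<in>A. cnj (x j) * (W (j - k) (of_real t) * x k)) + (\<Sum>j\<in>A. cnj (x j) * r j))"
    unfolding cnj_mult_of_int by (simp only: sum_distrib_left[symmetric] sum.distrib)
  finally have "Re (\<Sum>j\<in>A. cnj (x j) * y j) = Im ((\<Sum>j\<in>A. complex_of_real (of_int (j\<^sup>2) * (cmod (x j))\<^sup>2))
      + (\<Sum>j\<in>A. \<Sum>k\<in>A. cnj (x j) * (W (j - k) (of_real t) * x k)) + (\<Sum>j\<in>A. cnj (x j) * r j))"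
    by simp
  also have "\<dots> = Im (\<Sum>j\<in>A. cnj (x j) * r j)"
    using W_form_real[OF assms(1), of x t] by (simp only: plus_complex.sel Im_sum Im_complex_of_real sum.neutral_const)
  finally show ?thesis by (simp only: Re_sum sum_distrib_left[symmetric])
qed

end

lemma has_sum_finite_sum:
  fixes f :: "'i \<Rightarrow> 'a \<Rightarrow> 'b :: topological_comm_monoid_add"
  assumes "\<And>i. i \<in> I \<Longrightarrow> (f i has_sum s i) A"
  shows "((\<lambda>x. \<Sum>i\<in>I. f i x) has_sum (\<Sum>i\<in>I. s i)) A"
  using assms by (induction I rule: infinite_finite_induct) (auto intro: has_sum_add has_sum_0)

context exp_potential
begin

lemma flowD:
  assumes "flow c"
  shows "sq_summable (\<lambda>j. c j t)"
    "((\<lambda>t. \<Sum>\<^sub>\<infinity>j. (cmod (c j t - c j t0))\<^sup>2) \<longlongrightarrow> 0) (at t0)"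
    "(c j has_vector_derivative - \<i> * (of_int (j\<^sup>2) * c j t + (\<Sum>\<^sub>\<infinity>k. W (j - k) (of_real t) * c k t))) (at t)"
  using assms unfolding flow_def by blast+

lemma tail_coupling_has_sum:
  assumes "sq_summable x"
  shows "((\<lambda>k. \<Sum>j\<in>lo J. cnj (y j) * (W (j - k) (of_real t) * x k)) has_sum
     (\<Sum>j\<in>lo J. cnj (y j) * (\<Sum>\<^sub>\<infinity>k\<in>-lo J. W (j - k) (of_real t) * x k))) (- lo J)"
  by (intro has_sum_finite_sum has_sum_cmult_right has_sum_infsum W_summable_on assms)

text \<open>Schur's test on finite parts of the tail. The last factor is the norm of the tail, which
  makes the flux out of \<open>lo J\<close> vanish as J grows.\<close>

lemma tail_coupling_bound:
  assumes "sq_summable x"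
  shows "cmod (\<Sum>j\<in>lo J. cnj (y j) * (\<Sum>\<^sub>\<infinity>k\<in>-lo J. W (j - k) (of_real t) * x k))
     \<le> B * geo \<theta> * (sqrt (\<Sum>j\<in>lo J. (cmod (y j))\<^sup>2) * sqrt (\<Sum>\<^sub>\<infinity>k\<in>-lo J. (cmod (x k))\<^sup>2))"
proof (rule has_sum_norm_le[OF tail_coupling_has_sum[OF assms]])
  fix F assume F: "finite F" "F \<subseteq> - lo J"
  have "cmod (\<Sum>k\<in>F. \<Sum>j\<in>lo J. cnj (y j) * (W (j - k) (of_real t) * x k))
     \<le> (\<Sum>k\<in>F. \<Sum>j\<in>lo J. cmod (W (j - k) (of_real t)) * (cmod (y j) * cmod (x k)))"
    by (intro sum_norm_le) (simp add: norm_mult mult_ac)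
  also have "\<dots> = (\<Sum>j\<in>lo J. \<Sum>k\<in>F. cmod (W (j - k) (of_real t)) * (cmod (y j) * cmod (x k)))"
    by (rule sum.swap)
  also have "\<dots> \<le> B * geo \<theta> * (sqrt (\<Sum>j\<in>lo J. (cmod (y j))\<^sup>2) * sqrt (\<Sum>k\<in>F. (cmod (x k))\<^sup>2))"
    using F by (intro schur_test) auto
  also have "\<dots> \<le> B * geo \<theta> * (sqrt (\<Sum>j\<in>lo J. (cmod (y j))\<^sup>2) * sqrt (\<Sum>\<^sub>\<infinity>k\<in>-lo J. (cmod (x k))\<^sup>2))"
    using B geo_pos[OF theta] F
    by (intro mult_left_mono real_sqrt_le_mono finite_sum_sq_le assms) (auto intro!: sum_nonneg)
  finally show "cmod (\<Sum>k\<in>F. \<Sum>j\<in>lo J. cnj (y j) * (W (j - k) (of_real t) * x k))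
     \<le> B * geo \<theta> * (sqrt (\<Sum>j\<in>lo J. (cmod (y j))\<^sup>2) * sqrt (\<Sum>\<^sub>\<infinity>k\<in>-lo J. (cmod (x k))\<^sup>2))" .
qed

lemma truncated_energy_derivative:
  assumes "flow c"
  obtains D where "\<And>t. ((\<lambda>t. \<Sum>j\<in>lo J. (cmod (c j t))\<^sup>2) has_real_derivative D t) (at t)"
    "\<And>t. \<bar>D t\<bar> \<le> 2 * (B * geo \<theta> * (sqrt (\<Sum>j\<in>lo J. (cmod (c j t))\<^sup>2) * sqrt (\<Sum>\<^sub>\<infinity>k\<in>-lo J. (cmod (c k t))\<^sup>2)))"
proof
  define c' where "c' j t = - \<i> * (of_int (j\<^sup>2) * c j t + (\<Sum>\<^sub>\<infinity>k. W (j - k) (of_real t) * c k t))" for j t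
  let ?D = "\<lambda>t. \<Sum>j\<in>lo J. 2 * Re (cnj (c j t) * c' j t)"
  fix t
  show "((\<lambda>t. \<Sum>j\<in>lo J. (cmod (c j t))\<^sup>2) has_real_derivative ?D t) (at t)"
    unfolding c'_def by (intro DERIV_sum has_real_derivative_cmod_sq flowD(3)[OF assms])
  let ?T = "\<Sum>j\<in>lo J. cnj (c j t) * (\<Sum>\<^sub>\<infinity>k\<in>-lo J. W (j - k) (of_real t) * c k t)"
  have "?D t = 2 * Im ?T"
    by (rule energy_identity[where t = t])
      (simp_all add: c'_def W_infsum_split[OF flowD(1)[OF assms], of _ t t J] add.assoc)
  moreover have "\<bar>Im ?T\<bar> \<le> cmod ?T" by (rule abs_Im_le_cmod)
  ultimately show "\<bar>?D t\<bar> \<le> 2 * (B * geo \<theta> * (sqrt (\<Sum>j\<in>lo J. (cmod (c j t))\<^sup>2) * sqrt (\<Sum>\<^sub>\<infinity>k\<in>-lo J. (cmod (c k t))\<^sup>2)))"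
    using tail_coupling_bound[OF flowD(1)[OF assms, of t], where J = J and y = "\<lambda>j. c j t" and t = t] by linarith
qed

text \<open>The energy in \<open>lo J\<close> changes only through the coupling with the modes outside \<open>lo J\<close>, and the
  energy of the latter tends to \<open>0\<close> uniformly on compact time intervals by Dini's argument.\<close>

lemma flow_norm_conserved:
  assumes c: "flow c"
  shows "(\<Sum>\<^sub>\<infinity>j. (cmod (c j t))\<^sup>2) = (\<Sum>\<^sub>\<infinity>j. (cmod (c j 0))\<^sup>2)"
proof -
  define n2 where "n2 s = (\<Sum>\<^sub>\<infinity>j. (cmod (c j s))\<^sup>2)" for s
  define E where "E J s = (\<Sum>j\<in>lo J. (cmod (c j s))\<^sup>2)" for J s
  define tl where "tl J s = (\<Sum>\<^sub>\<infinity>j\<in>-lo J. (cmod (c j s))\<^sup>2)" for J s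
  have split: "n2 s = E J s + tl J s" for J s
    unfolding n2_def E_def tl_def by (rule infsum_sq_split[OF flowD(1)[OF c] finite_lo])
  have tl0: "tl J s \<ge> 0" for J s unfolding tl_def by (rule infsum_nonneg) auto
  have E0: "E J s \<ge> 0" for J s unfolding E_def by (rule sum_nonneg) auto
  define T where "T = \<bar>t\<bar>"
  have unif: "\<exists>J. \<forall>s. \<bar>s\<bar> \<le> T \<longrightarrow> tl J s \<le> \<epsilon>" if "\<epsilon> > 0" for \<epsilon>
    using l2_curve_uniform_tail[of c \<epsilon> T, OF flowD(1)[OF c] flowD(2)[OF c] that] unfolding tl_def by blast
  \<comment> \<open>Conservation is not yet available, so a crude bound for the norm on the time
    interval comes first: the tail beyond J1 is at most 1 and the finite part is continuous in
    time.\<close>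
  obtain J1 where J1: "\<And>s. \<bar>s\<bar> \<le> T \<Longrightarrow> tl J1 s \<le> 1" using unif[of 1] by auto
  obtain D1 where D1: "\<And>t. ((E J1) has_real_derivative D1 t) (at t)"
    using truncated_energy_derivative[OF c, of J1] unfolding E_def by metis
  have "continuous_on {-T..T} (E J1)"
    by (intro continuous_at_imp_continuous_on ballI) (meson D1 DERIV_isCont)
  then have "bounded (E J1 ` {-T..T})" by (intro compact_imp_bounded compact_continuous_image) auto
  then obtain D0 where D0: "\<And>s. \<bar>s\<bar> \<le> T \<Longrightarrow> E J1 s \<le> D0"
    unfolding bounded_iff by (force simp: abs_le_iff)
  define N where "N = \<bar>D0\<bar> + 1"
  have n2N: "n2 s \<le> N" if "\<bar>s\<bar> \<le> T" for s
    using split[of s J1] J1[OF that] D0[OF that] by (simp add: N_def)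
  define K where "K = 2 * B * geo \<theta> * sqrt N * T"
  \<comment> \<open>With a cutoff whose tail is at most \<open>\<delta>\<^sup>2\<close> throughout
    the interval, the tails at times t and 0 account for 2 \<open>\<delta>\<^sup>2\<close>, and the
    flux, of order \<delta>, integrates to K \<delta>. Then \<delta> tends to 0.\<close>
  have est: "\<bar>n2 t - n2 0\<bar> \<le> 2 * \<delta>\<^sup>2 + K * \<delta>" if \<delta>: "\<delta> > 0" for \<delta>
  proof -
    obtain J where J: "\<And>s. \<bar>s\<bar> \<le> T \<Longrightarrow> tl J s \<le> \<delta>\<^sup>2" using unif[of "\<delta>\<^sup>2"] \<delta> by auto
    obtain D where D: "\<And>t. ((E J) has_real_derivative D t) (at t)"
      and Db: "\<And>t. \<bar>D t\<bar> \<le> 2 * (B * geo \<theta> * (sqrt (E J t) * sqrt (tl J t)))"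
      using truncated_energy_derivative[OF c, of J] unfolding E_def tl_def by metis
    have "norm (E J t - E J 0) \<le> (2 * B * geo \<theta> * sqrt N * \<delta>) * \<bar>t\<bar>"
    proof (rule mean_value_bound[of "E J" D])
      show "(E J has_vector_derivative D s) (at s)" for s
        using D by (simp add: has_real_derivative_iff_has_vector_derivative)
      fix s :: real assume s: "\<bar>s\<bar> \<le> \<bar>t\<bar>"
      then have sT: "\<bar>s\<bar> \<le> T" by (simp add: T_def)
      have "E J s \<le> N" using split[of s J] tl0[of J s] n2N[OF sT] by linarith
      moreover have "sqrt (tl J s) \<le> \<delta>" using J[OF sT] \<delta> by (intro real_le_lsqrt) (auto simp: tl0)
      ultimately have "sqrt (E J s) * sqrt (tl J s) \<le> sqrt N * \<delta>"
        using E0 tl0 \<delta> by (intro mult_mono) (auto simp: N_def)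
      then have "2 * (B * geo \<theta> * (sqrt (E J s) * sqrt (tl J s))) \<le> 2 * (B * geo \<theta> * (sqrt N * \<delta>))"
        using B geo_pos[OF theta] by (intro mult_left_mono) auto
      with Db[of s] show "norm (D s) \<le> 2 * B * geo \<theta> * sqrt N * \<delta>" by (simp add: mult.assoc)
    qed
    then have "\<bar>E J t - E J 0\<bar> \<le> K * \<delta>" by (simp add: K_def T_def mult_ac)
    moreover have "tl J t \<le> \<delta>\<^sup>2" "tl J 0 \<le> \<delta>\<^sup>2" using J[of t] J[of 0] by (auto simp: T_def)
    ultimately show ?thesis using split[of t J] split[of 0 J] tl0[of J t] tl0[of J 0] by linarith
  qed
  have "((\<lambda>\<delta>::real. 2 * \<delta>\<^sup>2 + K * \<delta>) \<longlongrightarrow> 2 * 0\<^sup>2 + K * 0) (at_right 0)"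
    by (intro tendsto_intros)
  moreover have "\<forall>\<^sub>F \<delta> in at_right 0. \<bar>n2 t - n2 0\<bar> \<le> 2 * \<delta>\<^sup>2 + K * \<delta>"
    using est by (auto simp: eventually_at_filter)
  ultimately have "\<bar>n2 t - n2 0\<bar> \<le> 2 * 0\<^sup>2 + K * 0"
    by (rule tendsto_lowerbound) auto
  then show ?thesis by (simp add: n2_def)
qed

section \<open>Comparison of exact and approximate flows\<close>

lemma approx_flowD:
  assumes "approx_flow K e v v'"
  shows "(v j has_vector_derivative v' j t) (at t)" "j \<notin> lo K \<Longrightarrow> v j t = 0"
    "finite F \<Longrightarrow> (\<Sum>j\<in>F. cmod (\<i> * v' j t - of_int (j\<^sup>2) * v j t - (\<Sum>k\<in>lo K. W (j - k) (of_real t) * v k t)))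
        \<le> e * sqrt (\<Sum>k\<in>lo K. (cmod (v k t))\<^sup>2)"
  using assms unfolding approx_flow_def by blast+

text \<open>Every |v j| is at most the norm of v, and the residual is bounded in l^1 by e times that
  norm. The energy therefore changes at relative rate at most 2 e.\<close>

lemma approx_flow_energy:
  assumes v: "approx_flow K e v v'"
  shows "(\<Sum>k\<in>lo K. (cmod (v k t))\<^sup>2) \<le> (\<Sum>k\<in>lo K. (cmod (v k 0))\<^sup>2) * exp (2 * e * \<bar>t\<bar>)"
proof (rule growth_bound_of_relative_derivative)
  fix t
  define E where "E = (\<Sum>k\<in>lo K. (cmod (v k t))\<^sup>2)"
  have E0: "E \<ge> 0" unfolding E_def by (rule sum_nonneg) auto
  let ?D = "\<Sum>j\<in>lo K. 2 * Re (cnj (v j t) * v' j t)"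
  show "((\<lambda>t. \<Sum>k\<in>lo K. (cmod (v k t))\<^sup>2) has_real_derivative ?D) (at t)"
    by (intro DERIV_sum has_real_derivative_cmod_sq approx_flowD(1)[OF v])
  define r where "r j = \<i> * v' j t - of_int (j\<^sup>2) * v j t - (\<Sum>k\<in>lo K. W (j - k) (of_real t) * v k t)" for j
  let ?T = "\<Sum>j\<in>lo K. cnj (v j t) * r j"
  have D: "?D = 2 * Im ?T"
    by (rule energy_identity[where t = t]) (simp_all add: r_def algebra_simps)
  have "cmod ?T \<le> (\<Sum>j\<in>lo K. sqrt E * cmod (r j))"
  proof (rule sum_norm_le)
    fix j assume "j \<in> lo K"
    then have "cmod (v j t) \<le> sqrt E" unfolding E_def
      by (intro real_le_rsqrt member_le_sum[of j _ "\<lambda>k. (cmod (v k t))\<^sup>2"]) auto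
    then show "cmod (cnj (v j t) * r j) \<le> sqrt E * cmod (r j)"
      by (simp add: norm_mult mult_right_mono)
  qed
  also have "\<dots> \<le> sqrt E * (e * sqrt E)"
    unfolding sum_distrib_left[symmetric] E_def r_def
    by (intro mult_left_mono approx_flowD(3)[OF v] finite_lo real_sqrt_ge_zero sum_nonneg) auto
  also have "\<dots> = e * E" using E0 by simp
  finally show "\<bar>?D\<bar> \<le> 2 * e * (\<Sum>k\<in>lo K. (cmod (v k t))\<^sup>2)"
    unfolding D E_def[symmetric] using abs_Im_le_cmod[of ?T] by linarith
qed

text \<open>In the derivative the kinetic terms cancel, and so do the Hermitian couplings inside
  \<open>lo K\<close>. What remains is i times the pairing of c with the residual of v over all
  integers. An l^1 bound on the residual then suffices, since conservation of the norm bounds every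
  |c j| uniformly in time.\<close>

lemma pairing_almost_conserved:
  assumes c: "flow c" and v: "approx_flow K e v v'" and e: "e \<ge> 0"
  shows "cmod ((\<Sum>j\<in>lo K. cnj (v j t) * c j t) - (\<Sum>j\<in>lo K. cnj (v j 0) * c j 0))
    \<le> sqrt (\<Sum>\<^sub>\<infinity>j. (cmod (c j 0))\<^sup>2) * (e * (sqrt (\<Sum>k\<in>lo K. (cmod (v k 0))\<^sup>2) * exp (e * \<bar>t\<bar>))) * \<bar>t\<bar>"
proof -
  define n where "n = sqrt (\<Sum>\<^sub>\<infinity>j. (cmod (c j 0))\<^sup>2)"
  define E where "E t = (\<Sum>k\<in>lo K. (cmod (v k t))\<^sup>2)" for t
  define c' where "c' j t = - \<i> * (of_int (j\<^sup>2) * c j t + (\<Sum>\<^sub>\<infinity>k. W (j - k) (of_real t) * c k t))" for j t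
  have c_n: "cmod (c j t) \<le> n" for j t
    unfolding n_def flow_norm_conserved[OF c, of t, symmetric]
    using finite_sum_sq_le[OF flowD(1)[OF c], of "{j}" UNIV t] by (intro real_le_rsqrt) auto
  define I' where "I' t = (\<Sum>j\<in>lo K. cnj (v j t) * c' j t + cnj (v' j t) * c j t)" for t
  have "cmod ((\<Sum>j\<in>lo K. cnj (v j t) * c j t) - (\<Sum>j\<in>lo K. cnj (v j 0) * c j 0))
    \<le> (n * (e * (sqrt (E 0) * exp (e * \<bar>t\<bar>)))) * \<bar>t\<bar>"
  proof (rule mean_value_bound[where f' = I'])
    fix s
    show "((\<lambda>t. \<Sum>j\<in>lo K. cnj (v j t) * c j t) has_vector_derivative I' s) (at s)"
      unfolding I'_def c'_def
      by (intro has_vector_derivative_sum has_vector_derivative_mult flowD(3)[OF c]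
          bounded_linear.has_vector_derivative[OF bounded_linear_cnj] approx_flowD(1)[OF v])
    assume s: "\<bar>s\<bar> \<le> \<bar>t\<bar>"
    define r where "r j = \<i> * v' j s - of_int (j\<^sup>2) * v j s - (\<Sum>k\<in>lo K. W (j - k) (of_real s) * v k s)" for j
    define T where "T j = (\<Sum>\<^sub>\<infinity>k\<in>-lo K. W (j - k) (of_real s) * c k s)" for j
    define R where "R = (\<Sum>j\<in>lo K. cnj (r j) * c j s) - (\<Sum>j\<in>lo K. cnj (v j s) * T j)"
    have "I' s = \<i> * R + \<i> * ((\<Sum>j\<in>lo K. \<Sum>k\<in>lo K. cnj (W (j - k) (of_real s) * v k s) * c j s)
        - (\<Sum>j\<in>lo K. \<Sum>k\<in>lo K. cnj (v j s) * (W (j - k) (of_real s) * c k s)))"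
    proof -
      have "cnj (v j s) * c' j s + cnj (v' j s) * c j s =
         \<i> * (cnj (r j) * c j s - cnj (v j s) * T j
          + (\<Sum>k\<in>lo K. cnj (W (j - k) (of_real s) * v k s) * c j s)
          - (\<Sum>k\<in>lo K. cnj (v j s) * (W (j - k) (of_real s) * c k s)))" for j
      proof -
        have v': "cnj (v' j s) = \<i> * (cnj (r j) + of_int (j\<^sup>2) * cnj (v j s) + cnj (\<Sum>k\<in>lo K. W (j - k) (of_real s) * v k s))"
          by (simp add: r_def algebra_simps)
        have W: "(\<Sum>k\<in>lo K. cnj (W (j - k) (of_real s) * v k s) * c j s) = cnj (\<Sum>k\<in>lo K. W (j - k) (of_real s) * v k s) * c j s"
          by (simp add: sum_distrib_right)
        show ?thesis
          unfolding c'_def v' W W_infsum_split[OF flowD(1)[OF c], of j s s K] T_def[symmetric] sum_distrib_left[symmetric]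
          by (simp add: algebra_simps del: cnj_sum complex_cnj_mult)
      qed
      then show ?thesis unfolding I'_def R_def
        by (simp only: sum_distrib_left[symmetric] sum.distrib sum_subtractf)
          (simp add: algebra_simps del: cnj_sum complex_cnj_mult)
    qed
    then have I'R: "I' s = \<i> * R" by (simp only: W_swap[OF finite_lo]) simp
    have v'0: "v' k s = 0" if "k \<notin> lo K" for k
    proof -
      have "v k = (\<lambda>t. 0)" using approx_flowD(2)[OF v that] by auto
      then have "((\<lambda>t. 0) has_vector_derivative v' k s) (at s)" using approx_flowD(1)[OF v, of k s] by simp
      then show ?thesis using has_vector_derivative_const[of 0 "at s"] vector_derivative_unique_at by blast
    qed
    \<comment> \<open>Outside \<open>lo K\<close> the residual is minus the potential applied to v.
      Moving the potential onto c by Hermitian symmetry turns the residual terms beyond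
      \<open>lo K\<close> into the coupling of c to its own tail, so R is a single sum over all
      integers.\<close>
    have far: "cnj (r k) * c k s = - (\<Sum>j\<in>lo K. cnj (v j s) * (W (j - k) (of_real s) * c k s))" if "k \<in> - lo K" for k
    proof -
      have "cnj (W (k - j) (of_real s)) = W (j - k) (of_real s)" for j using sym[of "k - j" s] by simp
      then have "cnj (r k) = - (\<Sum>j\<in>lo K. cnj (v j s) * W (j - k) (of_real s))"
        using that v'0[of k] approx_flowD(2)[OF v, of k s] by (simp add: r_def mult.commute)
      then show ?thesis by (simp add: sum_distrib_right mult.assoc)
    qed
    have "((\<lambda>k. - (\<Sum>j\<in>lo K. cnj (v j s) * (W (j - k) (of_real s) * c k s))) has_sum - (\<Sum>j\<in>lo K. cnj (v j s) * T j)) (- lo K)"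
      unfolding T_def has_sum_uminus minus_minus by (rule tail_coupling_has_sum[OF flowD(1)[OF c]])
    then have "((\<lambda>k. cnj (r k) * c k s) has_sum - (\<Sum>j\<in>lo K. cnj (v j s) * T j)) (- lo K)"
      by (rule has_sum_cong[THEN iffD1, rotated]) (simp add: far)
    then have "((\<lambda>k. cnj (r k) * c k s) has_sum ((\<Sum>j\<in>lo K. cnj (r j) * c j s) + - (\<Sum>j\<in>lo K. cnj (v j s) * T j))) (lo K \<union> - lo K)"
      by (intro has_sum_Un_disjoint has_sum_finite) auto
    then have "((\<lambda>k. cnj (r k) * c k s) has_sum R) UNIV" by (simp add: R_def)
    then have "cmod R \<le> n * (e * sqrt (E s))"
    proof (rule has_sum_norm_le)
      fix F :: "int set" assume F: "finite F"
      have n0: "n \<ge> 0" by (simp add: n_def infsum_nonneg)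
      have "cmod (\<Sum>k\<in>F. cnj (r k) * c k s) \<le> (\<Sum>k\<in>F. n * cmod (r k))"
        using c_n n0 by (intro sum_norm_le) (subst norm_mult, subst mult.commute, simp add: mult_right_mono)
      also have "\<dots> \<le> n * (e * sqrt (E s))"
        unfolding sum_distrib_left[symmetric] r_def E_def
        by (intro mult_left_mono approx_flowD(3)[OF v F] n0)
      finally show "cmod (\<Sum>k\<in>F. cnj (r k) * c k s) \<le> n * (e * sqrt (E s))" .
    qed
    also have "\<dots> \<le> n * (e * (sqrt (E 0) * exp (e * \<bar>t\<bar>)))"
    proof (intro mult_left_mono e)
      have "E s \<le> E 0 * exp (2 * e * \<bar>s\<bar>)" unfolding E_def by (rule approx_flow_energy[OF v])
      also have "\<dots> \<le> E 0 * exp (2 * e * \<bar>t\<bar>)"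
        using e s by (intro mult_left_mono) (auto simp: E_def intro!: sum_nonneg mult_left_mono)
      also have "\<dots> = E 0 * (exp (e * \<bar>t\<bar>))\<^sup>2" by (simp add: exp_double[symmetric] mult.assoc)
      finally have "sqrt (E s) \<le> sqrt (E 0 * (exp (e * \<bar>t\<bar>))\<^sup>2)" by (rule real_sqrt_le_mono)
      then show "sqrt (E s) \<le> sqrt (E 0) * exp (e * \<bar>t\<bar>)" by (simp add: real_sqrt_mult)
    qed (simp add: n_def infsum_nonneg)
    finally show "cmod (I' s) \<le> n * (e * (sqrt (E 0) * exp (e * \<bar>t\<bar>)))" by (simp add: I'R norm_mult)
  qed
  then show ?thesis by (simp add: n_def E_def)
qed

end

section \<open>Decoupling of high frequencies\<close>

context exp_potential
begin

lemma approx_error_nonneg: "approx_error M N \<ge> 0"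
  using B S_pos by (simp add: approx_error_def C\<^sub>1_def)

text \<open>The energy of c beyond 2M is at most |c - v|^2, which is |c|^2 + |v|^2 - 2 Re <v, c>.
  All three quantities are almost constant in time, so the bound can be evaluated at time 0, where c
  and v agree on \<open>lo M\<close>. The second cutoff L divides the initial data: modes beyond L
  belong to the tail, and modes below L reach \<open>hi M\<close> only through the factor exp
  (-\<theta> (M - L)).\<close>

lemma tail_estimate:
  assumes c: "flow c" and M: "M > 0" and N: "(real N + 2) / \<rho> + C\<^sub>1 \<le> M / 2"
    and F: "finite F" "F \<inter> lo (2 * M) = {}" and t: "approx_error M N * \<bar>t\<bar> \<le> 1 / 2" and L: "L \<le> M"
  shows "(\<Sum>j\<in>F. (cmod (c j t))\<^sup>2) \<le> (2 + 128 * B\<^sup>2) * (\<Sum>\<^sub>\<infinity>j\<in>-lo L. (cmod (c j 0))\<^sup>2)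
    + (128 * B\<^sup>2 * exp (- \<theta> * (real M - real L)) + 8 * (1 + 128 * B\<^sup>2) * (approx_error M N * \<bar>t\<bar>))
      * (\<Sum>\<^sub>\<infinity>j. (cmod (c j 0))\<^sup>2)"
proof -
  obtain v v' where v: "approx_flow (2 * M) (approx_error M N) v v'"
    and vlo: "\<And>k. k \<in> lo M \<Longrightarrow> v k 0 = c k 0"
    and vhi: "\<And>j. j \<in> hi M \<Longrightarrow> cmod (v j 0) \<le> 2 * B / M * (\<Sum>k\<in>lo M. wt j k * cmod (c k 0))"
    using approximate_solution[OF M N, of "\<lambda>k. c k 0"] by blast
  define e where "e = approx_error M N"
  have e0: "e \<ge> 0" unfolding e_def by (rule approx_error_nonneg)
  define x where "x = e * \<bar>t\<bar>"
  have x: "0 \<le> x" "x \<le> 1 / 2" using e0 t by (auto simp: x_def e_def)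
  define n2 where "n2 = (\<Sum>\<^sub>\<infinity>j. (cmod (c j 0))\<^sup>2)"
  have n20: "n2 \<ge> 0" unfolding n2_def by (rule infsum_nonneg) auto
  define tl where "tl = (\<Sum>\<^sub>\<infinity>j\<in>-lo L. (cmod (c j 0))\<^sup>2)"
  have tl0: "tl \<ge> 0" unfolding tl_def by (rule infsum_nonneg) auto
  define q where "q = exp (- \<theta> * (real M - real L))"
  have q: "0 \<le> q" "q \<le> 1" using theta L by (auto simp: q_def)
  have tl_n2: "tl \<le> n2"
    unfolding n2_def infsum_sq_split[OF flowD(1)[OF c] finite_lo[of L]] tl_def by (simp add: sum_nonneg)
  define E where "E s = (\<Sum>k\<in>lo (2 * M). (cmod (v k s))\<^sup>2)" for s
  define Ec where "Ec s = (\<Sum>k\<in>lo (2 * M). (cmod (c k s))\<^sup>2)" for s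
  define I where "I s = (\<Sum>j\<in>lo (2 * M). cnj (v j s) * c j s)" for s
  have E0: "E s \<ge> 0" for s unfolding E_def by (rule sum_nonneg) auto
  have dist: "(\<Sum>k\<in>lo (2 * M). (cmod (c k s - v k s))\<^sup>2) = Ec s + E s - 2 * Re (I s)" for s
  proof -
    have "(cmod (c k s - v k s))\<^sup>2 = (cmod (c k s))\<^sup>2 + (cmod (v k s))\<^sup>2 - 2 * Re (cnj (v k s) * c k s)" for k
      unfolding cmod_power2 by (simp add: power2_eq_square algebra_simps)
    then show ?thesis
      by (simp add: Ec_def E_def I_def sum.distrib sum_subtractf sum_distrib_left)
  qed
  \<comment> \<open>F and \<open>lo (2 * M)\<close> are disjoint, so their energies add up to at
    most n2; nonnegativity of |c - v|^2 on \<open>lo (2 * M)\<close> bounds the energy of c there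
    from below by 2 Re I - E.\<close>
  have step1: "(\<Sum>j\<in>F. (cmod (c j t))\<^sup>2) \<le> n2 + E t - 2 * Re (I t)"
  proof -
    have "(\<Sum>j\<in>F. (cmod (c j t))\<^sup>2) + Ec t = (\<Sum>j\<in>F \<union> lo (2 * M). (cmod (c j t))\<^sup>2)"
      unfolding Ec_def using F by (intro sum.union_disjoint[symmetric]) auto
    also have "\<dots> \<le> (\<Sum>\<^sub>\<infinity>j. (cmod (c j t))\<^sup>2)"
      using F by (intro finite_sum_sq_le flowD(1)[OF c]) auto
    also have "\<dots> = n2" unfolding n2_def by (rule flow_norm_conserved[OF c])
    finally have "(\<Sum>j\<in>F. (cmod (c j t))\<^sup>2) + Ec t \<le> n2" .
    moreover have "0 \<le> (\<Sum>k\<in>lo (2 * M). (cmod (c k t - v k t))\<^sup>2)" by (rule sum_nonneg) auto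
    ultimately show ?thesis unfolding dist by linarith
  qed
  \<comment> \<open>By Cauchy-Schwarz the sum over at most 2M low modes costs a factor 2M, and there
    are at most 4M modes j. Both factors are paid for by the square of 2 B / M.\<close>
  have hi_v: "(\<Sum>j\<in>hi M. (cmod (v j 0))\<^sup>2) \<le> 64 * B\<^sup>2 * (tl + q * n2)"
  proof -
    have "(cmod (v j 0))\<^sup>2 \<le> 16 * B\<^sup>2 / M * (tl + q * n2)" if j: "j \<in> hi M" for j
    proof -
      let ?a = "\<Sum>k\<in>lo M - lo L. wt j k * cmod (c k 0)" and ?b = "\<Sum>k\<in>lo L. wt j k * cmod (c k 0)"
      have ab: "(\<Sum>k\<in>lo M. wt j k * cmod (c k 0)) = ?a + ?b"
        using lo_mono[OF L] by (intro sum.subset_diff) auto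
      have "?a\<^sup>2 \<le> real (card (lo M - lo L)) * (\<Sum>k\<in>lo M - lo L. (wt j k * cmod (c k 0))\<^sup>2)"
        by (rule sum_le_sqrt_card_mult)
      also have "\<dots> \<le> real (2 * M) * tl"
      proof (rule mult_mono)
        have "card (lo M - lo L) \<le> card (lo M)" by (rule card_mono) auto
        then show "real (card (lo M - lo L)) \<le> real (2 * M)" using card_lo[of M] by linarith
        have "(\<Sum>k\<in>lo M - lo L. (wt j k * cmod (c k 0))\<^sup>2) \<le> (\<Sum>k\<in>lo M - lo L. (cmod (c k 0))\<^sup>2)"
        proof (rule sum_mono)
          fix k assume k: "k \<in> lo M - lo L"
          have "wt j k \<le> 1" using theta j k by (auto simp: wt_def hi_def lo_def)
          then have "wt j k * cmod (c k 0) \<le> 1 * cmod (c k 0)" by (intro mult_right_mono) auto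
          then show "(wt j k * cmod (c k 0))\<^sup>2 \<le> (cmod (c k 0))\<^sup>2"
            using wt_pos[of j k] by (intro power_mono) auto
        qed
        also have "\<dots> \<le> tl" unfolding tl_def by (intro finite_sum_sq_le flowD(1)[OF c]) auto
        finally show "(\<Sum>k\<in>lo M - lo L. (wt j k * cmod (c k 0))\<^sup>2) \<le> tl" .
      qed (auto intro: sum_nonneg)
      finally have a: "?a\<^sup>2 \<le> real (2 * M) * tl" .
      have "?b\<^sup>2 \<le> real (card (lo L)) * (\<Sum>k\<in>lo L. (wt j k * cmod (c k 0))\<^sup>2)"
        by (rule sum_le_sqrt_card_mult)
      also have "\<dots> \<le> real (2 * M) * (q * n2)"
      proof (rule mult_mono)
        show "real (card (lo L)) \<le> real (2 * M)" using card_lo[of L] L by linarith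
        have "(\<Sum>k\<in>lo L. (wt j k * cmod (c k 0))\<^sup>2) \<le> (\<Sum>k\<in>lo L. q * (cmod (c k 0))\<^sup>2)"
        proof (rule sum_mono)
          fix k assume k: "k \<in> lo L"
          have "real M - real L \<le> \<bar>real_of_int j\<bar> - \<bar>real_of_int k\<bar>" using j k by (auto simp: hi_def lo_def)
          then have "\<theta> * (real M - real L) \<le> \<theta> * (\<bar>real_of_int j\<bar> - \<bar>real_of_int k\<bar>)"
            using theta by (intro mult_left_mono) auto
          \<comment> \<open>Squaring restores the full rate \<theta> from the rate \<theta> / 2 of
            the weight.\<close>
          then have "(wt j k)\<^sup>2 \<le> q"
            by (simp add: wt_def q_def power2_eq_square exp_add[symmetric])
          then show "(wt j k * cmod (c k 0))\<^sup>2 \<le> q * (cmod (c k 0))\<^sup>2"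
            unfolding power_mult_distrib by (intro mult_right_mono) auto
        qed
        also have "\<dots> \<le> q * n2" unfolding sum_distrib_left[symmetric] n2_def
          using q by (intro mult_left_mono finite_sum_sq_le flowD(1)[OF c]) auto
        finally show "(\<Sum>k\<in>lo L. (wt j k * cmod (c k 0))\<^sup>2) \<le> q * n2" .
      qed (auto intro: sum_nonneg)
      finally have b: "?b\<^sup>2 \<le> real (2 * M) * (q * n2)" .
      have "(?a + ?b)\<^sup>2 \<le> 2 * ?a\<^sup>2 + 2 * ?b\<^sup>2"
        using sum_squares_bound[of ?a ?b] by (simp add: power2_sum)
      also have "\<dots> \<le> 4 * M * (tl + q * n2)" using a b by (simp add: algebra_simps)
      finally have ab2: "(?a + ?b)\<^sup>2 \<le> 4 * M * (tl + q * n2)" .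
      have "(cmod (v j 0))\<^sup>2 \<le> (2 * B / M * (?a + ?b))\<^sup>2"
        using vhi[OF j] unfolding ab by (intro power_mono) auto
      also have "\<dots> = 4 * B\<^sup>2 / M^2 * (?a + ?b)\<^sup>2" by (simp add: power_mult_distrib power_divide)
      also have "\<dots> \<le> 4 * B\<^sup>2 / M^2 * (4 * M * (tl + q * n2))" by (intro mult_left_mono ab2) auto
      also have "\<dots> = 16 * B\<^sup>2 / M * (tl + q * n2)" using M by (simp add: power2_eq_square)
      finally show ?thesis .
    qed
    then have "(\<Sum>j\<in>hi M. (cmod (v j 0))\<^sup>2) \<le> real (card (hi M)) * (16 * B\<^sup>2 / M * (tl + q * n2))"
      by (intro sum_bounded_above) auto
    also have "\<dots> \<le> real (4 * M) * (16 * B\<^sup>2 / M * (tl + q * n2))"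
      using card_hi[of M] tl0 n20 q by (intro mult_right_mono mult_nonneg_nonneg) (auto simp del: of_nat_mult)
    also have "\<dots> = 64 * B\<^sup>2 * (tl + q * n2)" using M by simp
    finally show ?thesis .
  qed
  have Elo: "(\<Sum>k\<in>lo M. (cmod (c k 0))\<^sup>2) \<le> n2"
    unfolding n2_def by (intro finite_sum_sq_le flowD(1)[OF c]) auto
  define A where "A = 1 + 128 * B\<^sup>2"
  have E_A: "E 0 \<le> A * n2"
  proof -
    have "E 0 = (\<Sum>k\<in>lo M. (cmod (c k 0))\<^sup>2) + (\<Sum>j\<in>hi M. (cmod (v j 0))\<^sup>2)"
      unfolding E_def sum_lo_split by (simp add: vlo)
    also have "\<dots> \<le> n2 + 64 * B\<^sup>2 * (tl + q * n2)" by (intro add_mono Elo hi_v)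
    also have "\<dots> \<le> n2 + 64 * B\<^sup>2 * (n2 + 1 * n2)"
      using tl_n2 q n20 by (intro add_left_mono mult_left_mono add_mono mult_right_mono) auto
    finally show ?thesis by (simp add: A_def algebra_simps)
  qed
  have A1: "A \<ge> 1" by (simp add: A_def)
  \<comment> \<open>The hypothesis x \<le> 1/2 is what linearizes the exponentials: exp (2 x) \<le>
    1 + 4 x here, and exp x \<le> 2 in the next step.\<close>
  have step2: "E t \<le> E 0 + 4 * x * (A * n2)"
  proof -
    have "exp (2 * x) \<le> 1 + 2 * x + (2 * x)\<^sup>2" using x by (intro exp_bound) auto
    also have "(2 * x)\<^sup>2 \<le> 2 * x" using x mult_left_mono[of "2 * x" 1 "2 * x"] by (simp add: power2_eq_square)
    finally have ex: "exp (2 * x) \<le> 1 + 4 * x" by simp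
    have "E t \<le> E 0 * exp (2 * x)"
      using approx_flow_energy[OF v, of t] by (simp add: E_def x_def e_def mult.assoc)
    also have "\<dots> \<le> E 0 * (1 + 4 * x)" by (intro mult_left_mono ex E0)
    also have "\<dots> = E 0 + 4 * x * E 0" by (simp add: algebra_simps)
    also have "\<dots> \<le> E 0 + 4 * x * (A * n2)" using x by (intro add_left_mono mult_left_mono E_A) auto
    finally show ?thesis .
  qed
  have step3: "Re (I t) \<ge> Re (I 0) - 2 * x * (A * n2)"
  proof -
    have "exp x \<le> 1 + x + x\<^sup>2" using x by (intro exp_bound) auto
    moreover have "x\<^sup>2 \<le> 1/4" using x power_mono[of x "1/2" 2] by (simp add: power2_eq_square)
    ultimately have ex: "exp x \<le> 2" using x by linarith
    have "sqrt n2 * sqrt (E 0) \<le> sqrt (A * n2) * sqrt (A * n2)"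
      using E_A A1 n20 E0 mult_right_mono[OF A1 n20] by (intro mult_mono) auto
    also have "\<dots> = A * n2" using A1 n20 by simp
    finally have nE: "sqrt n2 * sqrt (E 0) \<le> A * n2" .
    have "cmod (I t - I 0) \<le> sqrt n2 * (e * (sqrt (E 0) * exp (e * \<bar>t\<bar>))) * \<bar>t\<bar>"
      using pairing_almost_conserved[OF c v, of t] e0 by (simp add: I_def E_def n2_def e_def)
    also have "\<dots> = x * exp x * (sqrt n2 * sqrt (E 0))" by (simp add: x_def mult_ac)
    also have "\<dots> \<le> x * 2 * (A * n2)"
      using x n20 E0 by (intro mult_mono[OF mult_left_mono[OF ex x(1)] nE]) auto
    finally have "cmod (I t - I 0) \<le> 2 * x * (A * n2)" by simp
    then show ?thesis using abs_Re_le_cmod[of "I t - I 0"] by simp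
  qed
  \<comment> \<open>At time 0 this expression is exactly |c - v|^2. It vanishes on
    \<open>lo M\<close>, which leaves c - v on \<open>hi M\<close> and c alone beyond 2M.\<close>
  have step4: "n2 + E 0 - 2 * Re (I 0) \<le> 2 * tl + 2 * (64 * B\<^sup>2 * (tl + q * n2))"
  proof -
    define tl2 where "tl2 = (\<Sum>\<^sub>\<infinity>j\<in>-lo (2 * M). (cmod (c j 0))\<^sup>2)"
    have "n2 = Ec 0 + tl2"
      unfolding n2_def Ec_def tl2_def by (rule infsum_sq_split[OF flowD(1)[OF c] finite_lo])
    then have "n2 + E 0 - 2 * Re (I 0) = tl2 + (\<Sum>k\<in>lo (2 * M). (cmod (c k 0 - v k 0))\<^sup>2)"
      unfolding dist by simp
    also have "(\<Sum>k\<in>lo (2 * M). (cmod (c k 0 - v k 0))\<^sup>2) = (\<Sum>k\<in>hi M. (cmod (c k 0 - v k 0))\<^sup>2)"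
      unfolding sum_lo_split by (simp add: vlo)
    also have "\<dots> \<le> (\<Sum>k\<in>hi M. 2 * (cmod (c k 0))\<^sup>2 + 2 * (cmod (v k 0))\<^sup>2)"
      using cmod_sq_add_le[of _ "- _"] by (intro sum_mono) (metis diff_conv_add_uminus norm_minus_cancel)
    also have "\<dots> = 2 * (\<Sum>k\<in>hi M. (cmod (c k 0))\<^sup>2) + 2 * (\<Sum>k\<in>hi M. (cmod (v k 0))\<^sup>2)"
      by (simp add: sum.distrib sum_distrib_left)
    finally have 1: "n2 + E 0 - 2 * Re (I 0) \<le> tl2 + 2 * (\<Sum>k\<in>hi M. (cmod (c k 0))\<^sup>2) + 2 * (\<Sum>k\<in>hi M. (cmod (v k 0))\<^sup>2)"
      by simp
    have "n2 = (\<Sum>k\<in>lo M. (cmod (c k 0))\<^sup>2) + (\<Sum>\<^sub>\<infinity>j\<in>-lo M. (cmod (c j 0))\<^sup>2)"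
      unfolding n2_def by (rule infsum_sq_split[OF flowD(1)[OF c] finite_lo])
    then have "(\<Sum>k\<in>hi M. (cmod (c k 0))\<^sup>2) + tl2 = (\<Sum>\<^sub>\<infinity>j\<in>-lo M. (cmod (c j 0))\<^sup>2)"
      using \<open>n2 = Ec 0 + tl2\<close> by (simp add: Ec_def sum_lo_split)
    also have "\<dots> \<le> tl" unfolding tl_def by (rule tail_antimono[OF flowD(1)[OF c] L])
    finally have "(\<Sum>k\<in>hi M. (cmod (c k 0))\<^sup>2) + tl2 \<le> tl" .
    moreover have "tl2 \<ge> 0" unfolding tl2_def by (rule infsum_nonneg) auto
    ultimately show ?thesis using 1 hi_v by linarith
  qed
  have "(\<Sum>j\<in>F. (cmod (c j t))\<^sup>2) \<le> 2 * tl + 2 * (64 * B\<^sup>2 * (tl + q * n2)) + 4 * x * (A * n2) + 2 * (2 * x * (A * n2))"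
    using step1 step2 step3 step4 by linarith
  also have "\<dots> = (2 + 128 * B\<^sup>2) * tl + (128 * B\<^sup>2 * q + 8 * A * x) * n2" by (simp add: algebra_simps)
  finally show ?thesis by (simp only: tl_def n2_def q_def A_def x_def e_def)
qed

end

text \<open>Rounding down loses at most one factor 1/2, hence the constant 2.\<close>

lemma half_power_nat_floor_le: "(1/2::real) ^ nat \<lfloor>y\<rfloor> \<le> 2 * exp (- ln 2 * y)"
proof -
  have "y - 1 \<le> real (nat \<lfloor>y\<rfloor>)" by linarith
  then have "exp (- ln 2 * real (nat \<lfloor>y\<rfloor>)) \<le> exp (- ln 2 * (y - 1))"
    by (simp add: mult_left_mono)
  also have "- ln 2 * (y - 1) = ln 2 + (- ln 2 * y)" by (simp add: algebra_simps)
  also have "exp \<dots> = 2 * exp (- ln 2 * y)" by (simp only: exp_add) simp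
  also have "exp (- ln 2 * real (nat \<lfloor>y\<rfloor>)) = (1/2::real) ^ nat \<lfloor>y\<rfloor>"
    by (simp add: exp_minus exp_of_nat2_mult power_one_over inverse_eq_divide)
  finally show ?thesis .
qed

context exp_potential
begin

text \<open>Fixes N and L in terms of M: N about \<rho> M / 8 makes the error exponentially small in
  M, and L = M div 2 makes the influence of the lowest data exponentially small as well.\<close>

lemma tail_decoupling:
  obtains \<kappa> A :: real and M0 :: nat where "\<kappa> > 0" "A \<ge> 0" "M0 > 0"
    "\<And>c M t F. flow c \<Longrightarrow> M0 \<le> M \<Longrightarrow> \<bar>t\<bar> \<le> exp (\<kappa> * real M) \<Longrightarrow> finite F \<Longrightarrow> F \<inter> lo (2 * M) = {} \<Longrightarrow>
       (\<Sum>j\<in>F. (cmod (c j t))\<^sup>2) \<le> A * (\<Sum>\<^sub>\<infinity>j\<in>-lo (M div 2). (cmod (c j 0))\<^sup>2)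
          + A * exp (- \<kappa> * real M) * (\<Sum>\<^sub>\<infinity>j. (cmod (c j 0))\<^sup>2)"
proof -
  \<comment> \<open>The error decays at rate 4 \<kappa>, up to a factor M^3. One \<kappa> is spent
    on the time span exp (\<kappa> M), two absorb the polynomial factor, and one remains.\<close>
  define \<kappa> where "\<kappa> = min (\<rho> * ln 2 / 8) (\<theta> / 2) / 4"
  have \<kappa>: "\<kappa> > 0" using rho theta by (simp add: \<kappa>_def)
  have \<kappa>4: "4 * \<kappa> \<le> \<rho> * ln 2 / 8" "4 * \<kappa> \<le> \<theta> / 2" by (auto simp: \<kappa>_def)
  define D where "D = 64 * B + C\<^sub>1"
  have C1: "C\<^sub>1 \<ge> 0" using B S_pos by (simp add: C\<^sub>1_def)
  have D: "D \<ge> 0" using B C1 by (simp add: D_def)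
  have "((\<lambda>M. (2 * \<kappa> * real M) ^ 3 / exp (2 * \<kappa> * real M)) \<longlongrightarrow> 0) sequentially"
    using \<kappa> by (intro filterlim_compose[OF tendsto_power_div_exp_0[of 3]]
        filterlim_tendsto_pos_mult_at_top[OF tendsto_const] filterlim_real_sequentially) auto
  then have "((\<lambda>M. D / (2 * \<kappa>) ^ 3 * ((2 * \<kappa> * real M) ^ 3 / exp (2 * \<kappa> * real M))) \<longlongrightarrow> D / (2 * \<kappa>) ^ 3 * 0) sequentially"
    by (intro tendsto_intros)
  then have "\<forall>\<^sub>F M in sequentially. D / (2 * \<kappa>) ^ 3 * ((2 * \<kappa> * real M) ^ 3 / exp (2 * \<kappa> * real M)) < 1 / 2"
    by (rule order_tendstoD) simp
  then obtain M1 where M1: "\<And>M. M \<ge> M1 \<Longrightarrow> D / (2 * \<kappa>) ^ 3 * ((2 * \<kappa> * real M) ^ 3 / exp (2 * \<kappa> * real M)) < 1 / 2"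
    unfolding eventually_sequentially by auto
  obtain M2 where M2: "3 * (2 / \<rho> + C\<^sub>1) \<le> real M2" using real_arch_simple by blast
  define M0 where "M0 = Suc (max M1 M2)"
  define A where "A = 2 + 128 * B\<^sup>2 + 8 * (1 + 128 * B\<^sup>2) + 128 * B\<^sup>2"
  show thesis
  proof (rule that[of \<kappa> A M0])
    fix c M t and F :: "int set"
    assume c: "flow c" and M: "M0 \<le> M" and t: "\<bar>t\<bar> \<le> exp (\<kappa> * real M)" and F: "finite F" "F \<inter> lo (2 * M) = {}"
    have M': "M > 0" "M \<ge> M1" "M \<ge> M2" using M by (auto simp: M0_def)
    \<comment> \<open>N / \<rho> is at most M / 8, and the choice of M2 makes 2 / \<rho> +
      \<open>C\<^sub>1\<close> at most M / 3; together they stay below M / 2.\<close>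
    define N where "N = nat \<lfloor>\<rho> * M / 8\<rfloor>"
    have N: "(real N + 2) / \<rho> + C\<^sub>1 \<le> real M / 2"
    proof -
      have "real N \<le> \<rho> * M / 8" unfolding N_def using rho by (intro of_nat_floor) auto
      then have N8: "real N / \<rho> \<le> real M / 8" using rho by (simp add: field_simps)
      have M3: "3 * (2 / \<rho> + C\<^sub>1) \<le> real M" using M2 M'(3) by linarith
      have "(real N + 2) / \<rho> + C\<^sub>1 = real N / \<rho> + (2 / \<rho> + C\<^sub>1)" by (simp add: add_divide_distrib)
      also have "\<dots> \<le> real M / 8 + real M / 3" by (rule add_mono[OF N8]) (use M3 in simp)
      also have "\<dots> \<le> real M / 2" by simp
      finally show ?thesis .
    qed
    have err: "approx_error M N \<le> D * real M ^ 3 * exp (- (4 * \<kappa>) * M)"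
    proof -
      have "4 * \<kappa> * real M \<le> \<rho> * ln 2 / 8 * real M" using \<kappa>4 by (intro mult_right_mono) auto
      then have "exp (- ln 2 * (\<rho> * real M / 8)) \<le> exp (- (4 * \<kappa>) * M)" by (simp add: mult_ac)
      then have "(1/2)^N \<le> 2 * exp (- (4 * \<kappa>) * M)"
        using half_power_nat_floor_le[of "\<rho> * real M / 8"] unfolding N_def by linarith
      then have "32 * B * real M ^ 3 * (1/2)^N \<le> 32 * B * real M ^ 3 * (2 * exp (- (4 * \<kappa>) * M))"
        using B by (intro mult_left_mono) auto
      moreover have "C\<^sub>1 * M * exp (- (\<theta> / 2) * M) \<le> C\<^sub>1 * real M ^ 3 * exp (- (4 * \<kappa>) * M)"
      proof (rule mult_mono)
        have "real M * 1 \<le> real M * real M ^ 2" using M' by (intro mult_left_mono) auto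
        then show "C\<^sub>1 * M \<le> C\<^sub>1 * real M ^ 3" using C1
          by (intro mult_left_mono) (auto simp: power2_eq_square power3_eq_cube mult_ac)
        have "4 * \<kappa> * real M \<le> \<theta> / 2 * real M" using \<kappa>4 by (intro mult_right_mono) auto
        then show "exp (- (\<theta> / 2) * M) \<le> exp (- (4 * \<kappa>) * M)" by simp
      qed (use C1 in auto)
      ultimately show ?thesis by (simp add: approx_error_def D_def algebra_simps)
    qed
    have err_t: "approx_error M N * \<bar>t\<bar> \<le> exp (- \<kappa> * M) / 2"
    proof -
      have "approx_error M N * \<bar>t\<bar> \<le> (D * real M ^ 3 * exp (- (4 * \<kappa>) * M)) * exp (\<kappa> * M)"
        using D by (intro mult_mono err t) auto
      also have "\<dots> = (D * real M ^ 3 * exp (- (2 * \<kappa>) * M)) * exp (- \<kappa> * M)"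
        by (simp add: mult.assoc exp_add[symmetric])
      also have "D * real M ^ 3 * exp (- (2 * \<kappa>) * M) = D / (2 * \<kappa>) ^ 3 * ((2 * \<kappa> * real M) ^ 3 / exp (2 * \<kappa> * real M))"
        using \<kappa> by (simp add: exp_minus power_mult_distrib field_simps)
      also have "\<dots> * exp (- \<kappa> * M) \<le> 1 / 2 * exp (- \<kappa> * M)"
        using M1[OF M'(2)] by (intro mult_right_mono) auto
      finally show ?thesis by simp
    qed
    have e1: "exp (- \<kappa> * M) \<le> 1" using \<kappa> by simp
    have err_half: "approx_error M N * \<bar>t\<bar> \<le> 1 / 2" using err_t e1 by linarith
    let ?L = "M div 2"
    define tl where "tl = (\<Sum>\<^sub>\<infinity>j\<in>-lo ?L. (cmod (c j 0))\<^sup>2)"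
    define n2 where "n2 = (\<Sum>\<^sub>\<infinity>j. (cmod (c j 0))\<^sup>2)"
    have n20: "n2 \<ge> 0" "tl \<ge> 0" unfolding n2_def tl_def by (rule infsum_nonneg; auto)+
    have "(\<Sum>j\<in>F. (cmod (c j t))\<^sup>2) \<le> (2 + 128 * B\<^sup>2) * tl
      + (128 * B\<^sup>2 * exp (- \<theta> * (real M - real ?L)) + 8 * (1 + 128 * B\<^sup>2) * (approx_error M N * \<bar>t\<bar>)) * n2"
      unfolding tl_def n2_def by (intro tail_estimate[OF c M'(1) N F err_half]) auto
    also have "\<dots> \<le> A * tl + (128 * B\<^sup>2 * exp (- \<kappa> * M) + 8 * (1 + 128 * B\<^sup>2) * exp (- \<kappa> * M)) * n2"
    proof (intro add_mono mult_right_mono mult_left_mono n20)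
      have "real M / 2 \<le> real M - real ?L" by linarith
      then have "\<theta> * (real M / 2) \<le> \<theta> * (real M - real ?L)" using theta by (intro mult_left_mono) auto
      moreover have "\<kappa> * real M \<le> \<theta> / 2 * real M" using \<kappa>4 \<kappa> by (intro mult_right_mono) auto
      ultimately show "exp (- \<theta> * (real M - real ?L)) \<le> exp (- \<kappa> * M)" by simp
      show "approx_error M N * \<bar>t\<bar> \<le> exp (- \<kappa> * M)" using err_t by (smt (verit) exp_gt_zero field_sum_of_halves)
    qed (auto simp: A_def)
    also have "\<dots> \<le> A * tl + A * exp (- \<kappa> * M) * n2"
      unfolding distrib_right[symmetric] using n20
      by (intro add_left_mono mult_right_mono) (auto simp: A_def)
    finally show "(\<Sum>j\<in>F. (cmod (c j t))\<^sup>2) \<le> A * (\<Sum>\<^sub>\<infinity>j\<in>-lo ?L. (cmod (c j 0))\<^sup>2)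
          + A * exp (- \<kappa> * real M) * (\<Sum>\<^sub>\<infinity>j. (cmod (c j 0))\<^sup>2)" by (simp only: tl_def n2_def)
  qed (use \<kappa> in \<open>auto simp: A_def M0_def\<close>)
qed

end

section \<open>Dyadic summation\<close>

definition sobolev_weight :: "real \<Rightarrow> int \<Rightarrow> real" where
  "sobolev_weight s j = (1 + (real_of_int j)\<^sup>2) powr s"

lemma sobolev_weight_ge_1: "s \<ge> 0 \<Longrightarrow> sobolev_weight s j \<ge> 1"
  by (simp add: sobolev_weight_def ge_one_powr_ge_zero)

lemma sobolev_weight_nonneg [simp]: "sobolev_weight s j \<ge> 0"
  by (simp add: sobolev_weight_def)

lemma four_powr_power: "(4 powr s) ^ p = (4 ^ p) powr (s::real)"
  by (simp add: powr_powr powr_realpow[symmetric] mult.commute)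

lemma four_powr_gt_1: "s > 0 \<Longrightarrow> (4::real) powr s > 1"
  using powr_less_mono[of 0 s 4] by simp

text \<open>The extra power of 4^s absorbs the summand 1 in the weight.\<close>

lemma sobolev_weight_le:
  assumes "j \<in> lo (2 ^ p)" "s \<ge> 0"
  shows "sobolev_weight s j \<le> (4 powr s) ^ Suc p"
proof -
  have "\<bar>real_of_int j\<bar> \<le> 2 ^ p"
  proof -
    have "\<bar>j\<bar> \<le> 2 ^ p" using assms(1) by (auto simp: lo_def)
    then have "real_of_int \<bar>j\<bar> \<le> real_of_int (2 ^ p)" by (simp only: of_int_le_iff)
    then show ?thesis by simp
  qed
  then have "\<bar>real_of_int j\<bar>\<^sup>2 \<le> (2 ^ p)\<^sup>2" by (intro power_mono) auto
  also have "(2 ^ p)\<^sup>2 = (4::real) ^ p" by (simp add: power2_eq_square power_mult_distrib[symmetric])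
  finally have "1 + (real_of_int j)\<^sup>2 \<le> 1 + 4 ^ p" by simp
  also have "\<dots> \<le> 4 ^ Suc p"
  proof -
    have "1 \<le> (4::real) ^ p" by simp
    then show ?thesis unfolding power_Suc by linarith
  qed
  finally show ?thesis unfolding four_powr_power sobolev_weight_def using assms(2) by (intro powr_mono2) auto
qed

lemma sobolev_weight_ge:
  assumes "2 ^ p \<le> \<bar>j\<bar>" "s \<ge> 0"
  shows "(4 powr s) ^ p \<le> sobolev_weight s j"
proof -
  have "real_of_int (2 ^ p) \<le> real_of_int \<bar>j\<bar>" using assms(1) by (simp only: of_int_le_iff)
  then have "(2 ^ p)\<^sup>2 \<le> \<bar>real_of_int j\<bar>\<^sup>2" by (intro power_mono) auto
  also have "(2 ^ p)\<^sup>2 = (4::real) ^ p" by (simp add: power2_eq_square power_mult_distrib[symmetric])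
  finally have "4 ^ p \<le> 1 + (real_of_int j)\<^sup>2" by simp
  then show ?thesis unfolding four_powr_power sobolev_weight_def using assms(2) by (intro powr_mono2) auto
qed

text \<open>The exponents that contribute satisfy 2^p \<le> |j|. Their geometric sum is comparable
  to its largest term, which is at most the Sobolev weight of j.\<close>

lemma dyadic_geometric_sum_le:
  assumes s: "s > 0"
  shows "(\<Sum>p\<in>{q..P}. if j \<in> - lo (2 ^ p) then (4 powr s) ^ p else 0)
    \<le> 4 powr s / (4 powr s - 1) * sobolev_weight s j"
proof -
  define r where "r = 4 powr s"
  have r: "r > 1" unfolding r_def using s by (intro four_powr_gt_1)
  define I where "I = {p\<in>{q..P}. j \<in> - lo (2 ^ p)}"
  have I: "finite I" by (simp add: I_def)
  have eq: "(\<Sum>p\<in>{q..P}. if j \<in> - lo (2 ^ p) then r ^ p else 0) = (\<Sum>p\<in>I. r ^ p)"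
    unfolding I_def by (simp add: sum.If_cases Int_def)
  show ?thesis
  proof (cases "I = {}")
    case True
    then show ?thesis unfolding r_def[symmetric] eq using r by simp
  next
    case False
    define m where "m = Max I"
    have m: "m \<in> I" using I False by (simp add: m_def)
    have "(\<Sum>p\<in>I. r ^ p) \<le> (\<Sum>p<Suc m. r ^ p)"
      using r I by (intro sum_mono2) (auto simp: m_def less_Suc_eq_le)
    also have "\<dots> = (r ^ Suc m - 1) / (r - 1)" using r by (subst geometric_sum) auto
    also have "\<dots> \<le> r / (r - 1) * r ^ m" using r by (simp add: field_simps)
    finally have le: "(\<Sum>p\<in>I. r ^ p) \<le> r / (r - 1) * r ^ m" .
    have "r ^ m \<le> sobolev_weight s j"
      unfolding r_def using m s by (intro sobolev_weight_ge) (auto simp: I_def lo_def)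
    then have "r / (r - 1) * r ^ m \<le> r / (r - 1) * sobolev_weight s j"
      using r by (intro mult_left_mono) auto
    with le show ?thesis unfolding r_def[symmetric] eq by linarith
  qed
qed

text \<open>Exchanging the sums over p and j gives each mode the total factor of
  \<open>dyadic_geometric_sum_le\<close>. So weighted dyadic tails reproduce the Sobolev norm with
  no logarithmic loss.\<close>

lemma dyadic_tail_sum_le:
  assumes s: "s > 0" and sum: "(\<lambda>j. sobolev_weight s j * (cmod (x j))\<^sup>2) summable_on UNIV"
  shows "(\<Sum>p\<in>{q..P}. (4 powr s) ^ p * (\<Sum>\<^sub>\<infinity>j\<in>-lo (2 ^ p). (cmod (x j))\<^sup>2))
    \<le> 4 powr s / (4 powr s - 1) * (\<Sum>\<^sub>\<infinity>j. sobolev_weight s j * (cmod (x j))\<^sup>2)"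
proof -
  have sq: "sq_summable x"
  proof (rule summable_on_comparison_test[OF sum])
    show "(cmod (x j))\<^sup>2 \<le> sobolev_weight s j * (cmod (x j))\<^sup>2" for j
      using mult_right_mono[OF sobolev_weight_ge_1[of s j], of "(cmod (x j))\<^sup>2"] s by simp
  qed auto
  have "((\<lambda>j. \<Sum>p\<in>{q..P}. if j \<in> - lo (2 ^ p) then (4 powr s) ^ p * (cmod (x j))\<^sup>2 else 0)
     has_sum (\<Sum>p\<in>{q..P}. (4 powr s) ^ p * (\<Sum>\<^sub>\<infinity>j\<in>-lo (2 ^ p). (cmod (x j))\<^sup>2))) UNIV"
  proof (rule has_sum_finite_sum)
    fix p
    have "((\<lambda>j. (4 powr s) ^ p * (cmod (x j))\<^sup>2) has_sum (4 powr s) ^ p * (\<Sum>\<^sub>\<infinity>j\<in>-lo (2 ^ p). (cmod (x j))\<^sup>2)) (- lo (2 ^ p))"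
      by (intro has_sum_cmult_right has_sum_infsum sq_summable_on[OF sq])
    also have "?this \<longleftrightarrow> ((\<lambda>j. if j \<in> - lo (2 ^ p) then (4 powr s) ^ p * (cmod (x j))\<^sup>2 else 0)
       has_sum (4 powr s) ^ p * (\<Sum>\<^sub>\<infinity>j\<in>-lo (2 ^ p). (cmod (x j))\<^sup>2)) UNIV"
      by (rule has_sum_cong_neutral) auto
    finally show "((\<lambda>j. if j \<in> - lo (2 ^ p) then (4 powr s) ^ p * (cmod (x j))\<^sup>2 else 0)
       has_sum (4 powr s) ^ p * (\<Sum>\<^sub>\<infinity>j\<in>-lo (2 ^ p). (cmod (x j))\<^sup>2)) UNIV" .
  qed
  moreover have "((\<lambda>j. 4 powr s / (4 powr s - 1) * (sobolev_weight s j * (cmod (x j))\<^sup>2)) has_sum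
     4 powr s / (4 powr s - 1) * (\<Sum>\<^sub>\<infinity>j. sobolev_weight s j * (cmod (x j))\<^sup>2)) UNIV"
    by (intro has_sum_cmult_right has_sum_infsum sum)
  ultimately show ?thesis
  proof (rule has_sum_mono)
    fix j
    have "(\<Sum>p\<in>{q..P}. if j \<in> - lo (2 ^ p) then (4 powr s) ^ p * (cmod (x j))\<^sup>2 else 0)
      = (\<Sum>p\<in>{q..P}. if j \<in> - lo (2 ^ p) then (4 powr s) ^ p else 0) * (cmod (x j))\<^sup>2"
      unfolding sum_distrib_right by (intro sum.cong) auto
    also have "\<dots> \<le> (4 powr s / (4 powr s - 1) * sobolev_weight s j) * (cmod (x j))\<^sup>2"
      by (intro mult_right_mono dyadic_geometric_sum_le s) auto
    finally show "(\<Sum>p\<in>{q..P}. if j \<in> - lo (2 ^ p) then (4 powr s) ^ p * (cmod (x j))\<^sup>2 else 0)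
      \<le> 4 powr s / (4 powr s - 1) * (sobolev_weight s j * (cmod (x j))\<^sup>2)" by (simp add: mult.assoc)
  qed
qed

text \<open>Since 2^(n+1) = 2^n + 2^n, the ratio of successive terms is r exp (-\<kappa> 2^n), which
  tends to 0.\<close>

lemma summable_geometric_double_exp:
  fixes r \<kappa> :: real
  assumes "r > 0" "\<kappa> > 0"
  shows "summable (\<lambda>p. r ^ p * exp (- \<kappa> * 2 ^ p))"
proof -
  obtain N :: nat where N: "ln (2 * r) / \<kappa> \<le> N" using real_arch_simple by blast
  show ?thesis
  proof (rule summable_ratio_test[of "1/2" N])
    fix n assume n: "n \<ge> N"
    have "real n \<le> 2 ^ n" using less_exp[of n] by (metis less_imp_le of_nat_le_iff of_nat_numeral of_nat_power)
    then have "ln (2 * r) / \<kappa> \<le> 2 ^ n" using N n by linarith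
    then have "ln (2 * r) \<le> \<kappa> * 2 ^ n" using assms(2) by (simp add: field_simps)
    then have "exp (ln (2 * r)) \<le> exp (\<kappa> * 2 ^ n)" by simp
    then have "2 * r \<le> exp (\<kappa> * 2 ^ n)" using assms(1) by simp
    then have "r * exp (- \<kappa> * 2 ^ n) \<le> 1 / 2" by (simp add: exp_minus field_simps)
    then have "(r ^ n * exp (- \<kappa> * 2 ^ n)) * (r * exp (- \<kappa> * 2 ^ n)) \<le> (r ^ n * exp (- \<kappa> * 2 ^ n)) * (1 / 2)"
      using assms(1) by (intro mult_left_mono) auto
    moreover have "exp (- \<kappa> * 2 ^ Suc n) = exp (- \<kappa> * 2 ^ n) * exp (- \<kappa> * 2 ^ n)"
      by (simp add: exp_add[symmetric])
    ultimately show "norm (r ^ Suc n * exp (- \<kappa> * 2 ^ Suc n)) \<le> 1 / 2 * norm (r ^ n * exp (- \<kappa> * 2 ^ n))"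
      using assms(1) by (simp add: abs_mult mult_ac)
  qed auto
qed

lemma dyadic_scale_exists:
  fixes Y :: real
  assumes "Y \<ge> 1"
  obtains p :: nat where "p \<ge> 1" "Y \<le> 2 ^ p" "2 ^ p \<le> 2 * Y"
proof -
  define k where "k = nat \<lfloor>Y\<rfloor>"
  have k: "1 \<le> k" "real k \<le> Y" "Y < real k + 1" using assms by (auto simp: k_def nat_le_iff le_nat_iff le_floor_iff)
  obtain n where n: "2 ^ n \<le> k" "k < 2 ^ (n + 1)" using ex_power_ivl1[of 2 k] k(1) by auto
  have "real (k + 1) \<le> real (2 ^ (n + 1))" using n(2) by (intro of_nat_mono) simp
  moreover have "real (2 ^ n) \<le> real k" using n(1) by (intro of_nat_mono)
  then have "2 ^ n \<le> Y" unfolding of_nat_power of_nat_numeral using k(2) by linarith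
  ultimately show thesis using k by (intro that[of "n + 1"]) auto
qed

lemma sum_UN_le:
  fixes f :: "'a \<Rightarrow> real"
  assumes "finite I" "\<And>i. i \<in> I \<Longrightarrow> finite (A i)" "\<And>x. f x \<ge> 0"
  shows "sum f (\<Union>i\<in>I. A i) \<le> (\<Sum>i\<in>I. sum f (A i))"
  using assms(1,2)
proof (induction I)
  case (insert i I)
  have "sum f (A i \<union> (\<Union>i\<in>I. A i)) = sum f (A i) + sum f (\<Union>i\<in>I. A i) - sum f (A i \<inter> (\<Union>i\<in>I. A i))"
    using insert by (intro sum_Un) auto
  moreover have "sum f (A i \<inter> (\<Union>i\<in>I. A i)) \<ge> 0" by (intro sum_nonneg assms)
  ultimately show ?case using insert by simp
qed auto

context exp_potential
begin

text \<open>Frequencies below a dyadic threshold of order log (|t| + 2) are handled by conservation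
  of the l^2 norm and produce the growth; each dyadic shell above it is handled by
  \<open>tail_decoupling\<close> without growth. Working with finite sets of modes first also proves
  that H^s regularity persists.\<close>

lemma sobolev_growth:
  assumes s: "s > 0"
  obtains C where "\<And>c t. flow c \<Longrightarrow> (\<lambda>j. sobolev_weight s j * (cmod (c j 0))\<^sup>2) summable_on UNIV \<Longrightarrow>
    (\<lambda>j. sobolev_weight s j * (cmod (c j t))\<^sup>2) summable_on UNIV \<and>
    (\<Sum>\<^sub>\<infinity>j. sobolev_weight s j * (cmod (c j t))\<^sup>2)
      \<le> C * ln (\<bar>t\<bar> + 2) powr (2 * s) * (\<Sum>\<^sub>\<infinity>j. sobolev_weight s j * (cmod (c j 0))\<^sup>2)"
proof -
  obtain \<kappa> A :: real and M0 :: nat where \<kappa>: "\<kappa> > 0" and A: "A \<ge> 0" and M0: "M0 > 0"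
    and dec: "\<And>c M t F. flow c \<Longrightarrow> M0 \<le> M \<Longrightarrow> \<bar>t\<bar> \<le> exp (\<kappa> * real M) \<Longrightarrow> finite F \<Longrightarrow> F \<inter> lo (2 * M) = {} \<Longrightarrow>
       (\<Sum>j\<in>F. (cmod (c j t))\<^sup>2) \<le> A * (\<Sum>\<^sub>\<infinity>j\<in>-lo (M div 2). (cmod (c j 0))\<^sup>2)
          + A * exp (- \<kappa> * real M) * (\<Sum>\<^sub>\<infinity>j. (cmod (c j 0))\<^sup>2)"
    using tail_decoupling by blast
  define r where "r = 4 powr s"
  have r: "r > 1" unfolding r_def using s by (intro four_powr_gt_1)
  define Ks where "Ks = (\<Sum>p. r ^ p * exp (- \<kappa> * 2 ^ p))"
  have Ks_sum: "summable (\<lambda>p. r ^ p * exp (- \<kappa> * 2 ^ p))"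
    using r \<kappa> by (intro summable_geometric_double_exp) auto
  have Ks0: "Ks \<ge> 0" unfolding Ks_def using r by (intro suminf_nonneg Ks_sum) auto
  \<comment> \<open>Chosen so that K0 log (|t| + 2) dominates both M0 and log (|t| + 2) / \<kappa>:
    beyond the threshold M is large enough, and |t| \<le> exp (\<kappa> M).\<close>
  define K0 where "K0 = M0 / ln 2 + 1 / \<kappa>"
  have K0: "K0 > 0" unfolding K0_def using \<kappa> by (intro add_nonneg_pos) auto
  define C' where "C' = A * (r ^ 4 * (r / (r - 1))) + A * (r ^ 3 * Ks)"
  have C'0: "C' \<ge> 0" unfolding C'_def using A r Ks0 by (intro add_nonneg_nonneg mult_nonneg_nonneg) auto
  \<comment> \<open>The first term comes from the low modes. The second comes from the shells, whose
    bound does not grow; dividing by a power of ln 2 lets it share the logarithmic factor.\<close>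
  define C where "C = r\<^sup>2 * (2 * K0) powr (2 * s) + C' / ln 2 powr (2 * s)"
  have main: "(\<Sum>j\<in>G. sobolev_weight s j * (cmod (c j t))\<^sup>2)
      \<le> C * ln (\<bar>t\<bar> + 2) powr (2 * s) * (\<Sum>\<^sub>\<infinity>j. sobolev_weight s j * (cmod (c j 0))\<^sup>2)"
    if c: "flow c" and h: "(\<lambda>j. sobolev_weight s j * (cmod (c j 0))\<^sup>2) summable_on UNIV" and G: "finite G" for c t G
  proof -
    define H where "H = (\<Sum>\<^sub>\<infinity>j. sobolev_weight s j * (cmod (c j 0))\<^sup>2)"
    define n2 where "n2 = (\<Sum>\<^sub>\<infinity>j. (cmod (c j 0))\<^sup>2)"
    have n20: "n2 \<ge> 0" unfolding n2_def by (rule infsum_nonneg) auto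
    have nH: "n2 \<le> H" unfolding n2_def H_def
    proof (rule infsum_mono[OF flowD(1)[OF c] h])
      show "(cmod (c j 0))\<^sup>2 \<le> sobolev_weight s j * (cmod (c j 0))\<^sup>2" for j
        using mult_right_mono[OF sobolev_weight_ge_1[of s j], of "(cmod (c j 0))\<^sup>2"] s by simp
    qed
    define \<Lambda> where "\<Lambda> = ln (\<bar>t\<bar> + 2)"
    have \<Lambda>: "\<Lambda> \<ge> ln 2" "\<Lambda> > 0" unfolding \<Lambda>_def by (auto intro!: ln_gt_zero)
    have ln2: "ln (2::real) > 0" by simp
    have K\<Lambda>: "real M0 + \<Lambda> / \<kappa> \<le> K0 * \<Lambda>"
    proof -
      have "real M0 * 1 \<le> real M0 * (\<Lambda> / ln 2)" using \<Lambda> by (intro mult_left_mono) (auto simp: field_simps)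
      then show ?thesis by (simp add: K0_def algebra_simps)
    qed
    have "0 \<le> \<Lambda> / \<kappa>" using \<Lambda> \<kappa> by simp
    then have "1 \<le> K0 * \<Lambda>" using K\<Lambda> M0 by linarith
    then obtain p0 where p0: "p0 \<ge> 1" "K0 * \<Lambda> \<le> 2 ^ p0" "2 ^ p0 \<le> 2 * (K0 * \<Lambda>)" by (rule dyadic_scale_exists)
    have M0p: "M0 \<le> 2 ^ p" if "p \<ge> p0" for p
    proof -
      have "real M0 \<le> 2 ^ p0" using p0(2) K\<Lambda> \<open>0 \<le> \<Lambda> / \<kappa>\<close> by linarith
      also have "\<dots> \<le> 2 ^ p" using that by (intro power_increasing) auto
      finally have "real M0 \<le> real (2 ^ p)" by simp
      then show ?thesis by (simp only: of_nat_le_iff)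
    qed
    have tp: "\<bar>t\<bar> \<le> exp (\<kappa> * real (2 ^ p))" if "p \<ge> p0" for p
    proof -
      have "\<Lambda> / \<kappa> \<le> 2 ^ p0" using p0(2) K\<Lambda> by linarith
      also have "(2::real) ^ p0 \<le> 2 ^ p" using that by (intro power_increasing) auto
      finally have "\<Lambda> \<le> \<kappa> * 2 ^ p" using \<kappa> by (simp add: field_simps)
      then have "exp \<Lambda> \<le> exp (\<kappa> * 2 ^ p)" by simp
      then show ?thesis by (simp add: \<Lambda>_def)
    qed
    obtain P where P: "G \<subseteq> lo (2 ^ P)"
    proof -
      obtain J where "\<forall>K\<ge>J. G \<subseteq> lo K" using lo_exhausts[OF G] by blast
      moreover have "J \<le> 2 ^ J" using less_exp[of J] by simp
      ultimately show thesis using that by blast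
    qed
    let ?w = "\<lambda>j. sobolev_weight s j * (cmod (c j t))\<^sup>2"
    \<comment> \<open>The shell \<open>hi (2 ^ Suc p)\<close> starts exactly at twice M = 2^p, where
      the decoupling at scale M begins to apply.\<close>
    let ?Gs = "\<lambda>p. G \<inter> hi (2 ^ Suc p)"
    have cover: "G - lo (2 ^ Suc p0) \<subseteq> (\<Union>p\<in>{p0..P}. ?Gs p)"
    proof
      fix j assume j: "j \<in> G - lo (2 ^ Suc p0)"
      define k where "k = nat \<bar>j\<bar>"
      have k: "2 ^ Suc p0 \<le> k" using j by (auto simp: k_def lo_def nat_le_iff le_nat_iff)
      have "1 \<le> k" using k one_le_power[of "2::nat" "Suc p0"] by linarith
      then obtain n where n: "2 ^ n \<le> k" "k < 2 ^ (n + 1)" using ex_power_ivl1[of 2 k] by auto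
      have "(2::nat) ^ Suc p0 < 2 ^ (n + 1)" using k n(2) by linarith
      then have np: "Suc p0 \<le> n" by (simp del: power_Suc)
      have "k < 2 ^ P" using j P by (auto simp: k_def lo_def nat_less_iff)
      then have "(2::nat) ^ n < 2 ^ P" using n(1) by linarith
      then have nP: "n < P" by simp
      have "int (2 ^ n) \<le> int k" "int k < int (2 ^ (n + 1))" using n by (simp_all only: of_nat_le_iff of_nat_less_iff)
      then have "j \<in> hi (2 ^ Suc (n - 1))" using np by (auto simp: hi_def k_def)
      then show "j \<in> (\<Union>p\<in>{p0..P}. ?Gs p)" using np nP j by (intro UN_I[of "n - 1"]) auto
    qed
    have low: "(\<Sum>j\<in>G \<inter> lo (2 ^ Suc p0). ?w j) \<le> r ^ Suc (Suc p0) * n2"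
    proof -
      have "(\<Sum>j\<in>G \<inter> lo (2 ^ Suc p0). ?w j) \<le> (\<Sum>j\<in>G \<inter> lo (2 ^ Suc p0). r ^ Suc (Suc p0) * (cmod (c j t))\<^sup>2)"
        unfolding r_def using s by (intro sum_mono mult_right_mono sobolev_weight_le) auto
      also have "\<dots> \<le> r ^ Suc (Suc p0) * (\<Sum>\<^sub>\<infinity>j. (cmod (c j t))\<^sup>2)"
        unfolding sum_distrib_left[symmetric] using r G
        by (intro mult_left_mono finite_sum_sq_le flowD(1)[OF c]) auto
      finally show ?thesis by (simp only: flow_norm_conserved[OF c, of t] n2_def)
    qed
    \<comment> \<open>The weight on this shell is at most r^(p+3), while the data tail starts at
      2^(p-1). The mismatch of four dyadic steps is the constant r^4; halving 2^p uses p \<ge>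
      1.\<close>
    have shell: "(\<Sum>j\<in>?Gs p. ?w j) \<le> A * r ^ 4 * (r ^ (p - 1) * (\<Sum>\<^sub>\<infinity>j\<in>-lo (2 ^ (p - 1)). (cmod (c j 0))\<^sup>2))
        + A * r ^ 3 * n2 * (r ^ p * exp (- \<kappa> * 2 ^ p))" if p: "p \<ge> p0" for p
    proof -
      have "(\<Sum>j\<in>?Gs p. ?w j) \<le> (\<Sum>j\<in>?Gs p. r ^ (p + 3) * (cmod (c j t))\<^sup>2)"
      proof (intro sum_mono mult_right_mono)
        fix j assume "j \<in> ?Gs p"
        then have "j \<in> lo (2 ^ (p + 2))" using hi_subset[of "2 ^ Suc p"] by auto
        from sobolev_weight_le[OF this, of s] show "sobolev_weight s j \<le> r ^ (p + 3)"
          using s by (simp add: r_def numeral_eq_Suc)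
      qed auto
      also have "\<dots> = r ^ (p + 3) * (\<Sum>j\<in>?Gs p. (cmod (c j t))\<^sup>2)" by (simp add: sum_distrib_left)
      also have "\<dots> \<le> r ^ (p + 3) * (A * (\<Sum>\<^sub>\<infinity>j\<in>-lo (2 ^ p div 2). (cmod (c j 0))\<^sup>2)
          + A * exp (- \<kappa> * real (2 ^ p)) * n2)"
      proof (intro mult_left_mono)
        show "(\<Sum>j\<in>?Gs p. (cmod (c j t))\<^sup>2) \<le> A * (\<Sum>\<^sub>\<infinity>j\<in>-lo (2 ^ p div 2). (cmod (c j 0))\<^sup>2)
          + A * exp (- \<kappa> * real (2 ^ p)) * n2"
          unfolding n2_def by (intro dec[OF c M0p[OF p] tp[OF p]]) (use G in \<open>auto simp: lo_def hi_def\<close>)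
      qed (use r in auto)
      also have "(2::nat) ^ p div 2 = 2 ^ (p - 1)" using p p0(1) by (cases p) auto
      also have "r ^ (p + 3) = r ^ 4 * r ^ (p - 1)"
        using p p0(1) by (cases p) (auto simp: power_add numeral_eq_Suc)
      finally have "(\<Sum>j\<in>?Gs p. ?w j) \<le> r ^ 4 * r ^ (p - 1) * (A * (\<Sum>\<^sub>\<infinity>j\<in>-lo (2 ^ (p - 1)). (cmod (c j 0))\<^sup>2)
          + A * exp (- \<kappa> * real (2 ^ p)) * n2)" .
      also have "\<dots> = A * r ^ 4 * (r ^ (p - 1) * (\<Sum>\<^sub>\<infinity>j\<in>-lo (2 ^ (p - 1)). (cmod (c j 0))\<^sup>2))
          + A * exp (- \<kappa> * 2 ^ p) * n2 * (r ^ 4 * r ^ (p - 1))" by (simp add: algebra_simps)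
      also have "r ^ 4 * r ^ (p - 1) = r ^ 3 * r ^ p"
        using p p0(1) by (cases p) (auto simp: numeral_eq_Suc)
      finally show ?thesis by (simp only: mult_ac)
    qed
    have "(\<Sum>p\<in>{p0..P}. A * r ^ 4 * (r ^ (p - 1) * (\<Sum>\<^sub>\<infinity>j\<in>-lo (2 ^ (p - 1)). (cmod (c j 0))\<^sup>2)))
       \<le> A * r ^ 4 * (r / (r - 1) * H)"
    proof -
      have "(\<Sum>p\<in>{p0..P}. r ^ (p - 1) * (\<Sum>\<^sub>\<infinity>j\<in>-lo (2 ^ (p - 1)). (cmod (c j 0))\<^sup>2))
        = (\<Sum>p\<in>(\<lambda>p. p - 1) ` {p0..P}. r ^ p * (\<Sum>\<^sub>\<infinity>j\<in>-lo (2 ^ p). (cmod (c j 0))\<^sup>2))"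
        using p0(1) by (subst sum.reindex) (auto simp: inj_on_def)
      also have "\<dots> \<le> (\<Sum>p\<in>{0..P}. r ^ p * (\<Sum>\<^sub>\<infinity>j\<in>-lo (2 ^ p). (cmod (c j 0))\<^sup>2))"
        using r by (intro sum_mono2) (auto intro!: mult_nonneg_nonneg infsum_nonneg)
      also have "\<dots> \<le> r / (r - 1) * H"
        unfolding r_def H_def by (rule dyadic_tail_sum_le[OF s h])
      finally show ?thesis unfolding sum_distrib_left[symmetric] using A r by (intro mult_left_mono) auto
    qed
    moreover have "(\<Sum>p\<in>{p0..P}. A * r ^ 3 * n2 * (r ^ p * exp (- \<kappa> * 2 ^ p))) \<le> A * r ^ 3 * n2 * Ks"
      unfolding sum_distrib_left[symmetric] Ks_def using A r n20
      by (intro mult_left_mono sum_le_suminf Ks_sum) auto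
    moreover have "(\<Sum>j\<in>G - lo (2 ^ Suc p0). ?w j) \<le> (\<Sum>p\<in>{p0..P}. \<Sum>j\<in>?Gs p. ?w j)"
    proof -
      have "(\<Sum>j\<in>G - lo (2 ^ Suc p0). ?w j) \<le> (\<Sum>j\<in>(\<Union>p\<in>{p0..P}. ?Gs p). ?w j)"
        using cover G by (intro sum_mono2) auto
      also have "\<dots> \<le> (\<Sum>p\<in>{p0..P}. \<Sum>j\<in>?Gs p. ?w j)"
        using G by (intro sum_UN_le) auto
      finally show ?thesis .
    qed
    moreover have "(\<Sum>p\<in>{p0..P}. \<Sum>j\<in>?Gs p. ?w j) \<le> (\<Sum>p\<in>{p0..P}. A * r ^ 4 * (r ^ (p - 1) * (\<Sum>\<^sub>\<infinity>j\<in>-lo (2 ^ (p - 1)). (cmod (c j 0))\<^sup>2))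
        + A * r ^ 3 * n2 * (r ^ p * exp (- \<kappa> * 2 ^ p)))"
      by (intro sum_mono shell) auto
    ultimately have high: "(\<Sum>j\<in>G - lo (2 ^ Suc p0). ?w j) \<le> A * r ^ 4 * (r / (r - 1) * H) + A * r ^ 3 * n2 * Ks"
      unfolding sum.distrib by linarith
    have "A * r ^ 3 * n2 * Ks \<le> A * r ^ 3 * H * Ks"
      using A r nH Ks0 by (intro mult_right_mono mult_left_mono) auto
    then have high': "(\<Sum>j\<in>G - lo (2 ^ Suc p0). ?w j) \<le> C' * H"
      using high by (simp add: C'_def algebra_simps)
    have H0: "H \<ge> 0" using nH n20 by linarith
    have "r ^ p0 \<le> (2 * K0 * \<Lambda>) powr (2 * s)"
    proof -
      have "r ^ p0 = (2 ^ p0 * 2 ^ p0) powr s" unfolding r_def four_powr_power by (simp add: power_mult_distrib[symmetric])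
      also have "\<dots> = (2 ^ p0) powr (2 * s)" by (simp add: powr_mult powr_add[symmetric])
      also have "\<dots> \<le> (2 * K0 * \<Lambda>) powr (2 * s)" using p0(3) s by (intro powr_mono2) (auto simp: mult.assoc)
      finally show ?thesis .
    qed
    also have "\<dots> = (2 * K0) powr (2 * s) * \<Lambda> powr (2 * s)" by (rule powr_mult)
    finally have rp: "r ^ p0 \<le> (2 * K0) powr (2 * s) * \<Lambda> powr (2 * s)" .
    have "r ^ Suc (Suc p0) * n2 = r\<^sup>2 * r ^ p0 * n2" by (simp add: power2_eq_square)
    also have "\<dots> \<le> r\<^sup>2 * ((2 * K0) powr (2 * s) * \<Lambda> powr (2 * s)) * H"
      using r n20 by (intro mult_mono mult_left_mono rp nH) auto
    finally have low': "(\<Sum>j\<in>G \<inter> lo (2 ^ Suc p0). ?w j) \<le> r\<^sup>2 * ((2 * K0) powr (2 * s) * \<Lambda> powr (2 * s)) * H"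
      using low by linarith
    have "ln 2 powr (2 * s) \<le> \<Lambda> powr (2 * s)" using \<Lambda> s by (intro powr_mono2) auto
    \<comment> \<open>The logarithm never falls below ln 2, so a bounded term may be multiplied by
      this quotient.\<close>
    then have "1 \<le> \<Lambda> powr (2 * s) / ln 2 powr (2 * s)" by simp
    then have "C' * 1 \<le> C' * (\<Lambda> powr (2 * s) / ln 2 powr (2 * s))" by (intro mult_left_mono C'0)
    then have "C' * H \<le> C' * (\<Lambda> powr (2 * s) / ln 2 powr (2 * s)) * H" using H0 by (intro mult_right_mono) auto
    moreover have "(\<Sum>j\<in>G. ?w j) = (\<Sum>j\<in>G \<inter> lo (2 ^ Suc p0). ?w j) + (\<Sum>j\<in>G - lo (2 ^ Suc p0). ?w j)"
      using G by (rule sum.Int_Diff)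
    ultimately have "(\<Sum>j\<in>G. ?w j) \<le> r\<^sup>2 * ((2 * K0) powr (2 * s) * \<Lambda> powr (2 * s)) * H + C' * (\<Lambda> powr (2 * s) / ln 2 powr (2 * s)) * H"
      using low' high' by linarith
    also have "\<dots> = C * \<Lambda> powr (2 * s) * H" by (simp add: C_def algebra_simps)
    finally show ?thesis by (simp only: \<Lambda>_def H_def)
  qed
  show thesis
  proof (rule that[of C], intro conjI)
    fix c t assume c: "flow c" and h: "(\<lambda>j. sobolev_weight s j * (cmod (c j 0))\<^sup>2) summable_on UNIV"
    show sm: "(\<lambda>j. sobolev_weight s j * (cmod (c j t))\<^sup>2) summable_on UNIV"
      by (rule nonneg_bdd_above_summable_on) (auto intro!: bdd_aboveI2 main[OF c h])
    show "(\<Sum>\<^sub>\<infinity>j. sobolev_weight s j * (cmod (c j t))\<^sup>2)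
      \<le> C * ln (\<bar>t\<bar> + 2) powr (2 * s) * (\<Sum>\<^sub>\<infinity>j. sobolev_weight s j * (cmod (c j 0))\<^sup>2)"
      by (rule infsum_le_finite_sums[OF sm main[OF c h]])
  qed
qed

end

section \<open>Fourier series in a strip\<close>

text \<open>The identity theorem on the connected strip: the real line accumulates at 0, a point of
  the strip.\<close>

lemma analytic_continuation_from_reals:
  assumes "f holomorphic_on strip r" "\<And>x. f (complex_of_real x) = 0" "z \<in> strip r"
  shows "f z = 0"
proof (rule analytic_continuation[where f = f and w = z and S = "strip r" and \<xi> = 0 and U = "range complex_of_real"])
  have "r > 0" using assms(3) by (auto simp: strip_def)
  then show "range complex_of_real \<subseteq> strip r" "0 \<in> strip r" by (auto simp: strip_def)
  show "0 islimpt range complex_of_real" unfolding islimpt_approachable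
  proof (intro allI impI)
    fix e :: real assume "e > 0"
    then show "\<exists>x'\<in>range complex_of_real. x' \<noteq> 0 \<and> dist x' 0 < e"
      by (intro bexI[of _ "complex_of_real (e / 2)"] rangeI) auto
  qed
qed (use assms in \<open>auto simp: open_strip convex_strip convex_connected\<close>)

lemma has_sum_range_imp_sums:
  fixes f :: "'a \<Rightarrow> complex" and g :: "nat \<Rightarrow> 'a"
  assumes "(f has_sum s) UNIV" "inj g" "\<And>x. x \<notin> range g \<Longrightarrow> f x = 0"
  shows "(\<lambda>n. f (g n)) sums s"
proof -
  have "(f has_sum s) (range g)"
    using assms(1) has_sum_cong_neutral[of "range g" UNIV f f s] assms(3) by auto
  then have "((f \<circ> g) has_sum s) UNIV" by (subst (asm) has_sum_reindex[OF assms(2)])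
  then show ?thesis by (intro has_sum_imp_sums) (simp add: o_def)
qed

section \<open>Separate holomorphy from double power series\<close>

lemma analytic2_onD:
  assumes "analytic2_on F D" "(z0, w0) \<in> D"
  shows "\<exists>r>0. \<exists>a :: nat \<Rightarrow> nat \<Rightarrow> complex. \<forall>z w. dist z z0 < r \<longrightarrow> dist w w0 < r \<longrightarrow>
       ((\<lambda>(m, n). a m n * (z - z0) ^ m * (w - w0) ^ n) has_sum F (z, w)) UNIV"
  using bspec[OF assms(1)[unfolded analytic2_on_def] assms(2)] by (simp only: prod.case)

text \<open>Expanding at (z0, w) and keeping the second variable equal to its centre kills every
  term with a positive power of it. The double series becomes an ordinary power series in z.\<close>

lemma analytic2_on_holomorphic_fst:
  assumes "analytic2_on F (complex_strip r)" "w \<in> strip r"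
  shows "(\<lambda>z. F (z, w)) holomorphic_on strip r"
  unfolding holomorphic_on_def
proof
  fix z0 assume "z0 \<in> strip r"
  then have "(z0, w) \<in> complex_strip r" using assms(2) by (auto simp: complex_strip_def strip_def)
  then obtain d a where d: "d > 0" and a: "\<And>z w'. dist z z0 < d \<Longrightarrow> dist w' w < d \<Longrightarrow>
      ((\<lambda>(m, n). a m n * (z - z0) ^ m * (w' - w) ^ n) has_sum F (z, w')) UNIV"
    using analytic2_onD[OF assms(1)] by blast
  have "(\<lambda>z. F (z, w)) holomorphic_on ball z0 d"
  proof (rule power_series_holomorphic)
    fix z assume "z \<in> ball z0 d"
    then have "dist z z0 < d" by (simp add: dist_commute)
    from has_sum_range_imp_sums[OF a[OF this], of w "\<lambda>m. (m, 0)"] d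
    show "(\<lambda>m. a m 0 * (z - z0) ^ m) sums F (z, w)" by (fastforce simp: inj_on_def image_iff)
  qed
  then have "(\<lambda>z. F (z, w)) field_differentiable at z0"
    using d by (intro holomorphic_on_imp_differentiable_at) auto
  then show "(\<lambda>z. F (z, w)) field_differentiable at z0 within strip r"
    by (rule field_differentiable_at_within)
qed

lemma analytic2_on_holomorphic_snd:
  assumes "analytic2_on F (complex_strip r)" "z \<in> strip r"
  shows "(\<lambda>w. F (z, w)) holomorphic_on strip r"
  unfolding holomorphic_on_def
proof
  fix w0 assume "w0 \<in> strip r"
  then have "(z, w0) \<in> complex_strip r" using assms(2) by (auto simp: complex_strip_def strip_def)
  then obtain d a where d: "d > 0" and a: "\<And>z' w. dist z' z < d \<Longrightarrow> dist w w0 < d \<Longrightarrow>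
      ((\<lambda>(m, n). a m n * (z' - z) ^ m * (w - w0) ^ n) has_sum F (z', w)) UNIV"
    using analytic2_onD[OF assms(1)] by blast
  have "(\<lambda>w. F (z, w)) holomorphic_on ball w0 d"
  proof (rule power_series_holomorphic)
    fix w assume "w \<in> ball w0 d"
    then have "dist w w0 < d" by (simp add: dist_commute)
    from has_sum_range_imp_sums[OF a[OF _ this], of z "\<lambda>n. (0, n)"] d
    show "(\<lambda>n. a 0 n * (w - w0) ^ n) sums F (z, w)" by (fastforce simp: inj_on_def image_iff)
  qed
  then have "(\<lambda>w. F (z, w)) field_differentiable at w0"
    using d by (intro holomorphic_on_imp_differentiable_at) auto
  then show "(\<lambda>w. F (z, w)) field_differentiable at w0 within strip r"
    by (rule field_differentiable_at_within)
qed

lemma lipschitz_strip: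
  assumes "g holomorphic_on strip r" "\<And>w. w \<in> strip r \<Longrightarrow> cmod (g w) \<le> K" "\<delta> > 0"
    "w \<in> strip (r - \<delta>)" "w' \<in> strip (r - \<delta>)"
  shows "cmod (g w - g w') \<le> K / \<delta> * cmod (w - w')"
proof (rule field_differentiable_bound[OF convex_strip[of "r - \<delta>"]])
  fix z assume z: "z \<in> strip (r - \<delta>)"
  show "(g has_field_derivative deriv g z) (at z within strip (r - \<delta>))"
    using z assms(3) by (intro holomorphic_derivI[OF assms(1) open_strip]) (auto simp: strip_def)
  show "cmod (deriv g z) \<le> K / \<delta>" by (rule deriv_bound_strip[OF assms(1-3) z])
qed (use assms in auto)

text \<open>The increment \<open>G (z + p) - G z\<close> of a primitive \<open>G\<close> has derivative \<open>0\<close>; this replaces shifting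
  the contour of integration.\<close>

lemma periodic_line_integral_constant:
  fixes S :: "complex set" and p :: real
  assumes S: "convex S" "open S" and g: "g holomorphic_on S" and p: "p > 0"
    and per: "\<And>z. z \<in> S \<Longrightarrow> z + p \<in> S \<Longrightarrow> g (z + p) = g z"
  obtains c where "\<And>a y. Complex a y \<in> S \<Longrightarrow> Complex (a + p) y \<in> S \<Longrightarrow>
    ((\<lambda>x. g (Complex x y)) has_integral c) {a..a + p}"
proof -
  obtain G where G: "\<And>z. z \<in> S \<Longrightarrow> (G has_field_derivative g z) (at z within S)"
    using holomorphic_convex_primitive'[OF S g] by blast
  have G': "(G has_field_derivative g z) (at z)" if "z \<in> S" for z
    using G[OF that] by (simp only: at_within_open[OF that S(2)])
  \<comment> \<open>S need not be invariant under the shift. T is an intersection of two translates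
    of a convex set, hence convex, so a vanishing derivative still forces a single constant.\<close>
  define T where "T = {z \<in> S. z + p \<in> S}"
  have convT: "convex T"
  proof -
    have "T = S \<inter> (\<lambda>z. z - p) ` S" by (force simp: T_def)
    then show ?thesis using S(1) by (simp add: convex_Int convex_translation_subtract)
  qed
  have der0: "((\<lambda>z. G (z + p) - G z) has_field_derivative 0) (at z within T)" if "z \<in> T" for z
  proof -
    have z: "z \<in> S" "z + p \<in> S" using that by (auto simp: T_def)
    have "((\<lambda>z. G (z + p) - G z) has_field_derivative (g (z + p) - g z)) (at z)"
      using G'[OF z(1)] G'[OF z(2)] by (auto intro!: derivative_eq_intros DERIV_shift[THEN iffD1])
    then show ?thesis using per[OF z] by (simp add: has_field_derivative_at_within)
  qed
  obtain c where c: "\<And>z. z \<in> T \<Longrightarrow> G (z + p) - G z = c"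
    using has_field_derivative_zero_constant[OF convT der0] by blast
  show thesis
  proof
    fix a y assume ay: "Complex a y \<in> S" "Complex (a + p) y \<in> S"
    have "((\<lambda>x. g (Complex x y)) has_integral G (Complex (a + p) y) - G (Complex a y)) {a..a + p}"
    proof (rule fundamental_theorem_of_calculus)
      fix x assume x: "x \<in> {a..a + p}"
      define u where "u = (x - a) / p"
      have u: "0 \<le> u" "u \<le> 1" using x p by (auto simp: u_def divide_simps)
      have "a + u * p = x" using p by (simp add: u_def)
      then have "Complex x y = (1 - u) *\<^sub>R Complex a y + u *\<^sub>R Complex (a + p) y"
        by (simp add: complex_eq_iff algebra_simps)
      then have "Complex x y \<in> S" using convexD_alt[OF S(1) ay u] by simp
      then have "(G has_field_derivative g (Complex x y)) (at (Complex x y))" by (rule G')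
      moreover have "((\<lambda>x. Complex x y) has_vector_derivative 1) (at x within {a..a + p})"
      proof -
        have "((\<lambda>x. complex_of_real x + \<i> * of_real y) has_vector_derivative 1) (at x within {a..a + p})"
          by (auto intro!: derivative_eq_intros)
        then show ?thesis by (simp add: Complex_eq)
      qed
      ultimately have "((G \<circ> (\<lambda>x. Complex x y)) has_vector_derivative 1 * g (Complex x y)) (at x within {a..a + p})"
        by (intro field_vector_diff_chain_within) (auto simp: has_field_derivative_at_within)
      then show "((\<lambda>x. G (Complex x y)) has_vector_derivative g (Complex x y)) (at x within {a..a + p})"
        by (simp add: o_def)
    qed (use p in auto)
    moreover have "G (Complex (a + p) y) - G (Complex a y) = c"
    proof -
      have "Complex a y + p = Complex (a + p) y" by (simp add: complex_eq_iff)
      then show ?thesis using c[of "Complex a y"] ay by (simp add: T_def)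
    qed
    ultimately show "((\<lambda>x. g (Complex x y)) has_integral c) {a..a + p}" by simp
  qed
qed

section \<open>Fourier coefficients as line integrals\<close>

lemma exp_int_mult_2pi: "exp (\<i> * of_int m * (z + of_real (2 * pi))) = exp (\<i> * of_int m * z)"
proof -
  have "exp (\<i> * of_int m * (z + of_real (2 * pi))) = exp (\<i> * of_int m * z) * exp (2 * of_int m * of_real pi * \<i>)"
    by (simp add: exp_add[symmetric] algebra_simps)
  also have "exp (2 * of_int m * of_real pi * \<i>) = (1::complex)" using exp_integer_2pi[of "of_int m"] by simp
  finally show ?thesis by simp
qed

text \<open>The Fourier coefficient of f along the real axis as an integral over a closed interval,
  the form in which primitives and differentiation under the integral sign apply. It serves the
  potential, whereas \<open>fourier_coeff\<close> serves square-integrable functions on the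
  torus.\<close>

definition strip_coeff :: "(complex \<Rightarrow> complex) \<Rightarrow> int \<Rightarrow> complex" where
  "strip_coeff f m = integral {-pi..pi} (\<lambda>x. f (of_real x) * exp (- \<i> * of_int m * of_real x)) / of_real (2 * pi)"

lemma exp_neg_int_mult_2pi: "exp (- \<i> * of_int m * (z + of_real (2 * pi))) = exp (- \<i> * of_int m * z)"
  using exp_int_mult_2pi[of "- m" z] by simp

lemma strip_coeff_shift:
  assumes f: "f holomorphic_on strip r" and per: "\<And>z. z \<in> strip r \<Longrightarrow> f (z + of_real (2 * pi)) = f z" and y: "\<bar>y\<bar> < r"
  shows "((\<lambda>x. f (Complex x y) * exp (- \<i> * of_int m * Complex x y)) has_integral of_real (2 * pi) * strip_coeff f m) {a..a + 2 * pi}"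
proof -
  obtain c where c: "\<And>a y. Complex a y \<in> strip r \<Longrightarrow> Complex (a + 2 * pi) y \<in> strip r \<Longrightarrow>
    ((\<lambda>x. f (Complex x y) * exp (- \<i> * of_int m * Complex x y)) has_integral c) {a..a + 2 * pi}"
  proof (rule periodic_line_integral_constant[of "strip r" "\<lambda>z. f z * exp (- \<i> * of_int m * z)" "2 * pi"])
    show "(\<lambda>z. f z * exp (- \<i> * of_int m * z)) holomorphic_on strip r"
      by (intro holomorphic_intros f)
    show "f (z + of_real (2 * pi)) * exp (- \<i> * of_int m * (z + of_real (2 * pi))) = f z * exp (- \<i> * of_int m * z)"
      if "z \<in> strip r" for z using per[OF that] exp_neg_int_mult_2pi by (simp only:)
  qed (auto simp: convex_strip open_strip)
  have "((\<lambda>x. f (Complex x 0) * exp (- \<i> * of_int m * Complex x 0)) has_integral c) {-pi..-pi + 2 * pi}"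
    using y by (intro c) (auto simp: strip_def)
  then have "((\<lambda>x. f (of_real x) * exp (- \<i> * of_int m * of_real x)) has_integral c) {-pi..pi}"
    by (simp add: complex_of_real_def)
  then have "c = of_real (2 * pi) * strip_coeff f m"
    unfolding strip_coeff_def by (simp add: integral_unique)
  then show ?thesis using c[of a y] y by (simp add: strip_def)
qed

lemma cmod_exp_int_Complex: "cmod (exp (- \<i> * of_int m * Complex x y)) = exp (of_int m * y)"
  by simp

lemma line_integral_bound:
  assumes "((\<lambda>x. g (Complex x y) * exp (- \<i> * of_int m * Complex x y)) has_integral c) {a..a + 2 * pi}"
    "\<And>x. x \<in> {a..a + 2 * pi} \<Longrightarrow> cmod (g (Complex x y)) \<le> K" "K \<ge> 0"
  shows "cmod c \<le> 2 * pi * K * exp (of_int m * y)"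
proof -
  have "cmod c \<le> (K * exp (of_int m * y)) * measure lborel {a..a + 2 * pi}"
  proof (rule has_integral_bound_real[OF _ finite.emptyI assms(1)])
    show "cmod (g (Complex x y) * exp (- \<i> * of_int m * Complex x y)) \<le> K * exp (of_int m * y)"
      if "x \<in> {a..a + 2 * pi} - {}" for x
      unfolding norm_mult cmod_exp_int_Complex using that assms(2) by (intro mult_right_mono) auto
  qed (use assms(3) in auto)
  then show ?thesis by (simp add: mult_ac)
qed

text \<open>The integral may be taken at any height in the strip, and at height y' the mode has
  modulus exp (m y').\<close>

lemma strip_coeff_bound:
  assumes f: "f holomorphic_on strip r" and per: "\<And>z. z \<in> strip r \<Longrightarrow> f (z + of_real (2 * pi)) = f z"
    and K: "\<And>z. z \<in> strip r \<Longrightarrow> cmod (f z) \<le> K" and y: "0 \<le> y" "y < r"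
  shows "cmod (strip_coeff f m) \<le> K * exp (- y * \<bar>of_int m\<bar>)"
proof -
  \<comment> \<open>The line is moved to the side on which the mode decays, so that m y' = - y
    |m|.\<close>
  define y' where "y' = - of_int (sgn m) * y"
  have y': "\<bar>y'\<bar> < r" "of_int m * y' = - y * \<bar>of_int m\<bar>"
    using y by (auto simp: y'_def sgn_if)
  have "0 \<in> strip r" using y by (simp add: strip_def)
  from order_trans[OF norm_ge_zero K[OF this]] have "K \<ge> 0" .
  have "cmod (of_real (2 * pi) * strip_coeff f m) \<le> 2 * pi * K * exp (of_int m * y')"
    using y' \<open>K \<ge> 0\<close> by (intro line_integral_bound[OF strip_coeff_shift[OF f per y'(1), of m 0]] K) (auto simp: strip_def)
  then show ?thesis unfolding y'(2) by (simp add: norm_mult)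
qed

lemma has_integral_exp_int:
  "((\<lambda>x. exp (- \<i> * of_int m * complex_of_real x)) has_integral (if m = 0 then of_real (2 * pi) else 0)) {a..a + 2 * pi}"
proof (cases "m = 0")
  case True
  then show ?thesis using has_integral_const_real[of "1::complex" a "a + 2 * pi"] by (simp add: scaleR_conv_of_real)
next
  case False
  let ?G = "\<lambda>x. exp (- \<i> * of_int m * complex_of_real x) / (- \<i> * of_int m)"
  have "((\<lambda>x. exp (- \<i> * of_int m * complex_of_real x)) has_integral ?G (a + 2 * pi) - ?G a) {a..a + 2 * pi}"
  proof (rule fundamental_theorem_of_calculus)
    fix x assume "x \<in> {a..a + 2 * pi}"
    have "((\<lambda>z. exp (- \<i> * of_int m * z) / (- \<i> * of_int m)) has_field_derivative exp (- \<i> * of_int m * of_real x)) (at (of_real x))"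
      using False by (auto intro!: derivative_eq_intros)
    then show "(?G has_vector_derivative exp (- \<i> * of_int m * of_real x)) (at x within {a..a + 2 * pi})"
      by (rule has_vector_derivative_at_within[OF has_vector_derivative_real_field])
  qed auto
  moreover have "?G (a + 2 * pi) = ?G a"
    using exp_neg_int_mult_2pi[of m "of_real a"] by (simp only: of_real_add)
  ultimately show ?thesis using False by simp
qed

text \<open>Chernoff's argument: \<open>f - f x0\<close> is \<open>exp (\<i> (z - x0)) - 1\<close> times a holomorphic function, which
  makes the Fourier series of \<open>f\<close> at \<open>x0\<close> telescope.\<close>

lemma fourier_series_telescopes:
  assumes f: "f holomorphic_on strip r" and per: "\<And>z. z \<in> strip r \<Longrightarrow> f (z + of_real (2 * pi)) = f z" and r: "r > 0"
  obtains \<gamma> :: "int \<Rightarrow> complex" and K where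
    "\<And>m. strip_coeff f m * exp (\<i> * of_int m * of_real x0) - (if m = 0 then f (of_real x0) else 0) = \<gamma> (m - 1) - \<gamma> m"
    "\<And>m. cmod (\<gamma> m) \<le> K * exp (- (r / 2) * \<bar>of_int m\<bar>)"
proof -
  define p where "p = complex_of_real x0"
  \<comment> \<open>The real width 4 \<pi> leaves p as the only zero of exp (\<i> (z - p)) - 1 in S,
    while a full period centred at x0 fits inside.\<close>
  define S where "S = {z. \<bar>Re z - x0\<bar> < 2 * pi \<and> \<bar>Im z\<bar> < r}"
  have S_eq: "S = {z. Re z < x0 + 2 * pi} \<inter> {z. x0 - 2 * pi < Re z} \<inter> strip r"
    by (auto simp: S_def strip_def)
  have S: "open S" "convex S" "S \<subseteq> strip r"
    unfolding S_eq by (auto intro!: open_Int convex_Int open_strip convex_strip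
      simp: open_halfspace_Re_lt open_halfspace_Re_gt convex_halfspace_Re_lt convex_halfspace_Re_gt)
  have pS: "p \<in> S" using r by (simp add: S_def p_def)
  define e where "e z = exp (\<i> * (z - p)) - 1" for z
  \<comment> \<open>Both difference quotients extend holomorphically over p. As e has derivative
    \<i> there, e1 has no zero in S, and g = f1 / e1 is holomorphic across p.\<close>
  define f1 where "f1 z = (if z = p then deriv f p else (f z - f p) / (z - p))" for z
  define e1 where "e1 z = (if z = p then deriv e p else (e z - e p) / (z - p))" for z
  have ep: "e p = 0" by (simp add: e_def)
  have de: "deriv e p = \<i>"
    unfolding e_def by (rule DERIV_imp_deriv) (auto intro!: derivative_eq_intros)
  have f1: "f1 holomorphic_on S" unfolding f1_def
    using pole_lemma_open[OF holomorphic_on_subset[OF f S(3)] S(1), of p] .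
  have e1: "e1 holomorphic_on S" unfolding e1_def
    by (rule pole_lemma_open[OF _ S(1)]) (auto simp: e_def[abs_def] intro!: holomorphic_intros)
  have e_nz: "e z \<noteq> 0" if "z \<in> S" "z \<noteq> p" for z
  proof
    assume "e z = 0"
    then have "exp (\<i> * (z - p)) = 1" by (simp add: e_def)
    then obtain n :: int where n: "Re (\<i> * (z - p)) = 0" "Im (\<i> * (z - p)) = of_int (2 * n) * pi"
      unfolding exp_eq_1 by blast
    have "\<bar>real_of_int n\<bar> * (2 * pi) < 1 * (2 * pi)" using n(2) that(1) by (simp add: S_def p_def abs_mult)
    then have "\<bar>real_of_int n\<bar> < 1" by (subst (asm) mult_less_cancel_right_pos) auto
    then have "n = 0" by linarith
    with n that(2) show False by (simp add: complex_eq_iff)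
  qed
  have e1_nz: "e1 z \<noteq> 0" if "z \<in> S" for z
    using e_nz[OF that] ep de by (auto simp: e1_def)
  define g where "g z = f1 z / e1 z" for z
  have g: "g holomorphic_on S" unfolding g_def[abs_def] by (intro holomorphic_intros f1 e1 e1_nz)
  have fg: "f z - f p = g z * e z" if "z \<in> S" for z
  proof (cases "z = p")
    case False
    then have "g z = (f z - f p) / e z" by (simp add: g_def f1_def e1_def ep)
    then show ?thesis using e_nz[OF that False] by simp
  qed (simp add: ep)
  have gper: "g (z + of_real (2 * pi)) = g z" if z: "z \<in> S" "z + of_real (2 * pi) \<in> S" for z
  proof -
    have "z \<noteq> p" "z + of_real (2 * pi) \<noteq> p" using z by (auto simp: S_def p_def complex_eq_iff)
    moreover have "e (z + of_real (2 * pi)) = e z"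
    proof -
      have "\<i> * (z + of_real (2 * pi) - p) = \<i> * of_int 1 * ((z - p) + of_real (2 * pi))" by simp
      then show ?thesis unfolding e_def by (simp only: exp_int_mult_2pi) simp
    qed
    moreover have "f (z + of_real (2 * pi)) = f z" using z S by (intro per) auto
    ultimately have "g (z + of_real (2 * pi)) * e z = g z * e z" "e z \<noteq> 0"
      using fg[OF z(1)] fg[OF z(2)] e_nz[OF z(1)] by simp_all
    then show ?thesis by simp
  qed
  have "\<exists>c. \<forall>y. \<bar>y\<bar> < r \<longrightarrow> ((\<lambda>x. g (Complex x y) * exp (- \<i> * of_int m * Complex x y)) has_integral c) {x0 - pi..x0 - pi + 2 * pi}" for m
  proof -
    obtain c where "\<And>a y. Complex a y \<in> S \<Longrightarrow> Complex (a + 2 * pi) y \<in> S \<Longrightarrow>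
      ((\<lambda>x. g (Complex x y) * exp (- \<i> * of_int m * Complex x y)) has_integral c) {a..a + 2 * pi}"
    proof (rule periodic_line_integral_constant[of S "\<lambda>z. g z * exp (- \<i> * of_int m * z)" "2 * pi"])
      show "(\<lambda>z. g z * exp (- \<i> * of_int m * z)) holomorphic_on S"
        by (intro holomorphic_intros g)
      show "g (z + of_real (2 * pi)) * exp (- \<i> * of_int m * (z + of_real (2 * pi))) = g z * exp (- \<i> * of_int m * z)"
        if "z \<in> S" "z + of_real (2 * pi) \<in> S" for z using gper[OF that] exp_neg_int_mult_2pi by (simp only:)
    qed (auto simp: S)
    from this[of "x0 - pi"] show ?thesis by (intro exI[of _ c]) (auto simp: S_def)
  qed
  then obtain c where c: "\<And>m y. \<bar>y\<bar> < r \<Longrightarrow>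
      ((\<lambda>x. g (Complex x y) * exp (- \<i> * of_int m * Complex x y)) has_integral c m) {x0 - pi..x0 - pi + 2 * pi}"
    by metis
  have lineS: "Complex x y \<in> S" if "x \<in> {x0 - pi..x0 - pi + 2 * pi}" "\<bar>y\<bar> < r" for x y
  proof -
    have "\<bar>x - x0\<bar> \<le> pi" using that(1) by auto
    also have "pi < 2 * pi" using pi_gt_zero by linarith
    finally show ?thesis using that(2) by (simp add: S_def)
  qed
  have "\<exists>K\<ge>0. \<forall>x\<in>{x0 - pi..x0 - pi + 2 * pi}. cmod (g (Complex x y)) \<le> K" if "\<bar>y\<bar> < r" for y
  proof -
    have "continuous_on {x0 - pi..x0 - pi + 2 * pi} (\<lambda>x. g (Complex x y))"
      by (rule continuous_on_compose2[OF holomorphic_on_imp_continuous_on[OF g]])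
        (use lineS[OF _ that] in \<open>auto intro!: continuous_intros simp: Complex_eq\<close>)
    then have "bounded ((\<lambda>x. g (Complex x y)) ` {x0 - pi..x0 - pi + 2 * pi})"
      by (intro compact_imp_bounded compact_continuous_image) auto
    then obtain K where "\<forall>x\<in>{x0 - pi..x0 - pi + 2 * pi}. cmod (g (Complex x y)) \<le> K" unfolding bounded_iff by blast
    then show ?thesis by (intro exI[of _ "\<bar>K\<bar>"]) force
  qed
  \<comment> \<open>There is no bound for g up to the edge of the strip; it is bounded on the
    compact segments at heights r / 2 and -r / 2, one for each sign of m.\<close>
  from this[of "r / 2"] this[of "- (r / 2)"] r obtain K1 K2 where K: "K1 \<ge> 0" "K2 \<ge> 0"
    "\<And>x. x \<in> {x0 - pi..x0 - pi + 2 * pi} \<Longrightarrow> cmod (g (Complex x (r / 2))) \<le> K1"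
    "\<And>x. x \<in> {x0 - pi..x0 - pi + 2 * pi} \<Longrightarrow> cmod (g (Complex x (- (r / 2)))) \<le> K2" by auto
  have c_bound: "cmod (c m) \<le> 2 * pi * (K1 + K2) * exp (- (r / 2) * \<bar>of_int m\<bar>)" for m
  proof (cases "m \<ge> 0")
    case True
    have "cmod (c m) \<le> 2 * pi * (K1 + K2) * exp (of_int m * - (r / 2))"
      using K r by (intro line_integral_bound[OF c]) (auto intro: add_increasing)
    then show ?thesis using True by (simp add: mult.commute)
  next
    case False
    have "cmod (c m) \<le> 2 * pi * (K1 + K2) * exp (of_int m * (r / 2))"
      using K r by (intro line_integral_bound[OF c]) (auto intro: add_increasing2)
    then show ?thesis using False by (simp add: mult.commute)
  qed
  \<comment> \<open>Multiplying by e lowers the frequency by one in one term and keeps it in the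
    other: e(z) exp (-\<i> m z) = exp (-\<i> p) exp (-\<i> (m - 1) z) - exp (-\<i> m z). This is the
    source of the telescoping.\<close>
  have rel: "of_real (2 * pi) * strip_coeff f m - f p * (if m = 0 then of_real (2 * pi) else 0) = exp (- \<i> * p) * c (m - 1) - c m" for m
  proof -
    have i1: "((\<lambda>x. f (Complex x 0) * exp (- \<i> * of_int m * Complex x 0) - f p * exp (- \<i> * of_int m * of_real x)) has_integral
       of_real (2 * pi) * strip_coeff f m - f p * (if m = 0 then of_real (2 * pi) else 0)) {x0 - pi..x0 - pi + 2 * pi}"
      using r by (intro has_integral_diff strip_coeff_shift[OF f per] has_integral_mult_right has_integral_exp_int) auto
    have i2: "((\<lambda>x. exp (- \<i> * p) * (g (Complex x 0) * exp (- \<i> * of_int (m - 1) * Complex x 0)) - g (Complex x 0) * exp (- \<i> * of_int m * Complex x 0))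
       has_integral exp (- \<i> * p) * c (m - 1) - c m) {x0 - pi..x0 - pi + 2 * pi}"
      using r by (intro has_integral_diff c has_integral_mult_right) auto
    have eq: "f (Complex x 0) * exp (- \<i> * of_int m * Complex x 0) - f p * exp (- \<i> * of_int m * of_real x)
      = exp (- \<i> * p) * (g (Complex x 0) * exp (- \<i> * of_int (m - 1) * Complex x 0)) - g (Complex x 0) * exp (- \<i> * of_int m * Complex x 0)"
      if "x \<in> {x0 - pi..x0 - pi + 2 * pi}" for x
    proof -
      define z where "z = complex_of_real x"
      have z: "Complex x 0 = z" by (simp add: z_def complex_of_real_def)
      have zS: "z \<in> S" using lineS[OF that, of 0] r by (simp add: z)
      have "exp (- \<i> * p) * exp (- \<i> * of_int (m - 1) * z) = exp (\<i> * (z - p)) * exp (- \<i> * of_int m * z)"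
        by (simp add: exp_add[symmetric] algebra_simps)
      then have "exp (- \<i> * p) * (g z * exp (- \<i> * of_int (m - 1) * z)) - g z * exp (- \<i> * of_int m * z)
        = g z * e z * exp (- \<i> * of_int m * z)" by (simp add: e_def algebra_simps)
      also have "\<dots> = f z * exp (- \<i> * of_int m * z) - f p * exp (- \<i> * of_int m * z)"
        using fg[OF zS, symmetric] by (simp add: left_diff_distrib)
      finally show ?thesis unfolding z z_def[symmetric] by simp
    qed
    show ?thesis by (rule has_integral_unique[OF has_integral_eq[OF eq i1] i2])
  qed
  define \<gamma> where "\<gamma> m = exp (\<i> * of_int m * p) * c m / of_real (2 * pi)" for m
  show thesis
  proof
    fix m
    have "exp (\<i> * of_int m * p) * exp (- \<i> * p) = exp (\<i> * of_int (m - 1) * p)"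
      by (simp add: exp_add[symmetric] algebra_simps)
    then have "\<gamma> (m - 1) - \<gamma> m = exp (\<i> * of_int m * p) * (exp (- \<i> * p) * c (m - 1) - c m) / of_real (2 * pi)"
      by (simp add: \<gamma>_def algebra_simps diff_divide_distrib)
    also have "\<dots> = strip_coeff f m * exp (\<i> * of_int m * p) - (if m = 0 then f p else 0)"
      unfolding rel[symmetric] by (simp add: field_simps)
    finally show "strip_coeff f m * exp (\<i> * of_int m * of_real x0) - (if m = 0 then f (of_real x0) else 0) = \<gamma> (m - 1) - \<gamma> m"
      by (simp add: p_def)
    have "cmod (exp (\<i> * of_int m * p)) = 1" by (simp add: p_def)
    then have "2 * pi * cmod (\<gamma> m) = cmod (c m)" by (simp add: \<gamma>_def norm_mult norm_divide)
    also note c_bound[of m]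
    finally have "2 * pi * cmod (\<gamma> m) \<le> 2 * pi * ((K1 + K2) * exp (- (r / 2) * \<bar>of_int m\<bar>))"
      by (simp only: mult.assoc)
    then show "cmod (\<gamma> m) \<le> (K1 + K2) * exp (- (r / 2) * \<bar>of_int m\<bar>)"
      by (rule mult_left_le_imp_le) simp
  qed
qed

section \<open>Pointwise convergence of the Fourier series\<close>

lemma sum_telescope_int:
  fixes \<gamma> :: "int \<Rightarrow> 'a :: ab_group_add"
  shows "(\<Sum>m\<in>lo (Suc N). \<gamma> (m - 1) - \<gamma> m) = \<gamma> (- int N - 1) - \<gamma> (int N)"
proof (induction N)
  case 0
  have "lo (Suc 0) = {0}" by (auto simp: lo_def)
  then show ?case by simp
next
  case (Suc N)
  have "lo (Suc (Suc N)) = insert (int (Suc N)) (insert (- int (Suc N)) (lo (Suc N)))"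
    by (auto simp: lo_def)
  moreover have "int (Suc N) \<notin> insert (- int (Suc N)) (lo (Suc N))" "- int (Suc N) \<notin> lo (Suc N)"
    by (auto simp: lo_def)
  ultimately have "(\<Sum>m\<in>lo (Suc (Suc N)). \<gamma> (m - 1) - \<gamma> m) = (\<gamma> (int (Suc N) - 1) - \<gamma> (int (Suc N)))
      + ((\<gamma> (- int (Suc N) - 1) - \<gamma> (- int (Suc N))) + (\<gamma> (- int N - 1) - \<gamma> (int N)))"
    by (simp only: sum.insert finite_insert finite_lo Suc.IH not_False_eq_True)
  moreover have "int (Suc N) - 1 = int N" "- int N - 1 = - int (Suc N)" by simp_all
  ultimately show ?case by (simp only:) simp
qed

lemma summable_on_exp_abs_int:
  fixes f :: "int \<Rightarrow> complex"
  assumes "\<And>m. cmod (f m) \<le> K * exp (- \<tau> * \<bar>of_int m\<bar>)" "\<tau> > 0"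
  shows "f summable_on UNIV"
proof (rule abs_summable_summable, rule nonneg_bdd_above_summable_on)
  have "K * exp (- \<tau> * \<bar>of_int 0\<bar>) \<ge> 0" using order_trans[OF norm_ge_zero assms(1)] by blast
  then have K: "K \<ge> 0" by simp
  show "bdd_above (sum (\<lambda>m. norm (f m)) ` {F. F \<subseteq> UNIV \<and> finite F})"
  proof (rule bdd_aboveI2)
    fix F :: "int set" assume F: "F \<in> {F. F \<subseteq> UNIV \<and> finite F}"
    have "(\<Sum>m\<in>F. norm (f m)) \<le> (\<Sum>m\<in>F. K * exp (- \<tau> * \<bar>of_int (0 - m)\<bar>))"
      using assms(1) by (intro sum_mono) auto
    also have "\<dots> \<le> K * geo \<tau>"
      unfolding sum_distrib_left[symmetric] using F K assms(2) by (intro mult_left_mono sum_exp_abs_le_geo) auto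
    finally show "(\<Sum>m\<in>F. norm (f m)) \<le> K * geo \<tau>" .
  qed
qed auto

text \<open>Exponential decay gives an unordered sum of unknown value. The symmetric partial sums
  telescope to f (x0) plus boundary terms that vanish, which identifies the value.\<close>

lemma fourier_series_has_sum:
  assumes f: "f holomorphic_on strip r" and per: "\<And>z. z \<in> strip r \<Longrightarrow> f (z + of_real (2 * pi)) = f z" and r: "r > 0"
    and K: "\<And>z. z \<in> strip r \<Longrightarrow> cmod (f z) \<le> K"
  shows "((\<lambda>m. strip_coeff f m * exp (\<i> * of_int m * of_real x0)) has_sum f (of_real x0)) UNIV"
proof -
  define h where "h m = strip_coeff f m * exp (\<i> * of_int m * of_real x0)" for m
  obtain \<gamma> K' where tele: "\<And>m. h m - (if m = 0 then f (of_real x0) else 0) = \<gamma> (m - 1) - \<gamma> m"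
    and \<gamma>: "\<And>m. cmod (\<gamma> m) \<le> K' * exp (- (r / 2) * \<bar>of_int m\<bar>)"
    unfolding h_def using fourier_series_telescopes[OF f per r, of x0] by blast
  have "h summable_on UNIV"
  proof (rule summable_on_exp_abs_int)
    show "cmod (h m) \<le> K * exp (- (r / 2) * \<bar>of_int m\<bar>)" for m
    proof -
      have "cmod (exp (\<i> * of_int m * of_real x0)) = 1" by simp
      then show ?thesis using strip_coeff_bound[OF f per K, of "r / 2" m] r by (simp add: h_def norm_mult)
    qed
  qed (use r in auto)
  then obtain s where s: "(h has_sum s) UNIV" by (auto simp: summable_on_def)
  have "filterlim (\<lambda>N. lo (Suc N)) (finite_subsets_at_top UNIV) sequentially"
    unfolding filterlim_finite_subsets_at_top
  proof (intro allI impI)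
    fix X :: "int set" assume "finite X \<and> X \<subseteq> UNIV"
    then obtain J where J: "\<forall>N\<ge>J. X \<subseteq> lo N" using lo_exhausts by blast
    show "\<forall>\<^sub>F N in sequentially. finite (lo (Suc N)) \<and> X \<subseteq> lo (Suc N) \<and> lo (Suc N) \<subseteq> UNIV"
      unfolding eventually_sequentially using J by (intro exI[of _ J]) auto
  qed
  then have lim1: "(\<lambda>N. sum h (lo (Suc N))) \<longlonglongrightarrow> s"
    using s unfolding has_sum_def by (rule filterlim_compose[rotated])
  have sum_eq: "sum h (lo (Suc N)) = f (of_real x0) + (\<gamma> (- int N - 1) - \<gamma> (int N))" for N
  proof -
    have "sum h (lo (Suc N)) = (\<Sum>m\<in>lo (Suc N). (if m = 0 then f (of_real x0) else 0)) + (\<Sum>m\<in>lo (Suc N). \<gamma> (m - 1) - \<gamma> m)"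
      unfolding tele[symmetric] sum.distrib[symmetric] by simp
    also have "(\<Sum>m\<in>lo (Suc N). (if m = 0 then f (of_real x0) else 0)) = f (of_real x0)"
      by (simp add: sum.delta) (simp add: lo_def)
    finally show ?thesis by (simp only: sum_telescope_int)
  qed
  have e0: "(\<lambda>N. K' * exp (- (r / 2) * real N)) \<longlonglongrightarrow> 0"
  proof -
    have "(\<lambda>N. exp (- (r / 2)) ^ N) \<longlonglongrightarrow> 0" using r by (intro LIMSEQ_realpow_zero) auto
    then have "(\<lambda>N. K' * exp (- (r / 2)) ^ N) \<longlonglongrightarrow> K' * 0" by (intro tendsto_mult tendsto_const)
    then show ?thesis by (simp only: exp_of_nat2_mult mult_zero_right)
  qed
  have g1: "(\<lambda>N. \<gamma> (int N)) \<longlonglongrightarrow> 0"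
    by (rule Lim_null_comparison[OF _ e0]) (use \<gamma>[of "int _"] in auto)
  have g2: "(\<lambda>N. \<gamma> (- int N - 1)) \<longlonglongrightarrow> 0"
    by (rule Lim_null_comparison[OF _ LIMSEQ_Suc[OF e0]]) (use \<gamma>[of "- int _ - 1"] in \<open>auto simp: algebra_simps\<close>)
  have "(\<lambda>N. f (of_real x0) + (\<gamma> (- int N - 1) - \<gamma> (int N))) \<longlonglongrightarrow> f (of_real x0) + (0 - 0)"
    by (intro tendsto_intros g1 g2)
  then have "(\<lambda>N. sum h (lo (Suc N))) \<longlonglongrightarrow> f (of_real x0)" by (simp add: sum_eq)
  with lim1 have "s = f (of_real x0)" by (rule LIMSEQ_unique)
  with s have "(h has_sum f (of_real x0)) UNIV" by simp
  then show ?thesis unfolding h_def[abs_def] .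
qed

section \<open>Fourier coefficients of the potential in complex time\<close>

lemma strip_coeff_uminus:
  assumes "\<And>x. cnj (f (complex_of_real x)) = f (of_real x)"
  shows "strip_coeff f (- m) = cnj (strip_coeff f m)"
proof -
  have "cnj (f (of_real x) * exp (- \<i> * of_int m * of_real x)) = f (of_real x) * exp (- \<i> * of_int (- m) * of_real x)" for x
    using assms by (simp add: exp_cnj)
  then show ?thesis by (simp add: strip_coeff_def Henstock_Kurzweil_Integration.integral_cnj)
qed

text \<open>Differentiation under the integral needs the w-derivative of F to be jointly continuous,
  while only separate holomorphy and a bound on F are given. Cauchy's estimates make that derivative
  Lipschitz in each variable, hence jointly.\<close>

lemma strip_coeff_holomorphic:
  assumes fst: "\<And>w. w \<in> strip r \<Longrightarrow> (\<lambda>z. F (z, w)) holomorphic_on strip r"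
    and snd: "\<And>z. z \<in> strip r \<Longrightarrow> (\<lambda>w. F (z, w)) holomorphic_on strip r"
    and K: "\<And>z w. z \<in> strip r \<Longrightarrow> w \<in> strip r \<Longrightarrow> cmod (F (z, w)) \<le> K" and r: "r > 0"
  shows "(\<lambda>w. strip_coeff (\<lambda>z. F (z, w)) m) holomorphic_on strip (r / 2)"
proof -
  \<comment> \<open>Cauchy's estimate is applied twice in the time variable, each time at the cost
    of r / 4, which leaves the strip of half width r / 2.\<close>
  define \<delta> where "\<delta> = r / 4"
  have \<delta>: "\<delta> > 0" using r by (simp add: \<delta>_def)
  have str: "strip (r / 2) = strip (r - \<delta> - \<delta>)" by (simp add: \<delta>_def)
  have real: "complex_of_real t \<in> strip (r - \<delta>)" "complex_of_real t \<in> strip r" for t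
    using r by (auto simp: strip_def \<delta>_def)
  have sub: "strip (r / 2) \<subseteq> strip (r - \<delta>)" "strip (r / 2) \<subseteq> strip r" "strip (r - \<delta>) \<subseteq> strip r"
    using r by (auto simp: strip_def \<delta>_def)
  define D where "D t w = deriv (\<lambda>w. F (complex_of_real t, w)) w" for t w
  have D: "((\<lambda>w. F (of_real t, w)) has_field_derivative D t w) (at w)" if "w \<in> strip r" for t w
    unfolding D_def by (rule holomorphic_derivI[OF snd[OF real(2)] open_strip that])
  have Kpos: "K \<ge> 0"
    using order_trans[OF norm_ge_zero K[OF real(2) real(2)]] .
  define L where "L = K / \<delta> / \<delta>"
  have L: "L \<ge> 0" using Kpos \<delta> by (simp add: L_def)
  have Lw: "cmod (D t w - D t w') \<le> L * cmod (w - w')" if "w \<in> strip (r / 2)" "w' \<in> strip (r / 2)" for t w w'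
    unfolding L_def
  proof (rule lipschitz_strip)
    have "D t holomorphic_on strip r" unfolding D_def
      by (rule holomorphic_deriv[OF snd[OF real(2)] open_strip])
    then show "D t holomorphic_on strip (r - \<delta>)" using sub holomorphic_on_subset by blast
    show "cmod (D t w) \<le> K / \<delta>" if "w \<in> strip (r - \<delta>)" for w
      unfolding D_def by (rule deriv_bound_strip[OF snd[OF real(2)] K[OF real(2)] \<delta> that])
  qed (use that \<delta> str in auto)
  \<comment> \<open>The difference of F at two values of t is already small, by the Lipschitz bound
    in the first variable; Cauchy in w carries this over to its derivative.\<close>
  have Lt: "cmod (D t w - D t' w) \<le> L * \<bar>t - t'\<bar>" if w: "w \<in> strip (r / 2)" for t t' w
  proof -
    have "cmod (deriv (\<lambda>w. F (of_real t, w) - F (of_real t', w)) w) \<le> (K / \<delta> * \<bar>t - t'\<bar>) / \<delta>"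
    proof (rule deriv_bound_strip)
      show "(\<lambda>w. F (of_real t, w) - F (of_real t', w)) holomorphic_on strip r"
        by (intro holomorphic_intros snd real)
      show "cmod (F (of_real t, w) - F (of_real t', w)) \<le> K / \<delta> * \<bar>t - t'\<bar>" if w: "w \<in> strip r" for w
        using lipschitz_strip[OF fst[OF w] K[OF _ w] \<delta> real(1) real(1), of t t']
        by (simp add: of_real_diff[symmetric] del: of_real_diff)
      show "w \<in> strip (r - \<delta>)" using w sub by auto
    qed (rule \<delta>)
    moreover have "deriv (\<lambda>w. F (of_real t, w) - F (of_real t', w)) w = D t w - D t' w"
      using w sub by (intro DERIV_imp_deriv DERIV_diff D) auto
    ultimately show ?thesis by (simp add: L_def mult_ac)
  qed
  have cont: "continuous_on (strip (r / 2) \<times> cbox (- pi) pi) (\<lambda>(w, t). D t w * exp (- \<i> * of_int m * of_real t))"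
  proof -
    have "(2 * L)-lipschitz_on (strip (r / 2) \<times> cbox (- pi) pi) (\<lambda>p. D (snd p) (fst p))"
    proof (rule lipschitz_onI)
      fix p q assume pq: "p \<in> strip (r / 2) \<times> cbox (- pi) pi" "q \<in> strip (r / 2) \<times> cbox (- pi) pi"
      have "cmod (D (snd p) (fst p) - D (snd q) (fst q)) \<le> cmod (D (snd p) (fst p) - D (snd p) (fst q)) + cmod (D (snd p) (fst q) - D (snd q) (fst q))"
        using norm_triangle_ineq[of "D (snd p) (fst p) - D (snd p) (fst q)" "D (snd p) (fst q) - D (snd q) (fst q)"] by simp
      also have "\<dots> \<le> L * dist (fst p) (fst q) + L * dist (snd p) (snd q)"
        using pq unfolding dist_norm by (intro add_mono order_trans[OF Lw] order_trans[OF Lt]) auto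
      also have "\<dots> \<le> L * dist p q + L * dist p q"
        using L by (intro add_mono mult_left_mono dist_fst_le dist_snd_le)
      finally show "dist (D (snd p) (fst p)) (D (snd q) (fst q)) \<le> 2 * L * dist p q"
        by (simp add: dist_norm)
    qed (use L in simp)
    then show ?thesis unfolding case_prod_unfold
      by (intro continuous_intros lipschitz_on_continuous_on)
  qed
  have "(\<lambda>w. integral (cbox (- pi) pi) (\<lambda>t. F (of_real t, w) * exp (- \<i> * of_int m * of_real t))) holomorphic_on strip (r / 2)"
  proof (rule leibniz_rule_holomorphic[where fx = "\<lambda>w t. D t w * exp (- \<i> * of_int m * of_real t)", OF _ _ cont convex_strip])
    fix w assume w: "w \<in> strip (r / 2)"
    show "((\<lambda>w. F (of_real t, w) * exp (- \<i> * of_int m * of_real t)) has_field_derivative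
        D t w * exp (- \<i> * of_int m * of_real t)) (at w within strip (r / 2))" for t
      using w sub by (intro has_field_derivative_at_within[OF DERIV_cmult_right[OF D]]) auto
    show "(\<lambda>t. F (of_real t, w) * exp (- \<i> * of_int m * of_real t)) integrable_on cbox (- pi) pi"
    proof (rule integrable_continuous)
      have "continuous_on (strip r) (\<lambda>z. F (z, w))"
        using w sub by (intro holomorphic_on_imp_continuous_on fst) auto
      then have "continuous_on (cbox (- pi) pi) (\<lambda>t. F (of_real t, w))"
        by (rule continuous_on_compose2) (auto intro!: continuous_intros simp: real)
      then show "continuous_on (cbox (- pi) pi) (\<lambda>t. F (of_real t, w) * exp (- \<i> * of_int m * of_real t))"
        by (intro continuous_intros)
    qed
  qed
  then show ?thesis unfolding strip_coeff_def
    by (intro holomorphic_intros) (auto simp: cbox_interval)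
qed

text \<open>Periodicity is given on the real plane only. The identity theorem extends it first to
  complex z at real times, then to complex w.\<close>

lemma periodic_extends_to_strip:
  assumes fst: "\<And>w. w \<in> strip r \<Longrightarrow> (\<lambda>z. F (z, w)) holomorphic_on strip r"
    and snd: "\<And>z. z \<in> strip r \<Longrightarrow> (\<lambda>w. F (z, w)) holomorphic_on strip r"
    and per: "\<And>x t. F (complex_of_real x + of_real p, complex_of_real t) = F (of_real x, of_real t)"
    and z: "z \<in> strip r" and w: "w \<in> strip r"
  shows "F (z + of_real p, w) = F (z, w)"
proof -
  have r: "r > 0" using z by (auto simp: strip_def)
  have shift: "z + of_real p \<in> strip r" if "z \<in> strip r" for z using that by (simp add: strip_def)
  have 1: "F (z + of_real p, of_real t) - F (z, of_real t) = 0" if "z \<in> strip r" for z t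
  proof (rule analytic_continuation_from_reals[OF _ _ that])
    have t: "complex_of_real t \<in> strip r" using r by (simp add: strip_def)
    have "((\<lambda>z. F (z, of_real t)) \<circ> (\<lambda>z. z + of_real p)) holomorphic_on strip r"
      by (rule holomorphic_on_compose_gen[OF _ fst[OF t]]) (auto intro!: holomorphic_intros simp: shift)
    then show "(\<lambda>z. F (z + of_real p, of_real t) - F (z, of_real t)) holomorphic_on strip r"
      by (intro holomorphic_on_diff fst t) (simp add: o_def)
  qed (simp add: per)
  have "F (z + of_real p, w) - F (z, w) = 0"
  proof (rule analytic_continuation_from_reals[OF _ _ w])
    show "(\<lambda>w. F (z + of_real p, w) - F (z, w)) holomorphic_on strip r"
      by (intro holomorphic_on_diff snd shift z)
  qed (rule 1[OF z])
  then show ?thesis by simp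
qed

lemma analytic_potential_fourier:
  assumes "analytic_potential V"
  obtains W \<rho> \<theta> B where "exp_potential W \<rho> \<theta> B"
    "\<And>x t. ((\<lambda>m. W m (complex_of_real t) * exp (\<i> * of_int m * complex_of_real x)) has_sum complex_of_real (V x t)) UNIV"
    "\<And>t. continuous_on UNIV (\<lambda>x. complex_of_real (V x t))"
proof -
  obtain r F where Vper: "\<And>x t. V (x + 2 * pi) t = V x t" and r: "r > 0"
    and an: "analytic2_on F (complex_strip r)" and bdd: "bounded (F ` complex_strip r)"
    and FV: "\<And>x t. F (complex_of_real x, complex_of_real t) = complex_of_real (V x t)"
    using assms unfolding analytic_potential_def by blast
  obtain K where K: "K > 0" "\<And>z w. z \<in> strip r \<Longrightarrow> w \<in> strip r \<Longrightarrow> cmod (F (z, w)) \<le> K"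
    using bdd unfolding bounded_pos by (fastforce simp: complex_strip_def strip_def)
  note fst = analytic2_on_holomorphic_fst[OF an] and snd = analytic2_on_holomorphic_snd[OF an]
  have per: "F (z + of_real (2 * pi), w) = F (z, w)" if "z \<in> strip r" "w \<in> strip r" for z w
  proof (rule periodic_extends_to_strip[OF fst snd _ that])
    show "F (of_real x + of_real (2 * pi), of_real t) = F (of_real x, of_real t)" for x t
      unfolding of_real_add[symmetric] FV Vper ..
  qed
  define W where "W m w = strip_coeff (\<lambda>z. F (z, w)) m" for m w
  have sub: "w \<in> strip r" if "w \<in> strip (r / 2)" for w using that r by (auto simp: strip_def)
  show thesis
  \<comment> \<open>The first r / 2 is the strip on which the coefficients are holomorphic in time;
    the second is the decay rate obtained by moving the line of integration to height r / 2.\<close>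
  proof (rule that[of W "r / 2" "r / 2" K])
    show "exp_potential W (r / 2) (r / 2) K"
    proof
      show "W m holomorphic_on strip (r / 2)" for m
        unfolding W_def by (rule strip_coeff_holomorphic[OF fst snd K(2) r])
      show "cmod (W m w) \<le> K * exp (- (r / 2) * \<bar>real_of_int m\<bar>)" if "w \<in> strip (r / 2)" for m w
        unfolding W_def using sub[OF that] r
        by (intro strip_coeff_bound[of "\<lambda>z. F (z, w)" r] fst per K(2)) auto
      show "W (- m) (of_real t) = cnj (W m (of_real t))" for m t
        unfolding W_def by (rule strip_coeff_uminus) (simp add: FV)
    qed (use r K in auto)
    fix x t
    have t: "complex_of_real t \<in> strip r" using r by (simp add: strip_def)
    show "((\<lambda>m. W m (of_real t) * exp (\<i> * of_int m * of_real x)) has_sum of_real (V x t)) UNIV"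
      unfolding W_def FV[symmetric] using r t
      by (intro fourier_series_has_sum[of "\<lambda>z. F (z, complex_of_real t)" r K] fst per K(2)) auto
    have "continuous_on (strip r) (\<lambda>z. F (z, complex_of_real t))"
      by (intro holomorphic_on_imp_continuous_on fst t)
    then show "continuous_on UNIV (\<lambda>x. complex_of_real (V x t))" unfolding FV[symmetric]
      by (rule continuous_on_compose2) (use r in \<open>auto intro!: continuous_intros simp: strip_def\<close>)
  qed
qed

section \<open>From weak solutions to Fourier coefficients\<close>

abbreviation fourier_mode :: "int \<Rightarrow> real \<Rightarrow> complex" where
  "fourier_mode j x \<equiv> exp (- \<i> * of_int j * of_real x)"

section \<open>Integration on the torus\<close>

lemma finite_measure_torus: "finite_measure torus"
  by (rule finite_measureI) (simp add: torus_def emeasure_restrict_space)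

lemma measurable_continuous_torus:
  fixes f :: "real \<Rightarrow> complex"
  assumes "continuous_on UNIV f"
  shows "f \<in> borel_measurable torus"
  unfolding torus_def by (rule continuous_imp_measurable_on_sets_lebesgue) (auto intro: continuous_on_subset[OF assms])

lemma measurable_fourier_mode [measurable]: "fourier_mode j \<in> borel_measurable torus"
  by (intro measurable_continuous_torus continuous_intros)

lemma L2_torusD:
  assumes "f \<in> L2_torus"
  shows "f \<in> borel_measurable torus" "integrable torus (\<lambda>x. (cmod (f x))\<^sup>2)"
  using assms by (auto simp: L2_torus_def)

lemma integrable_L2_torus:
  assumes "f \<in> L2_torus"
  shows "integrable torus f"
proof (rule Bochner_Integration.integrable_bound)
  interpret finite_measure torus by (rule finite_measure_torus)
  show "integrable torus (\<lambda>x. 1 + (cmod (f x))\<^sup>2)" using L2_torusD[OF assms] by simp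
  have "cmod (f x) \<le> 1 + (cmod (f x))\<^sup>2" for x
    using zero_le_power2[of "cmod (f x) - 1/2"] by (simp add: power2_eq_square algebra_simps)
  then show "AE x in torus. norm (f x) \<le> norm (1 + (cmod (f x))\<^sup>2)" by simp
qed (use L2_torusD[OF assms] in auto)

lemma integrable_mult_bounded:
  fixes f g :: "real \<Rightarrow> complex"
  assumes "integrable torus f" "g \<in> borel_measurable torus" "\<And>x. cmod (g x) \<le> K"
  shows "integrable torus (\<lambda>x. f x * g x)"
proof (rule Bochner_Integration.integrable_bound)
  show "integrable torus (\<lambda>x. K * norm (f x))" using assms(1) by simp
  show "(\<lambda>x. f x * g x) \<in> borel_measurable torus" using assms by measurable
  have "K \<ge> 0" using order_trans[OF norm_ge_zero assms(3)] by blast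
  then have "norm (f x * g x) \<le> norm (K * norm (f x))" for x
    using mult_right_mono[OF assms(3), of "cmod (f x)" x] by (simp add: norm_mult mult.commute)
  then show "AE x in torus. norm (f x * g x) \<le> norm (K * norm (f x))" by simp
qed

lemma integrable_mult_mode:
  assumes "integrable torus f"
  shows "integrable torus (\<lambda>x. f x * fourier_mode j x)"
  by (rule integrable_mult_bounded[OF assms measurable_fourier_mode, of _ 1]) simp

lemma L2_torus_diff:
  assumes "f \<in> L2_torus" "g \<in> L2_torus"
  shows "(\<lambda>x. f x - g x) \<in> L2_torus"
  unfolding L2_torus_def
proof safe
  note [measurable] = L2_torusD(1)[OF assms(1)] L2_torusD(1)[OF assms(2)]
  show "(\<lambda>x. f x - g x) \<in> borel_measurable torus" by measurable
  show "integrable torus (\<lambda>x. (cmod (f x - g x))\<^sup>2)"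
  proof (rule Bochner_Integration.integrable_bound)
    show "integrable torus (\<lambda>x. 2 * (cmod (f x))\<^sup>2 + 2 * (cmod (g x))\<^sup>2)"
      using L2_torusD(2) assms by simp
    have "norm ((cmod (f x - g x))\<^sup>2) \<le> norm (2 * (cmod (f x))\<^sup>2 + 2 * (cmod (g x))\<^sup>2)" for x
      using cmod_sq_add_le[of "f x" "- g x"] by simp
    then show "AE x in torus. norm ((cmod (f x - g x))\<^sup>2) \<le> norm (2 * (cmod (f x))\<^sup>2 + 2 * (cmod (g x))\<^sup>2)" by simp
  qed measurable
qed

lemma fourier_coeff_diff:
  assumes "f \<in> L2_torus" "g \<in> L2_torus"
  shows "fourier_coeff (\<lambda>x. f x - g x) j = fourier_coeff f j - fourier_coeff g j"
  unfolding fourier_coeff_def left_diff_distrib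
  using integrable_mult_mode[OF integrable_L2_torus[OF assms(1)], of j] integrable_mult_mode[OF integrable_L2_torus[OF assms(2)], of j]
  by (simp add: right_diff_distrib)

lemma integral_fourier_mode:
  "(LINT x|torus. fourier_mode m x) = (if m = 0 then of_real (2 * pi) else 0)"
proof -
  interpret finite_measure torus by (rule finite_measure_torus)
  have "integrable torus (fourier_mode m)"
    using integrable_mult_mode[of "\<lambda>x. 1" m] by simp
  then have "(LINT x|torus. fourier_mode m x) = integral {-pi..<pi} (fourier_mode m)"
    unfolding torus_def by (intro lebesgue_integral_eq_integral) auto
  also have "((fourier_mode m) has_integral (if m = 0 then of_real (2 * pi) else 0)) {-pi..<pi}"
  proof (subst has_integral_spike_set_eq)
    show "((fourier_mode m) has_integral (if m = 0 then of_real (2 * pi) else 0)) {-pi..pi}"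
      using has_integral_exp_int[of m "- pi"] by simp
    show "negligible {x \<in> {- pi..<pi} - {- pi..pi}. fourier_mode m x \<noteq> 0}"
      by (rule negligible_subset[of "{}"]) auto
    show "negligible {x \<in> {- pi..pi} - {- pi..<pi}. fourier_mode m x \<noteq> 0}"
      by (rule negligible_subset[of "{pi}"]) auto
  qed
  then have "integral {-pi..<pi} (fourier_mode m) = (if m = 0 then of_real (2 * pi) else 0)"
    by (rule integral_unique)
  finally show ?thesis .
qed

text \<open>Expansion of 0 \<le> \<integral> |f - p|^2 for the Fourier polynomial p. Applied to
  differences of u at two times, it turns continuity in L^2 into continuity of the coefficients in
  l^2.\<close>

lemma bessel_inequality:
  assumes f: "f \<in> L2_torus" and A: "finite A"
  shows "(\<Sum>j\<in>A. (cmod (fourier_coeff f j))\<^sup>2) \<le> 1 / (2 * pi) * (LINT x|torus. (cmod (f x))\<^sup>2)"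
proof -
  interpret finite_measure torus by (rule finite_measure_torus)
  define c where "c = fourier_coeff f"
  define p where "p x = (\<Sum>j\<in>A. c j * cnj (fourier_mode j x))" for x
  define S where "S = (\<Sum>j\<in>A. (cmod (c j))\<^sup>2)"
  have c: "(LINT x|torus. f x * fourier_mode j x) = of_real (2 * pi) * c j" for j
    by (simp add: c_def fourier_coeff_def)
  note fi = integrable_mult_mode[OF integrable_L2_torus[OF f]]
  have mode_i: "integrable torus (fourier_mode m)" for m
    using integrable_mult_mode[of "\<lambda>x. 1" m] by simp
  have fp: "f x * cnj (p x) = (\<Sum>j\<in>A. cnj (c j) * (f x * fourier_mode j x))" for x
    by (simp add: p_def sum_distrib_left mult_ac)
  have fp_i: "integrable torus (\<lambda>x. f x * cnj (p x))"
    unfolding fp by (intro Bochner_Integration.integrable_sum integrable_mult_right fi)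
  have fp_v: "(LINT x|torus. f x * cnj (p x)) = of_real (2 * pi * S)"
  proof -
    have "(LINT x|torus. f x * cnj (p x)) = (\<Sum>j\<in>A. cnj (c j) * (of_real (2 * pi) * c j))"
      unfolding fp c[symmetric] by (simp only: Bochner_Integration.integral_sum integrable_mult_right fi integral_mult_right_zero)
    also have "\<dots> = (\<Sum>j\<in>A. of_real (2 * pi) * (c j * cnj (c j)))" by (simp add: mult_ac)
    also have "\<dots> = (\<Sum>j\<in>A. of_real (2 * pi) * of_real ((cmod (c j))\<^sup>2))" by (simp only: complex_norm_square)
    finally show ?thesis by (simp add: S_def sum_distrib_left)
  qed
  have pp: "p x * cnj (p x) = (\<Sum>j\<in>A. \<Sum>k\<in>A. c j * cnj (c k) * fourier_mode (k - j) x)" for x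
  proof -
    have "cnj (fourier_mode j x) * fourier_mode k x = fourier_mode (k - j) x" for j k
      by (simp add: exp_cnj exp_add[symmetric] algebra_simps)
    then have eq: "c j * cnj (c k) * fourier_mode (k - j) x = (c j * cnj (fourier_mode j x)) * cnj (c k * cnj (fourier_mode k x))" for j k
      by (metis (no_types, lifting) complex_cnj_cnj complex_cnj_mult mult.assoc mult.left_commute)
    show ?thesis unfolding p_def cnj_sum sum_product by (intro sum.cong refl eq[symmetric])
  qed
  have pp_i: "integrable torus (\<lambda>x. p x * cnj (p x))"
    unfolding pp by (intro Bochner_Integration.integrable_sum integrable_mult_right mode_i)
  have pp_v: "(LINT x|torus. p x * cnj (p x)) = of_real (2 * pi * S)"
  proof -
    have "(LINT x|torus. p x * cnj (p x)) = (\<Sum>j\<in>A. \<Sum>k\<in>A. c j * cnj (c k) * (LINT x|torus. fourier_mode (k - j) x))"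
      unfolding pp by (simp only: Bochner_Integration.integral_sum Bochner_Integration.integrable_sum
        integrable_mult_right mode_i integral_mult_right_zero)
    also have "\<dots> = (\<Sum>j\<in>A. \<Sum>k\<in>A. if j = k then of_real (2 * pi) * (c j * cnj (c j)) else 0)"
      unfolding integral_fourier_mode by (intro sum.cong refl) auto
    also have "\<dots> = (\<Sum>j\<in>A. of_real (2 * pi) * (c j * cnj (c j)))"
      using A by (simp add: sum.delta)
    also have "\<dots> = (\<Sum>j\<in>A. of_real (2 * pi) * of_real ((cmod (c j))\<^sup>2))" by (simp only: complex_norm_square)
    finally show ?thesis by (simp add: S_def sum_distrib_left)
  qed
  have sq: "(cmod (f x - p x))\<^sup>2 = (cmod (f x))\<^sup>2 - 2 * Re (f x * cnj (p x)) + Re (p x * cnj (p x))" for x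
    unfolding cmod_power2 by (simp add: power2_eq_square algebra_simps)
  have "0 \<le> (LINT x|torus. (cmod (f x - p x))\<^sup>2)" by (intro integral_nonneg_AE) auto
  also have "\<dots> = (LINT x|torus. (cmod (f x))\<^sup>2) - 2 * Re (LINT x|torus. f x * cnj (p x)) + Re (LINT x|torus. p x * cnj (p x))"
  proof -
    have "(LINT x|torus. a x - 2 * Re (g x) + Re (h x)) = (LINT x|torus. a x) - 2 * Re (LINT x|torus. g x) + Re (LINT x|torus. h x)"
      if "integrable torus a" "integrable torus g" "integrable torus h" for a :: "real \<Rightarrow> real" and g h :: "real \<Rightarrow> complex"
      using that by simp
    from this[OF L2_torusD(2)[OF f] fp_i pp_i] show ?thesis unfolding sq .
  qed
  also have "\<dots> = (LINT x|torus. (cmod (f x))\<^sup>2) - 2 * pi * S" unfolding fp_v pp_v by simp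
  finally show ?thesis by (simp add: S_def c_def field_simps)
qed

lemma bessel_infsum:
  assumes f: "f \<in> L2_torus"
  shows "sq_summable (fourier_coeff f)"
    "(\<Sum>\<^sub>\<infinity>j. (cmod (fourier_coeff f j))\<^sup>2) \<le> 1 / (2 * pi) * (LINT x|torus. (cmod (f x))\<^sup>2)"
proof -
  show s: "sq_summable (fourier_coeff f)"
    by (rule nonneg_bdd_above_summable_on) (auto intro!: bdd_aboveI2 bessel_inequality[OF f])
  show "(\<Sum>\<^sub>\<infinity>j. (cmod (fourier_coeff f j))\<^sup>2) \<le> 1 / (2 * pi) * (LINT x|torus. (cmod (f x))\<^sup>2)"
    by (rule infsum_le_finite_sums[OF s bessel_inequality[OF f]])
qed

text \<open>The weak formulation carries the derivatives of the test function along, so the whole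
  tower is supplied; its second member is -j^2 times the mode and yields the free energy.\<close>

lemma test_function_mode: "test_function (\<lambda>k x. (- \<i> * of_int j) ^ k * fourier_mode j x)"
  unfolding test_function_def
proof (intro conjI allI)
  fix k x
  have "((\<lambda>z. (- \<i> * of_int j) ^ k * exp (- \<i> * of_int j * z)) has_field_derivative
     (- \<i> * of_int j) ^ Suc k * exp (- \<i> * of_int j * of_real x)) (at (of_real x))"
    by (auto intro!: derivative_eq_intros)
  then show "((\<lambda>x. (- \<i> * of_int j) ^ k * fourier_mode j x) has_vector_derivative (- \<i> * of_int j) ^ Suc k * fourier_mode j x) (at x)"
    by (rule has_vector_derivative_real_field)
  show "(- \<i> * of_int j) ^ 0 * fourier_mode j (x + 2 * pi) = (- \<i> * of_int j) ^ 0 * fourier_mode j x"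
    using exp_neg_int_mult_2pi[of j "of_real x"] by (simp only: of_real_add)
qed

section \<open>The equation in Fourier coefficients\<close>

context exp_potential
begin

text \<open>The convolution formula. The Fourier series of v converges uniformly in x, with
  remainder bounded by the tail of a summable majorant, so it may be integrated against the
  integrable function u.\<close>

lemma fourier_coeff_potential_mult:
  assumes V: "\<And>x. ((\<lambda>m. W m (of_real t) * exp (\<i> * of_int m * of_real x)) has_sum v x) UNIV"
    and vc: "continuous_on UNIV v" and u: "u \<in> L2_torus"
  shows "(LINT x|torus. u x * (v x * fourier_mode j x))
    = of_real (2 * pi) * (\<Sum>\<^sub>\<infinity>k. W (j - k) (of_real t) * fourier_coeff u k)"
proof -
  define b where "b m = B * exp (- \<theta> * \<bar>real_of_int m\<bar>)" for m
  have b0: "b m \<ge> 0" for m using B by (simp add: b_def)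
  have Wb: "cmod (W m (of_real t)) \<le> b m" for m unfolding b_def by (rule bound[OF real_in_strip])
  have bsum: "b summable_on UNIV"
  proof -
    have "(\<lambda>m. complex_of_real (b m)) summable_on UNIV"
      by (rule summable_on_exp_abs_int[of _ B \<theta>]) (use B theta in \<open>auto simp: b_def norm_mult\<close>)
    then show ?thesis using summable_on_bounded_linear[OF bounded_linear_Re, of "\<lambda>m. complex_of_real (b m)" UNIV] by (simp add: o_def)
  qed
  define T where "T = infsum b UNIV"
  have bT: "(b has_sum T) UNIV" unfolding T_def by (rule has_sum_infsum[OF bsum])
  note ui = integrable_L2_torus[OF u]
  define P where "P G x = (\<Sum>m\<in>G. W m (of_real t) * exp (\<i> * of_int m * of_real x))" for G x
  have approx: "cmod (v x - P G x) \<le> T - sum b G" if G: "finite G" for G x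
  proof -
    have "((\<lambda>m. W m (of_real t) * exp (\<i> * of_int m * of_real x)) has_sum (v x - P G x)) (UNIV - G)"
      unfolding P_def by (rule has_sum_Diff[OF V]) (use G in auto)
    moreover have "(b has_sum (T - sum b G)) (UNIV - G)"
      by (rule has_sum_Diff[OF bT]) (use G in auto)
    moreover have "cmod (W m (of_real t) * exp (\<i> * of_int m * of_real x)) \<le> b m" for m
      using Wb[of m] by (simp add: norm_mult)
    ultimately show ?thesis by (rule norm_infsum_le)
  qed
  have T0: "T \<ge> 0" unfolding T_def by (rule infsum_nonneg) (rule b0)
  have vb: "cmod (v x) \<le> T" for x using approx[of "{}" x] by (simp add: P_def)
  have vm: "(\<lambda>x. v x * fourier_mode j x) \<in> borel_measurable torus"
    using measurable_continuous_torus[OF vc] by measurable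
  have uvi: "integrable torus (\<lambda>x. u x * (v x * fourier_mode j x))"
    by (rule integrable_mult_bounded[OF ui vm, of T]) (use vb in \<open>simp add: norm_mult\<close>)
  have mode: "u x * (exp (\<i> * of_int m * of_real x) * fourier_mode j x) = u x * fourier_mode (j - m) x" for x m
    by (simp add: exp_add[symmetric] algebra_simps)
  have PG_eq: "u x * (P G x * fourier_mode j x) = (\<Sum>m\<in>G. W m (of_real t) * (u x * fourier_mode (j - m) x))" for G x
    unfolding P_def sum_distrib_left sum_distrib_right mode[symmetric] by (intro sum.cong refl) (simp only: mult_ac)
  have PG_i: "integrable torus (\<lambda>x. u x * (P G x * fourier_mode j x))" for G
    unfolding PG_eq by (intro Bochner_Integration.integrable_sum integrable_mult_right integrable_mult_mode ui)
  define h where "h m = W m (of_real t) * fourier_coeff u (j - m)" for m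
  have PG_v: "(LINT x|torus. u x * (P G x * fourier_mode j x)) = of_real (2 * pi) * sum h G" for G
  proof -
    have "(LINT x|torus. u x * (P G x * fourier_mode j x)) = (\<Sum>m\<in>G. W m (of_real t) * (LINT x|torus. u x * fourier_mode (j - m) x))"
      unfolding PG_eq by (simp only: Bochner_Integration.integral_sum integrable_mult_right integrable_mult_mode[OF ui] integral_mult_right_zero)
    then show ?thesis by (simp add: h_def fourier_coeff_def sum_distrib_left mult_ac)
  qed
  define I where "I = (LINT x|torus. u x * (v x * fourier_mode j x))"
  define N1 where "N1 = (LINT x|torus. cmod (u x))"
  have est: "norm (of_real (2 * pi) * sum h G - I) \<le> (T - sum b G) * N1" if G: "finite G" for G
  proof -
    define D where "D = (\<lambda>x. u x * (v x * fourier_mode j x) - u x * (P G x * fourier_mode j x))"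
    have Di: "integrable torus D" unfolding D_def by (rule Bochner_Integration.integrable_diff[OF uvi PG_i])
    have Dle: "cmod (D x) \<le> (T - sum b G) * cmod (u x)" for x
    proof -
      have "D x = (v x - P G x) * u x * fourier_mode j x" by (simp add: D_def algebra_simps)
      then show ?thesis
        using mult_right_mono[OF approx[OF G, of x], of "cmod (u x)"] by (simp add: norm_mult)
    qed
    have "I - of_real (2 * pi) * sum h G = (LINT x|torus. D x)"
      unfolding I_def PG_v[symmetric] D_def by (rule Bochner_Integration.integral_diff[symmetric, OF uvi PG_i])
    also have "norm \<dots> \<le> (LINT x|torus. norm (D x))" by (rule integral_norm_bound)
    also have "\<dots> \<le> (LINT x|torus. (T - sum b G) * cmod (u x))"
      using Di ui Dle by (intro Bochner_Integration.integral_mono) auto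
    also have "\<dots> = (T - sum b G) * N1" by (simp add: N1_def)
    finally show ?thesis by (simp add: norm_minus_commute)
  qed
  have "((\<lambda>G. (T - sum b G) * N1) \<longlongrightarrow> (T - T) * N1) (finite_subsets_at_top UNIV)"
    using bT unfolding has_sum_def by (intro tendsto_intros)
  then have lim: "((\<lambda>G. (T - sum b G) * N1) \<longlongrightarrow> 0) (finite_subsets_at_top UNIV)" by simp
  have "\<forall>\<^sub>F G in finite_subsets_at_top UNIV. norm (of_real (2 * pi) * sum h G - I) \<le> (T - sum b G) * N1"
    by (rule eventually_finite_subsets_at_top_weakI) (rule est)
  then have "((\<lambda>G. of_real (2 * pi) * sum h G - I) \<longlongrightarrow> 0) (finite_subsets_at_top UNIV)"
    using lim by (rule Lim_null_comparison)
  then have "((\<lambda>m. of_real (2 * pi) * h m) has_sum I) UNIV"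
    unfolding has_sum_def sum_distrib_left[symmetric] by (rule LIM_zero_cancel)
  \<comment> \<open>The sum so far runs over the frequency m of the potential; k = j - m is the
    frequency of u.\<close>
  moreover have "bij_betw (\<lambda>k. j - k) UNIV UNIV"
    by (rule bij_betw_byWitness[of _ "\<lambda>k. j - k"]) auto
  ultimately have "((\<lambda>k. of_real (2 * pi) * h (j - k)) has_sum I) UNIV"
    by (simp only: has_sum_reindex_bij_betw[of "\<lambda>k. j - k" UNIV UNIV "\<lambda>m. of_real (2 * pi) * h m"])
  then have "(\<Sum>\<^sub>\<infinity>k. of_real (2 * pi) * h (j - k)) = I" by (rule infsumI)
  then show ?thesis by (simp only: I_def h_def infsum_cmult_right' diff_diff_eq2 add_diff_cancel_left')
qed

text \<open>Testing the equation against a single mode gives the equation for one coefficient, at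
  every time, and Bessel's inequality supplies the continuity in l^2.\<close>

lemma flow_of_solution:
  assumes V: "\<And>x t. ((\<lambda>m. W m (of_real t) * exp (\<i> * of_int m * of_real x)) has_sum of_real (V x t)) UNIV"
    and Vc: "\<And>t. continuous_on UNIV (\<lambda>x. complex_of_real (V x t))"
    and sol: "schrodinger_solution V u0 u"
  shows "flow (\<lambda>j t. fourier_coeff (u t) j)"
  unfolding flow_def
proof (intro conjI allI)
  have L2: "u t \<in> L2_torus" for t using sol by (simp add: schrodinger_solution_def)
  show "sq_summable (\<lambda>j. fourier_coeff (u t) j)" for t by (rule bessel_infsum(1)[OF L2])
  fix t0
  have "((\<lambda>t. LINT x|torus. (cmod (u t x - u t0 x))\<^sup>2) \<longlongrightarrow> 0) (at t0)"
    using sol by (simp add: schrodinger_solution_def)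
  then have lim: "((\<lambda>t. 1 / (2 * pi) * (LINT x|torus. (cmod (u t x - u t0 x))\<^sup>2)) \<longlongrightarrow> 0) (at t0)"
    by (rule tendsto_mult_right_zero)
  show "((\<lambda>t. \<Sum>\<^sub>\<infinity>j. (cmod (fourier_coeff (u t) j - fourier_coeff (u t0) j))\<^sup>2) \<longlongrightarrow> 0) (at t0)"
  proof (rule Lim_null_comparison[OF always_eventually lim], rule allI)
    fix t
    have "(\<Sum>\<^sub>\<infinity>j. (cmod (fourier_coeff (u t) j - fourier_coeff (u t0) j))\<^sup>2) \<ge> 0" by (rule infsum_nonneg) auto
    then show "norm (\<Sum>\<^sub>\<infinity>j. (cmod (fourier_coeff (u t) j - fourier_coeff (u t0) j))\<^sup>2) \<le> 1 / (2 * pi) * (LINT x|torus. (cmod (u t x - u t0 x))\<^sup>2)"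
      using bessel_infsum(2)[OF L2_torus_diff[OF L2[of t] L2[of t0]]] by (simp add: fourier_coeff_diff[OF L2 L2])
  qed
next
  fix j t
  have u: "u t \<in> L2_torus" using sol by (simp add: schrodinger_solution_def)
  define S where "S = (\<Sum>\<^sub>\<infinity>k. W (j - k) (of_real t) * fourier_coeff (u t) k)"
  obtain d where d: "((\<lambda>\<tau>. LINT x|torus. u \<tau> x * ((- \<i> * of_int j) ^ 0 * fourier_mode j x)) has_vector_derivative d) (at t)"
    and id: "\<i> * d = (LINT x|torus. u t x * (- ((- \<i> * of_int j) ^ 2 * fourier_mode j x) + of_real (V x t) * ((- \<i> * of_int j) ^ 0 * fourier_mode j x)))"
    using sol test_function_mode[of j] unfolding schrodinger_solution_def by blast
  have d1: "((\<lambda>\<tau>. fourier_coeff (u \<tau>) j) has_vector_derivative of_real (1 / (2 * pi)) * d) (at t)"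
    unfolding fourier_coeff_def using has_vector_derivative_mult_right[OF d, of "of_real (1 / (2 * pi))"] by simp
  have vm: "(\<lambda>x. of_real (V x t) * fourier_mode j x) \<in> borel_measurable torus"
    using measurable_continuous_torus[OF Vc] by measurable
  obtain K where K: "\<And>x. cmod (of_real (V x t)) \<le> K"
  proof -
    have "cmod (of_real (V x t)) \<le> B * geo \<theta>" for x
    proof (rule has_sum_norm_le[OF V])
      fix G :: "int set" assume G: "finite G"
      have "cmod (\<Sum>m\<in>G. W m (of_real t) * exp (\<i> * of_int m * of_real x)) \<le> (\<Sum>m\<in>G. B * exp (- \<theta> * \<bar>real_of_int (0 - m)\<bar>))"
        using bound[OF real_in_strip] by (intro sum_norm_le) (simp add: norm_mult)
      also have "\<dots> \<le> B * geo \<theta>"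
        unfolding sum_distrib_left[symmetric] using B by (intro mult_left_mono sum_exp_abs_le_geo theta G) auto
      finally show "cmod (\<Sum>m\<in>G. W m (of_real t) * exp (\<i> * of_int m * of_real x)) \<le> B * geo \<theta>" .
    qed
    then show thesis by (rule that)
  qed
  have "\<i> * d = (LINT x|torus. of_int (j\<^sup>2) * (u t x * fourier_mode j x) + u t x * (of_real (V x t) * fourier_mode j x))"
    unfolding id by (rule Bochner_Integration.integral_cong) (auto simp: power2_eq_square algebra_simps)
  also have "\<dots> = of_int (j\<^sup>2) * (LINT x|torus. u t x * fourier_mode j x) + (LINT x|torus. u t x * (of_real (V x t) * fourier_mode j x))"
  proof (subst Bochner_Integration.integral_add)
    show "integrable torus (\<lambda>x. of_int (j\<^sup>2) * (u t x * fourier_mode j x))"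
      by (intro integrable_mult_right integrable_mult_mode integrable_L2_torus u)
    show "integrable torus (\<lambda>x. u t x * (of_real (V x t) * fourier_mode j x))"
      by (rule integrable_mult_bounded[OF integrable_L2_torus[OF u] vm, of K]) (use K in \<open>simp add: norm_mult\<close>)
  qed (simp only: integral_mult_right_zero)
  also have "(LINT x|torus. u t x * (of_real (V x t) * fourier_mode j x)) = of_real (2 * pi) * S"
    unfolding S_def by (rule fourier_coeff_potential_mult[OF V Vc u])
  also have "(LINT x|torus. u t x * fourier_mode j x) = of_real (2 * pi) * fourier_coeff (u t) j"
    by (simp add: fourier_coeff_def)
  finally have "\<i> * d = of_real (2 * pi) * (of_int (j\<^sup>2) * fourier_coeff (u t) j + S)"
    by (simp add: algebra_simps)
  then have "- \<i> * (\<i> * d) = - \<i> * (of_real (2 * pi) * (of_int (j\<^sup>2) * fourier_coeff (u t) j + S))" by simp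
  then have "d = of_real (2 * pi) * (- \<i> * (of_int (j\<^sup>2) * fourier_coeff (u t) j + S))" by (simp add: algebra_simps)
  then have "of_real (1 / (2 * pi)) * d = - \<i> * (of_int (j\<^sup>2) * fourier_coeff (u t) j + S)" by simp
  with d1 show "((\<lambda>\<tau>. fourier_coeff (u \<tau>) j) has_vector_derivative
      - \<i> * (of_int (j\<^sup>2) * fourier_coeff (u t) j + (\<Sum>\<^sub>\<infinity>k. W (j - k) (of_real t) * fourier_coeff (u t) k))) (at t)"
    by (simp only: S_def)
qed

end

section \<open>Logarithmic growth of Sobolev norms\<close>

theorem mainTheorem1:
  fixes V :: "real \<Rightarrow> real \<Rightarrow> real"
  assumes "analytic_potential V"
  shows "\<exists>\<sigma>::real. \<sigma> > 3 \<and> (\<forall>s::real. s > 0 \<longrightarrow> (\<exists>C::real.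
           \<forall>u0 u. u0 \<in> sobolev s \<longrightarrow> schrodinger_solution V u0 u \<longrightarrow>
             (\<forall>t. u t \<in> sobolev s \<and>
                  sobolev_norm s (u t) \<le> C * ln (\<bar>t\<bar> + 2) powr (\<sigma> * s) * sobolev_norm s u0)))"
proof (rule exI[of _ 4], intro conjI allI impI)
  fix s :: real assume s: "s > 0"
  obtain W \<rho> \<theta> B where "exp_potential W \<rho> \<theta> B"
    and WV: "\<And>x t. ((\<lambda>m. W m (complex_of_real t) * exp (\<i> * of_int m * complex_of_real x)) has_sum complex_of_real (V x t)) UNIV"
    and Vc: "\<And>t. continuous_on UNIV (\<lambda>x. complex_of_real (V x t))"
    using analytic_potential_fourier[OF assms] by blast
  then interpret exp_potential W \<rho> \<theta> B by blast
  obtain C where C: "\<And>c t. flow c \<Longrightarrow> (\<lambda>j. sobolev_weight s j * (cmod (c j 0))\<^sup>2) summable_on UNIV \<Longrightarrow>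
    (\<lambda>j. sobolev_weight s j * (cmod (c j t))\<^sup>2) summable_on UNIV \<and>
    (\<Sum>\<^sub>\<infinity>j. sobolev_weight s j * (cmod (c j t))\<^sup>2)
      \<le> C * ln (\<bar>t\<bar> + 2) powr (2 * s) * (\<Sum>\<^sub>\<infinity>j. sobolev_weight s j * (cmod (c j 0))\<^sup>2)"
    using sobolev_growth[OF s] by blast
  show "\<exists>C. \<forall>u0 u. u0 \<in> sobolev s \<longrightarrow> schrodinger_solution V u0 u \<longrightarrow>
      (\<forall>t. u t \<in> sobolev s \<and> sobolev_norm s (u t) \<le> C * ln (\<bar>t\<bar> + 2) powr (4 * s) * sobolev_norm s u0)"
  \<comment> \<open>The square root of \<open>sobolev_growth\<close> gives the power s of the
    logarithm. Raising it to 4 s costs the constant ln 2 powr (-3 s), because the logarithm is at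
    least ln 2. The absolute value keeps the root of C meaningful, as no sign of C is
    recorded.\<close>
  proof (intro exI[of _ "sqrt \<bar>C\<bar> * ln 2 powr (- (3 * s))"] allI impI)
    fix u0 u and t :: real assume u0: "u0 \<in> sobolev s" and sol: "schrodinger_solution V u0 u"
    have L2: "u t \<in> L2_torus" for t using sol by (simp add: schrodinger_solution_def)
    have u0L2: "u0 \<in> L2_torus" using u0 by (simp add: sobolev_def)
    have init: "fourier_coeff (u 0) j = fourier_coeff u0 j" for j
    proof -
      note [measurable] = L2_torusD(1)[OF L2[of 0]] L2_torusD(1)[OF u0L2]
      have "AE x in torus. u 0 x = u0 x" using sol by (simp add: schrodinger_solution_def)
      then have "AE x in torus. u 0 x * fourier_mode j x = u0 x * fourier_mode j x"
        by eventually_elim simp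
      then have "(LINT x|torus. u 0 x * fourier_mode j x) = (LINT x|torus. u0 x * fourier_mode j x)"
        by (intro integral_cong_AE) measurable
      then show ?thesis by (simp only: fourier_coeff_def)
    qed
    note flow = flow_of_solution[OF WV Vc sol]
    define H where "H = (\<Sum>\<^sub>\<infinity>j. sobolev_weight s j * (cmod (fourier_coeff u0 j))\<^sup>2)"
    have H: "H \<ge> 0" unfolding H_def by (rule infsum_nonneg) (simp add: sobolev_weight_def)
    have sm: "(\<lambda>j. sobolev_weight s j * (cmod (fourier_coeff u0 j))\<^sup>2) summable_on UNIV"
      using u0 by (simp add: sobolev_def sobolev_weight_def)
    define \<Lambda> where "\<Lambda> = ln (\<bar>t\<bar> + 2)"
    have \<Lambda>: "\<Lambda> \<ge> ln 2" "\<Lambda> > 0" unfolding \<Lambda>_def by (auto intro!: ln_gt_zero)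
    have grow: "(\<lambda>j. sobolev_weight s j * (cmod (fourier_coeff (u t) j))\<^sup>2) summable_on UNIV"
      "(\<Sum>\<^sub>\<infinity>j. sobolev_weight s j * (cmod (fourier_coeff (u t) j))\<^sup>2) \<le> C * \<Lambda> powr (2 * s) * H"
      using C[OF flow, of t] sm by (auto simp: init H_def \<Lambda>_def)
    have "sobolev_norm s (u t) \<le> sqrt (\<bar>C\<bar> * \<Lambda> powr (2 * s) * H)"
      unfolding sobolev_norm_def
    proof (rule real_sqrt_le_mono)
      have "C * \<Lambda> powr (2 * s) * H \<le> \<bar>C\<bar> * \<Lambda> powr (2 * s) * H"
        using H by (intro mult_right_mono) auto
      with grow(2) show "(\<Sum>\<^sub>\<infinity>j. (1 + (real_of_int j)\<^sup>2) powr s * (cmod (fourier_coeff (u t) j))\<^sup>2) \<le> \<bar>C\<bar> * \<Lambda> powr (2 * s) * H"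
        by (simp add: sobolev_weight_def)
    qed
    also have "\<dots> = sqrt \<bar>C\<bar> * \<Lambda> powr s * sqrt H"
    proof -
      have "\<Lambda> powr (2 * s) = (\<Lambda> powr s)\<^sup>2" by (simp add: power2_eq_square powr_add[symmetric])
      then show ?thesis by (simp add: real_sqrt_mult)
    qed
    also have "\<Lambda> powr s \<le> ln 2 powr (- (3 * s)) * \<Lambda> powr (4 * s)"
    proof -
      have "\<Lambda> powr s = \<Lambda> powr (- (3 * s)) * \<Lambda> powr (4 * s)" by (simp add: powr_add[symmetric])
      also have "\<Lambda> powr (- (3 * s)) \<le> ln 2 powr (- (3 * s))" using \<Lambda> s by (intro powr_mono2') auto
      then have "\<Lambda> powr (- (3 * s)) * \<Lambda> powr (4 * s) \<le> ln 2 powr (- (3 * s)) * \<Lambda> powr (4 * s)"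
        by (intro mult_right_mono) auto
      finally show ?thesis .
    qed
    then have "sqrt \<bar>C\<bar> * \<Lambda> powr s * sqrt H \<le> sqrt \<bar>C\<bar> * (ln 2 powr (- (3 * s)) * \<Lambda> powr (4 * s)) * sqrt H"
      using H by (intro mult_right_mono mult_left_mono) auto
    finally have "sobolev_norm s (u t) \<le> sqrt \<bar>C\<bar> * ln 2 powr (- (3 * s)) * \<Lambda> powr (4 * s) * sqrt H"
      by (simp only: mult.assoc)
    moreover have "sqrt H = sobolev_norm s u0" by (simp add: H_def sobolev_norm_def sobolev_weight_def)
    moreover have "u t \<in> sobolev s" using L2 grow(1) by (simp add: sobolev_def sobolev_weight_def)
    ultimately show "u t \<in> sobolev s \<and> sobolev_norm s (u t)
        \<le> sqrt \<bar>C\<bar> * ln 2 powr (- (3 * s)) * ln (\<bar>t\<bar> + 2) powr (4 * s) * sobolev_norm s u0"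
      by (simp only: \<Lambda>_def)
  qed
qed simp

end
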